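(* Let $\xi$ be a simple point process on $\mathbb{R}^n$ having all finite moments and let $\{A_k\}$ be a balanced convex averaging sequence. If $\xi$ is stationary, then there exists a unique Radon measure $\mathfrak{P}$ on $\Delta$ such that $$\frac{\mathfrak{p}(A_k)}{\lambda_n(A_k)}\longrightarrow\mathfrak{P}\quad\text{vaguely as }k\to\infty,$$ where $\mathfrak{p}$ is the persistence diagram expectation measure corresponding to $\xi$.
   Context: $(\Omega,\mathcal{E},\mathbb{P})$ is a probability space, $\mathcal{B}^n_b$ the bounded Borel subsets of $\mathbb{R}^n$, $\lambda_n$ Lebesgue measure. A point process on $\mathbb{R}^n$ is a random integer-valued boundedly finite measure $\xi$; simple: a.s. all atoms are distinct; all finite moments: $\mathbb{E}[\xi(A)^k]<\infty$ for all $k\ge1$, $A\in\mathcal{B}^n_b$; stationary: distribution invariant under all translations. Standing assumption: $\mathbb{E}[\xi(A)]>0$ whenever $\lambda_n(A)>0$, $A\in\mathcal{B}^n_b$. $X_{\xi_\omega}(A)$ is the (a.s. finite) set of atoms of $\xi_\omega$ in $A$. $\Delta=\{(b,d)\in\mathbb{R}^2:b<d\}$. For a finite $X\subset\mathbb{R}^n$, $\mathrm{Dgm}_\ell(X)$ is the $\ell$-th persistence diagram (finite multiset of birth-death pairs $(b,d)\in\Delta$, zero-persistence pairs ignored; homology over a fixed field) of the filtration of Čech complexes $\check C_r(X)=\{\sigma\subseteq X:\bigcap_{x\in\sigma}B_r(x)\ne\emptyset\}$. For $A\in\mathcal{B}^n_b$, $\rho_\omega(A)=\sum_{x\in D}\delta_x$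 with $D=\bigcup_{\ell=0}^{n-1}\mathrm{Dgm}_\ell(X_{\xi_\omega}(A))$ (multiset union), and $\mathfrak{p}(A)=\mathbb{E}[\rho_\omega(A)]$, a Radon measure on $\Delta$; $\mathfrak p$ is the persistence diagram expectation measure. Vague convergence means convergence of integrals of all continuous compactly supported functions on $\Delta$. A convex averaging sequence is a sequence $\{A_k\}\subset\mathcal{B}^n_b$ with each $A_k$ convex, $A_k\subseteq A_{k+1}$, and $\sup\{r:A_k\text{ contains a ball of radius }r\}\to\infty$. It is balanced if $W_{n-1}(A_k)=O(\lambda_n(A_k)^{1/n})$ for sufficiently large $k$, where $W_i(C)=V(C,\dots,C,B_1(0),\dots,B_1(0))$ ($n-i$ copies of $C$, $i$ copies of the closed unit ball, $V$ the mixed volume) is the $i$-th quermassintegral. *)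

theory Defs
  imports
    "HOL-Probability.Probability"
    "HOL-Library.Multiset"
    "HOL-Library.Landau_Symbols"
    "HOL-Library.Function_Algebras"
begin

section \<open>Point processes\<close>

definition bounded_borel :: "'a::euclidean_space set set" where
  "bounded_borel = {A. bounded A \<and> A \<in> sets borel}"

text \<open>The measurable space of boundedly finite Borel measures, with the sigma-algebra generated by
  the evaluations at bounded Borel sets.\<close>

definition bdd_finite_measures :: "'a::euclidean_space measure set" where
  "bdd_finite_measures =
     {\<mu>. sets \<mu> = sets borel \<and> (\<forall>A\<in>bounded_borel. emeasure \<mu> A < \<infinity>)}"

definition measure_algebra :: "'a::euclidean_space measure measure" where
  "measure_algebra =
     (SUP A \<in> bounded_borel. vimage_algebra bdd_finite_measures (\<lambda>\<mu>. emeasure \<mu> A) borel)"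

definition point_process :: "'w measure \<Rightarrow> ('w \<Rightarrow> 'a::euclidean_space measure) \<Rightarrow> bool" where
  "point_process M \<xi> \<longleftrightarrow>
     \<xi> \<in> M \<rightarrow>\<^sub>M measure_algebra \<and>
     (\<forall>\<omega>\<in>space M. \<forall>A\<in>bounded_borel. \<exists>m::nat. emeasure (\<xi> \<omega>) A = of_nat m)"

definition simple_process :: "'w measure \<Rightarrow> ('w \<Rightarrow> 'a::euclidean_space measure) \<Rightarrow> bool" where
  "simple_process M \<xi> \<longleftrightarrow> (AE \<omega> in M. \<forall>x. emeasure (\<xi> \<omega>) {x} \<in> {0, 1})"

definition all_moments_finite :: "'w measure \<Rightarrow> ('w \<Rightarrow> 'a::euclidean_space measure) \<Rightarrow> bool" where
  "all_moments_finite M \<xi> \<longleftrightarrow>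
     (\<forall>k\<ge>(1::nat). \<forall>A\<in>bounded_borel. (\<integral>\<^sup>+ \<omega>. emeasure (\<xi> \<omega>) A ^ k \<partial>M) < \<infinity>)"

definition stationary :: "'w measure \<Rightarrow> ('w \<Rightarrow> 'a::euclidean_space measure) \<Rightarrow> bool" where
  "stationary M \<xi> \<longleftrightarrow>
     (\<forall>v. distr M measure_algebra (\<lambda>\<omega>. distr (\<xi> \<omega>) borel (\<lambda>x. x + v)) =
          distr M measure_algebra \<xi>)"

definition positive_intensity :: "'w measure \<Rightarrow> ('w \<Rightarrow> 'a::euclidean_space measure) \<Rightarrow> bool" where
  "positive_intensity M \<xi> \<longleftrightarrow>
     (\<forall>A\<in>bounded_borel. emeasure lborel A > 0 \<longrightarrow> (\<integral>\<^sup>+ \<omega>. emeasure (\<xi> \<omega>) A \<partial>M) > 0)"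

definition atoms_in :: "'a::euclidean_space measure \<Rightarrow> 'a set \<Rightarrow> 'a set" where
  "atoms_in \<mu> A = {x\<in>A. emeasure \<mu> {x} > 0}"


section \<open>Simplicial homology over a field\<close>

text \<open>Oriented chains: an \<open>l\<close>-chain of a simplicial complex \<open>K\<close> (a set of nonempty vertex sets) is a
  function on the orderings \<open>[v\<^sub>0, \<dots>, v\<^sub>l]\<close> of its \<open>l\<close>-simplices that changes sign when two vertices
  are swapped. The oriented simplex \<open>[v\<^sub>0, \<dots>, v\<^sub>l]\<close> is the chain with value \<open>1\<close> there and value
  \<open>0\<close> off its rearrangements.\<close>

definition chains :: "nat \<Rightarrow> 'v set set \<Rightarrow> ('v list \<Rightarrow> 'f::field) set" where
  "chains l K =
     {c. (\<forall>vs. c vs \<noteq> 0 \<longrightarrow> length vs = Suc l \<and> distinct vs \<and> set vs \<in> K) \<and>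
         (\<forall>vs i j. i < j \<and> j < length vs \<longrightarrow> c (vs[i := vs ! j, j := vs ! i]) = - c vs)}"

text \<open>This is \<open>\<partial>[v\<^sub>0, \<dots>, v\<^sub>l] = (\<Sum>i\<le>l. (-1)^i [\<dots>, v\<^sub>i omitted, \<dots>])\<close>: the ordering of the simplex
  with \<open>v\<^sub>i\<close> moved to the front has sign \<open>(-1)^i\<close>. The value at \<open>[]\<close> is \<open>0\<close> because homology is
  not reduced.\<close>

definition boundary :: "'v set set \<Rightarrow> ('v list \<Rightarrow> 'f::field) \<Rightarrow> 'v list \<Rightarrow> 'f" where
  "boundary K c = (\<lambda>vs. if vs = [] then 0 else (\<Sum>v\<in>\<Union>K. c (v # vs)))"

definition cycles :: "nat \<Rightarrow> 'v set set \<Rightarrow> ('v list \<Rightarrow> 'f::field) set" where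
  "cycles l K = {c \<in> chains l K. boundary K c = 0}"

definition boundaries :: "nat \<Rightarrow> 'v set set \<Rightarrow> ('v list \<Rightarrow> 'f::field) set" where
  "boundaries l K = boundary K ` chains (Suc l) K"

definition chain_scale :: "'f::field \<Rightarrow> ('v list \<Rightarrow> 'f) \<Rightarrow> 'v list \<Rightarrow> 'f" where
  "chain_scale a c = (\<lambda>vs. a * c vs)"

interpretation chain_space: vector_space chain_scale
  by unfold_locales (auto simp: chain_scale_def algebra_simps)

text \<open>The rank of \<open>H\<^sub>l(K) \<rightarrow> H\<^sub>l(L)\<close> for \<open>K \<subseteq> L\<close>. The image of this map is the persistent homology
  group \<open>Z\<^sub>l(K) / (Z\<^sub>l(K) \<inter> B\<^sub>l(L))\<close>.\<close>

definition persistent_betti :: "'f::field itself \<Rightarrow> nat \<Rightarrow> 'v set set \<Rightarrow> 'v set set \<Rightarrow> nat" where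
  "persistent_betti F l K L =
     chain_space.dim (cycles l K :: ('v list \<Rightarrow> 'f) set) -
     chain_space.dim (cycles l K \<inter> boundaries l L :: ('v list \<Rightarrow> 'f) set)"


section \<open>Persistence diagrams\<close>

definition Delta :: "(real \<times> real) set" where
  "Delta = {(b, d). b < d}"

text \<open>The multiplicity of \<open>(b, d)\<close> in the diagram of a filtration, in the form of Cohen-Steiner,
  Edelsbrunner and Harer: the number of classes that are born in \<open>(b - \<epsilon>, b + \<epsilon>]\<close> and die in
  \<open>(d - \<epsilon>, d + \<epsilon>]\<close>, which does not depend on \<open>\<epsilon>\<close> once \<open>\<epsilon>\<close> is small (for a filtration with
  finitely many critical values). Classes that never die have no pair in \<open>Delta\<close>.\<close>

definition persistence_multiplicity ::
    "'f::field itself \<Rightarrow> nat \<Rightarrow> (real \<Rightarrow> 'v set set) \<Rightarrow> real \<times> real \<Rightarrow> nat" where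
  "persistence_multiplicity F l K = (\<lambda>(b, d).
     let \<beta> = (\<lambda>r s. int (persistent_betti F l (K r) (K s)))
     in THE m. \<forall>\<^sub>F \<epsilon> in at_right 0.
          int m = (\<beta> (b + \<epsilon>) (d - \<epsilon>) - \<beta> (b - \<epsilon>) (d - \<epsilon>))
                - (\<beta> (b + \<epsilon>) (d + \<epsilon>) - \<beta> (b - \<epsilon>) (d + \<epsilon>)))"

definition persistence_diagram ::
    "'f::field itself \<Rightarrow> nat \<Rightarrow> (real \<Rightarrow> 'v set set) \<Rightarrow> (real \<times> real) multiset" where
  "persistence_diagram F l K =
     Abs_multiset (\<lambda>p. if p \<in> Delta then persistence_multiplicity F l K p else 0)"

definition cech :: "'a::euclidean_space set \<Rightarrow> real \<Rightarrow> 'a set set" where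
  "cech X r = {\<sigma>. \<sigma> \<noteq> {} \<and> \<sigma> \<subseteq> X \<and> (\<Inter>x\<in>\<sigma>. cball x r) \<noteq> {}}"

definition Dgm ::
    "'f::field itself \<Rightarrow> nat \<Rightarrow> 'a::euclidean_space set \<Rightarrow> (real \<times> real) multiset" where
  "Dgm F l X = persistence_diagram F l (cech X)"

definition mset_measure :: "(real \<times> real) multiset \<Rightarrow> (real \<times> real) measure" where
  "mset_measure D =
     measure_of Delta (sets (restrict_space borel Delta))
       (\<lambda>B. of_nat (size (filter_mset (\<lambda>x. x \<in> B) D)))"

definition persistence_diagram_measure ::
    "'f::field itself \<Rightarrow> ('w \<Rightarrow> 'a::euclidean_space measure) \<Rightarrow> 'w \<Rightarrow> 'a set \<Rightarrow>
      (real \<times> real) measure" where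
  "persistence_diagram_measure F \<xi> \<omega> A =
     mset_measure (\<Sum>l<DIM('a). Dgm F l (atoms_in (\<xi> \<omega>) A))"

definition persistence_expectation_measure ::
    "'f::field itself \<Rightarrow> 'w measure \<Rightarrow> ('w \<Rightarrow> 'a::euclidean_space measure) \<Rightarrow> 'a set \<Rightarrow>
      (real \<times> real) measure" where
  "persistence_expectation_measure F M \<xi> A =
     measure_of Delta (sets (restrict_space borel Delta))
       (\<lambda>B. \<integral>\<^sup>+ \<omega>. emeasure (persistence_diagram_measure F \<xi> \<omega> A) B \<partial>M)"


section \<open>Radon measures and vague convergence\<close>

definition radon_measure_on :: "'a::topological_space set \<Rightarrow> 'a measure \<Rightarrow> bool" where
  "radon_measure_on S \<mu> \<longleftrightarrow>
     sets \<mu> = sets (restrict_space borel S) \<and>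
     (\<forall>K. compact K \<and> K \<subseteq> S \<longrightarrow> emeasure \<mu> K < \<infinity>) \<and>
     (\<forall>B\<in>sets \<mu>. emeasure \<mu> B = (SUP K\<in>{K. compact K \<and> K \<subseteq> B}. emeasure \<mu> K))"

definition vague_convergence_on ::
    "'a::topological_space set \<Rightarrow> (nat \<Rightarrow> 'a measure) \<Rightarrow> 'a measure \<Rightarrow> bool" where
  "vague_convergence_on S \<mu> \<nu> \<longleftrightarrow>
     (\<forall>f::'a \<Rightarrow> real.
        continuous_on S f \<and> (\<exists>K. compact K \<and> K \<subseteq> S \<and> (\<forall>x\<in>S - K. f x = 0)) \<longrightarrow>
        (\<lambda>k. \<integral>x. f x \<partial>\<mu> k) \<longlonglongrightarrow> (\<integral>x. f x \<partial>\<nu>))"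


section \<open>Quermassintegrals\<close>

definition minkowski_combination ::
    "(nat \<Rightarrow> real) \<Rightarrow> 'a::euclidean_space set list \<Rightarrow> 'a set" where
  "minkowski_combination t Ks =
     {\<Sum>i<length Ks. t i *\<^sub>R x i | x. \<forall>i<length Ks. x i \<in> Ks ! i}"

text \<open>The mixed volume is the symmetric function that gives the coefficients of the polynomial
  \<open>vol (t\<^sub>1 K\<^sub>1 + \<dots> + t\<^sub>m K\<^sub>m)\<close> (Minkowski). Closedness is not required of the \<open>K\<^sub>i\<close>, because
  the sets of an averaging sequence need not be closed; taking closures does not change the
  volumes. A non-closed convex set need not be Borel, hence \<open>lebesgue\<close>.\<close>

definition bounded_convex_sets :: "'a::euclidean_space set set" where
  "bounded_convex_sets = {K. K \<noteq> {} \<and> bounded K \<and> convex K}"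

definition is_mixed_volume :: "('a::euclidean_space set list \<Rightarrow> real) \<Rightarrow> bool" where
  "is_mixed_volume V \<longleftrightarrow>
     (\<forall>Ks Ls. set Ks \<subseteq> bounded_convex_sets \<and> length Ks = DIM('a) \<and> mset Ks = mset Ls \<longrightarrow>
        V Ks = V Ls) \<and>
     (\<forall>Ks t. set Ks \<subseteq> bounded_convex_sets \<and> (\<forall>i<length Ks. t i \<ge> 0) \<longrightarrow>
        measure lebesgue (minkowski_combination t Ks) =
        (\<Sum>is | length is = DIM('a) \<and> set is \<subseteq> {..<length Ks}.
           prod_list (map t is) * V (map (\<lambda>i. Ks ! i) is)))"

definition mixed_volume :: "'a::euclidean_space set list \<Rightarrow> real" where
  "mixed_volume = (SOME V. is_mixed_volume V)"

definition quermassintegral :: "nat \<Rightarrow> 'a::euclidean_space set \<Rightarrow> real" where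
  "quermassintegral i C = mixed_volume (replicate (DIM('a) - i) C @ replicate i (cball 0 1))"


section \<open>Averaging sequences\<close>

definition convex_averaging_sequence :: "(nat \<Rightarrow> 'a::euclidean_space set) \<Rightarrow> bool" where
  "convex_averaging_sequence A \<longleftrightarrow>
     (\<forall>k. A k \<in> bounded_borel \<and> convex (A k) \<and> A k \<subseteq> A (Suc k)) \<and>
     (\<lambda>k. SUP r\<in>{r. 0 < r \<and> (\<exists>x. cball x r \<subseteq> A k)}. ereal r) \<longlonglongrightarrow> \<infinity>"

definition balanced :: "(nat \<Rightarrow> 'a::euclidean_space set) \<Rightarrow> bool" where
  "balanced A \<longleftrightarrow>
     (\<lambda>k. quermassintegral (DIM('a) - 1) (A k)) \<in>
       O(\<lambda>k. measure lborel (A k) powr (1 / real DIM('a)))"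

end

theory Submission
  imports Defs
begin

text \<open>
  \<^bold>\<open>Counting points of a diagram.\<close> For a finite set \<open>X\<close> let \<open>u(r, s)\<close> be the dimension of the space of relative
  \<open>(l + 1)\<close>-cycles of the pair formed by the Cech complexes at the radii \<open>s\<close> and \<open>r\<close>, that is, of the chains at
  radius \<open>s\<close> whose boundary lies in the complex at radius \<open>r\<close>. Rank-nullity for the boundary map expresses the
  persistent Betti number at \<open>(r, s)\<close> as \<open>z(r) + z'(s) - u(r, s)\<close>. Hence the number of points of the diagram
  in a rectangle \<open>{b1<..b2} \<times> {d1<..d2}\<close> with \<open>b2 \<le> d1\<close> is \<open>u(b2, d2) - u(b2, d1) - u(b1, d2) + u(b1, d1)\<close>
  (\<open>Dgm_rectangle\<close>): \<open>u\<close> plays the role of a distribution function of the diagram.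

  \<^bold>\<open>Averaging.\<close> The space of relative cycles is given by linear conditions that are local. If \<open>X\<close> is cut into
  blocks, then \<open>u(X)\<close> is at least the sum of \<open>u\<close> over the blocks, and it exceeds that sum by at most the number
  of ordered \<open>(l + 1)\<close>-simplices that lie in no block (\<open>rel_rank_blocks\<close>). Cut the space into cubes of side \<open>m\<close>.
  By stationarity every cube contributes the same expectation. A simplex at radius \<open>s\<close> that leaves its cube
  is near the surface of the cube, so by the moment bounds the expected number of such simplices is of
  order \<open>m ^ (n - 1)\<close> per cube. The volumes of the cubes inside a convex set and of those that meet it both
  agree with its volume up to a factor close to 1 if the set contains a ball that is large compared
  with \<open>m\<close>, because a parallel body is squeezed between homothetic copies. So the expectation of \<open>u\<close> per unit
  volume converges for all \<open>r\<close> and \<open>s\<close> (\<open>mean_rank_density_converges\<close>), and with it the mass of every half-open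
  rectangle whose closure avoids the diagonal.

  \<^bold>\<open>From rectangles to a measure.\<close> Countably many rational rectangles generate a tree of nested partitions of
  \<open>Delta\<close>. The limiting masses of the cells are additive along the tree, so they can be represented by nested
  intervals on the half-line. A point of the half-line selects a shrinking sequence of cells and thereby a
  point of \<open>Delta\<close>, and the limit measure is the image of Lebesgue measure under this map. A continuous function
  with compact support is nearly constant on the cells of a deep level, which gives vague convergence
  (\<open>vague_convergence_limit_measure\<close>). The limit is unique because a Radon measure is determined by the
  integrals of such functions (\<open>radon_measure_eqI\<close>).

  \<^bold>\<open>Measurability.\<close> Moving the points of \<open>X\<close> by a small \<open>\<delta>\<close> and enlarging both radii by \<open>\<delta>\<close> does not change \<open>u\<close>
  (\<open>rel_rank_perturb\<close>). So \<open>u\<close> of the atoms of a point process is a limit of functions of the set of occupied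
  cells of ever finer grids.
\<close>

section \<open>Rank-nullity for spaces of chains\<close>

text \<open>The space of all chains is infinite-dimensional; finiteness of dimensions always comes from a finite
  set \<open>W\<close> that spans the subspaces in question.\<close>

lemma (in vector_space) dim_mono_span:
  assumes "V \<subseteq> span W" "finite W" "U \<subseteq> V"
  shows "dim U \<le> dim V"
proof -
  obtain B where B: "B \<subseteq> V" "independent B" "V \<subseteq> span B" "card B = dim V"
    using basis_exists by blast
  obtain C where C: "C \<subseteq> U" "independent C" "U \<subseteq> span C" "card C = dim U"
    using basis_exists by blast
  have "finite B"
    using independent_span_bound[OF assms(2) B(2)] B(1) assms(1) by auto
  then have "card C \<le> card B"
    using independent_span_bound[OF _ C(2), of B] C(1) B(3) assms(3) by auto
  then show ?thesis using B(4) C(4) by simp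
qed

text \<open>The coordinates of \<open>x\<close> with respect to \<open>B\<close> vanish both outside \<open>A\<close> and on \<open>A\<close>.\<close>

lemma (in vector_space) independent_span_Int:
  assumes "independent B" "A \<subseteq> B" "x \<in> span A" "x \<in> span (B - A)"
  shows "x = 0"
proof -
  have 1: "representation B x = representation A x"
    using representation_extend[OF assms(1) assms(3) assms(2)] .
  have 2: "representation B x = representation (B - A) x"
    using representation_extend[OF assms(1) assms(4)] by blast
  have "representation B x b = 0" for b
    using 1 2 representation_ne_zero by (metis DiffD2)
  moreover have "x \<in> span B" using span_mono[OF assms(2)] assms(3) by blast
  ultimately show ?thesis
    using sum_nonzero_representation_eq[OF assms(1), of x] by simp
qed

text \<open>A basis \<open>A\<close> of the kernel is extended to a basis \<open>B\<close> of \<open>V\<close>. An element of the kernel that lies in the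
  span of \<open>B - A\<close> also lies in the span of \<open>A\<close> and is therefore \<open>0\<close>; so \<open>f\<close> is injective on the span of
  \<open>B - A\<close>, whose image is all of \<open>f ` V\<close>.\<close>

lemma (in vector_space_pair) rank_nullity:
  assumes f: "Vector_Spaces.linear s1 s2 f" and V: "vs1.subspace V"
    and W: "V \<subseteq> vs1.span W" "finite W"
  shows "vs1.dim V = vs1.dim {x\<in>V. f x = 0} + vs2.dim (f ` V)"
proof -
  define K where "K = {x\<in>V. f x = 0}"
  obtain A where A: "A \<subseteq> K" "vs1.independent A" "K \<subseteq> vs1.span A" "card A = vs1.dim K"
    using vs1.basis_exists by blast
  have "A \<subseteq> V" using A(1) K_def by auto
  then obtain B where B: "A \<subseteq> B" "B \<subseteq> V" "vs1.independent B" "V \<subseteq> vs1.span B"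
    using vs1.maximal_independent_subset_extend[OF _ A(2)] by blast
  have finB: "finite B"
    using vs1.independent_span_bound[OF W(2) B(3)] B(2) W(1) by auto
  have spV: "vs1.span B \<subseteq> V" using B(2) V vs1.span_minimal by blast
  let ?D = "B - A"
  have inj: "inj_on f (vs1.span ?D)"
    unfolding linear_inj_on_iff_eq_0[OF f vs1.subspace_span]
  proof (intro ballI impI)
    fix x assume x: "x \<in> vs1.span ?D" "f x = 0"
    have "x \<in> V" using x(1) vs1.span_mono[of ?D B] spV by blast
    with x have "x \<in> vs1.span A" using A(3) K_def by blast
    then show "x = 0" using vs1.independent_span_Int[OF B(3) B(1)] x(1) by blast
  qed
  have ind: "vs2.independent (f ` ?D)"
    by (rule linear_independent_injective_image[OF f vs1.independent_mono[OF B(3) Diff_subset] inj])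
  have "f ` V \<subseteq> vs2.span (f ` ?D)"
  proof -
    have "f ` V \<subseteq> vs2.span (f ` B)"
      using linear_span_image[OF f] B(4) by auto
    also have "f ` B \<subseteq> insert 0 (f ` ?D)" using A(1) K_def by auto
    then have "vs2.span (f ` B) \<subseteq> vs2.span (f ` ?D)"
      using vs2.span_mono vs2.span_insert_0 by metis
    finally show ?thesis .
  qed
  moreover have "f ` ?D \<subseteq> f ` V" using B(2) by auto
  ultimately have "vs2.dim (f ` V) = card (f ` ?D)"
    using vs2.basis_card_eq_dim ind by metis
  also have "\<dots> = card ?D"
    using inj_on_subset[OF inj vs1.span_superset] by (rule card_image)
  finally have "vs2.dim (f ` V) = card B - card A"
    using card_Diff_subset[of A B] finB finite_subset B(1) by metis
  moreover have "vs1.dim V = card B"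
    using vs1.basis_card_eq_dim B by metis
  moreover have "card A \<le> card B" using B(1) finB card_mono by blast
  ultimately show ?thesis using A(4) K_def by simp
qed

definition supported :: "'v list set \<Rightarrow> ('v list \<Rightarrow> 'f::field) set" where
  "supported S = {c. \<forall>vs. c vs \<noteq> 0 \<longrightarrow> vs \<in> S}"

definition restrict_chain :: "'v list set \<Rightarrow> ('v list \<Rightarrow> 'f::field) \<Rightarrow> 'v list \<Rightarrow> 'f" where
  "restrict_chain S c = (\<lambda>vs. if vs \<in> S then c vs else 0)"

lemma sum_fun_apply: "(\<Sum>x\<in>A. g x) y = (\<Sum>x\<in>A. g x y)"
  by (induction A rule: infinite_finite_induct) (auto simp: zero_fun_def)

interpretation chain_pair: vector_space_pair
  "chain_scale :: 'f::field \<Rightarrow> ('v list \<Rightarrow> 'f) \<Rightarrow> 'v list \<Rightarrow> 'f"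
  "chain_scale :: 'f::field \<Rightarrow> ('w list \<Rightarrow> 'f) \<Rightarrow> 'w list \<Rightarrow> 'f"
  by unfold_locales

lemma supported_in_span:
  fixes S :: "'v list set"
  assumes "finite S"
  shows "\<exists>W::('v list \<Rightarrow> 'f::field) set. finite W \<and> card W \<le> card S \<and> supported S \<subseteq> chain_space.span W"
proof -
  define e :: "'v list \<Rightarrow> 'v list \<Rightarrow> 'f" where "e v = (\<lambda>w. if w = v then 1 else 0)" for v
  have "c \<in> chain_space.span (e ` S)" if "c \<in> supported S" for c
  proof -
    have "c = (\<Sum>v\<in>S. chain_scale (c v) (e v))"
    proof
      fix w
      have "(\<Sum>v\<in>S. chain_scale (c v) (e v)) w = (\<Sum>v\<in>S. if v = w then c w else 0)"
        unfolding sum_fun_apply by (intro sum.cong) (auto simp: chain_scale_def e_def)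
      also have "\<dots> = c w"
        using assms that by (auto simp: supported_def)
      finally show "c w = (\<Sum>v\<in>S. chain_scale (c v) (e v)) w" by simp
    qed
    also have "\<dots> \<in> chain_space.span (e ` S)"
      by (intro chain_space.span_sum chain_space.span_scale chain_space.span_base) auto
    finally show ?thesis .
  qed
  then show ?thesis
    using assms by (intro exI[of _ "e ` S"]) (auto intro: card_image_le)
qed

lemma dim_supported_mono:
  assumes "finite S" "V \<subseteq> supported S" "U \<subseteq> V"
  shows "chain_space.dim U \<le> chain_space.dim (V :: ('v list \<Rightarrow> 'f::field) set)"
proof -
  obtain W :: "('v list \<Rightarrow> 'f) set" where W: "finite W" "supported S \<subseteq> chain_space.span W"
    using supported_in_span[OF assms(1), where 'f='f] by blast
  show ?thesis
    by (rule chain_space.dim_mono_span[OF subset_trans[OF assms(2) W(2)] W(1) assms(3)])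
qed

lemma dim_supported_le_card:
  assumes "finite S" "V \<subseteq> supported S"
  shows "chain_space.dim (V :: ('v list \<Rightarrow> 'f::field) set) \<le> card S"
proof -
  obtain W :: "('v list \<Rightarrow> 'f) set" where W: "finite W" "card W \<le> card S" "supported S \<subseteq> chain_space.span W"
    using supported_in_span[OF assms(1), where 'f='f] by blast
  show ?thesis
    using chain_space.dim_le_card[OF subset_trans[OF assms(2) W(3)] W(1)] W(2) by simp
qed

lemma rank_nullity_supported:
  fixes f :: "('v list \<Rightarrow> 'f::field) \<Rightarrow> 'w list \<Rightarrow> 'f"
  assumes "Vector_Spaces.linear chain_scale chain_scale f"
    and "chain_space.subspace V" and "finite S" "V \<subseteq> supported S"
  shows "chain_space.dim V = chain_space.dim {c\<in>V. f c = 0} + chain_space.dim (f ` V)"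
proof -
  obtain W :: "('v list \<Rightarrow> 'f) set" where W: "finite W" "supported S \<subseteq> chain_space.span W"
    using supported_in_span[OF assms(3), where 'f='f] by blast
  show ?thesis
    by (rule chain_pair.rank_nullity[OF assms(1,2) subset_trans[OF assms(4) W(2)] W(1)])
qed

lemma linear_chainI:
  assumes "\<And>c d. f (c + d) = f c + f d" "\<And>a c. f (chain_scale a c) = chain_scale a (f c)"
  shows "Vector_Spaces.linear chain_scale chain_scale f"
  by unfold_locales (use assms in auto)

lemma linear_restrict_chain: "Vector_Spaces.linear chain_scale chain_scale (restrict_chain S)"
  by (rule linear_chainI) (auto simp: restrict_chain_def chain_scale_def plus_fun_def)

lemma linear_boundary: "Vector_Spaces.linear chain_scale chain_scale (boundary K)"
  by (rule linear_chainI) (auto simp: boundary_def chain_scale_def plus_fun_def sum.distrib sum_distrib_left)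

lemma subspace_chainI:
  assumes "0 \<in> V" "\<And>c d. c \<in> V \<Longrightarrow> d \<in> V \<Longrightarrow> c + d \<in> V" "\<And>a c. c \<in> V \<Longrightarrow> chain_scale a c \<in> V"
  shows "chain_space.subspace V"
  using assms by (auto simp: chain_space.subspace_def)

text \<open>Vanishing on \<open>T\<close> is \<open>card T\<close> linear conditions. The upper half of the almost-additivity below rests
  on this count.\<close>

lemma dim_restrict_chain_le:
  assumes "chain_space.subspace V" "finite S" "V \<subseteq> supported S" "finite T"
  shows "chain_space.dim (V :: ('v list \<Rightarrow> 'f::field) set) \<le> chain_space.dim {c\<in>V. restrict_chain T c = 0} + card T"
proof -
  have "chain_space.dim (restrict_chain T ` V) \<le> card T"
    using assms(4) by (intro dim_supported_le_card) (auto simp: supported_def restrict_chain_def split: if_splits)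
  then show ?thesis
    using rank_nullity_supported[OF linear_restrict_chain assms(1-3), of T] by simp
qed

section \<open>Relative cycles and persistent Betti numbers\<close>

text \<open>For a subcomplex \<open>K\<close> of \<open>L\<close> these are the relative cycles of the pair \<open>(L, K)\<close>; the absolute cycles are
  the case \<open>K = {}\<close>. The condition on \<open>c\<close> at a list \<open>vs\<close> only involves the simplices that have \<open>set vs\<close> as a
  face. This locality is the reason why the dimension of this space is almost additive.\<close>

definition relative_cycles :: "nat \<Rightarrow> 'v set set \<Rightarrow> 'v set set \<Rightarrow> ('v list \<Rightarrow> 'f::field) set" where
  "relative_cycles l K L = {c \<in> chains l L. \<forall>vs. boundary L c vs \<noteq> 0 \<longrightarrow> set vs \<in> K}"

definition orderings :: "nat \<Rightarrow> 'v set set \<Rightarrow> 'v list set" where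
  "orderings l L = {vs. length vs = Suc l \<and> distinct vs \<and> set vs \<in> L}"

lemma finite_orderings: "finite (\<Union>L) \<Longrightarrow> finite (orderings l L)"
  by (rule finite_subset[OF _ finite_lists_length_eq[of "\<Union>L" "Suc l"]]) (auto simp: orderings_def)

lemma chains_supported: "chains l L \<subseteq> supported (orderings l L)"
  by (auto simp: chains_def supported_def orderings_def)

lemma relative_cycles_supported: "relative_cycles l K L \<subseteq> supported (orderings l L)"
  using chains_supported by (auto simp: relative_cycles_def)

lemma chains_antisym: "c \<in> chains l L \<Longrightarrow> i < j \<Longrightarrow> j < length vs \<Longrightarrow> c (vs[i := vs ! j, j := vs ! i]) = - c vs"
  by (simp add: chains_def)

lemma chains_nonzeroD:
  "c \<in> chains l L \<Longrightarrow> c vs \<noteq> 0 \<Longrightarrow> length vs = Suc l \<and> distinct vs \<and> set vs \<in> L"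
  by (simp add: chains_def)

lemma subspace_chains: "chain_space.subspace (chains l L :: ('v list \<Rightarrow> 'f::field) set)"
proof (rule subspace_chainI)
  show "0 \<in> chains l L" by (simp add: chains_def)
next
  fix c d :: "'v list \<Rightarrow> 'f" assume *: "c \<in> chains l L" "d \<in> chains l L"
  show "c + d \<in> chains l L"
    unfolding chains_def
  proof (intro CollectI conjI allI impI)
    fix vs assume "(c + d) vs \<noteq> 0"
    then have "c vs \<noteq> 0 \<or> d vs \<noteq> 0" by auto
    then show "length vs = Suc l" "distinct vs" "set vs \<in> L" using * chains_nonzeroD by blast+
  next
    fix vs :: "'v list" and i j assume "i < j \<and> j < length vs"
    then show "(c + d) (vs[i := vs ! j, j := vs ! i]) = - (c + d) vs"
      using * by (simp add: chains_antisym)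
  qed
next
  fix a and c :: "'v list \<Rightarrow> 'f" assume "c \<in> chains l L"
  then show "chain_scale a c \<in> chains l L" by (auto simp: chains_def chain_scale_def)
qed

lemma boundary_add: "boundary K (c + d) = boundary K c + boundary K d"
  using chain_pair.linear_add[OF linear_boundary] .

lemma boundary_scale: "boundary K (chain_scale a c) = chain_scale a (boundary K c)"
  using chain_pair.linear_scale[OF linear_boundary] .

lemma subspace_relative_cycles: "chain_space.subspace (relative_cycles l K L :: ('v list \<Rightarrow> 'f::field) set)"
proof (rule subspace_chainI)
  show "0 \<in> relative_cycles l K L"
    using chain_space.subspace_0[OF subspace_chains] by (auto simp: relative_cycles_def boundary_def)
next
  fix c d :: "'v list \<Rightarrow> 'f" assume *: "c \<in> relative_cycles l K L" "d \<in> relative_cycles l K L"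
  have "set vs \<in> K" if "boundary L (c + d) vs \<noteq> 0" for vs
  proof -
    have "boundary L c vs \<noteq> 0 \<or> boundary L d vs \<noteq> 0"
      using that unfolding boundary_add by auto
    then show ?thesis using * by (auto simp: relative_cycles_def)
  qed
  then show "c + d \<in> relative_cycles l K L"
    using * chain_space.subspace_add[OF subspace_chains] by (auto simp: relative_cycles_def)
next
  fix a and c :: "'v list \<Rightarrow> 'f" assume *: "c \<in> relative_cycles l K L"
  have "set vs \<in> K" if "boundary L (chain_scale a c) vs \<noteq> 0" for vs
    using that * unfolding boundary_scale by (auto simp: relative_cycles_def chain_scale_def)
  then show "chain_scale a c \<in> relative_cycles l K L"
    using * chain_space.subspace_scale[OF subspace_chains] by (auto simp: relative_cycles_def)
qed

lemma boundary_eq_sum: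
  assumes "c \<in> chains l L" "\<Union>L \<subseteq> X" "finite X" "vs \<noteq> []"
  shows "boundary L c vs = (\<Sum>v\<in>X. c (v # vs))"
proof -
  have "c (v # vs) = 0" if "v \<notin> \<Union>L" for v
    using chains_nonzeroD[OF assms(1), of "v # vs"] that by auto
  then have "(\<Sum>v\<in>\<Union>L. c (v # vs)) = (\<Sum>v\<in>X. c (v # vs))"
    using assms(2,3) by (intro sum.mono_neutral_left) auto
  then show ?thesis using assms(4) by (simp add: boundary_def)
qed

lemma boundary_mono:
  assumes "c \<in> chains l K" "K \<subseteq> L" "finite (\<Union>L)"
  shows "boundary L c = boundary K c"
proof
  fix vs
  have "boundary K c vs = (\<Sum>v\<in>\<Union>L. c (v # vs))" if "vs \<noteq> []"
    using assms that by (intro boundary_eq_sum) auto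
  then show "boundary L c vs = boundary K c vs" by (auto simp: boundary_def)
qed

lemma boundary_nonzeroE:
  assumes "boundary L c vs \<noteq> 0"
  obtains v where "vs \<noteq> []" "c (v # vs) \<noteq> 0"
proof -
  have "vs \<noteq> []" "(\<Sum>v\<in>\<Union>L. c (v # vs)) \<noteq> 0" using assms by (auto simp: boundary_def split: if_splits)
  then show ?thesis using that by (metis sum.neutral)
qed

text \<open>In characteristic 2 it is not enough that the sum equals its own negative: the terms at \<open>(v, w)\<close> and
  \<open>(w, v)\<close> have to be paired off, which the induction on \<open>S\<close> does.\<close>

lemma alternating_double_sum:
  fixes f :: "'a \<Rightarrow> 'a \<Rightarrow> 'f::field"
  assumes "finite S" "\<And>v. f v v = 0" "\<And>v w. f w v = - f v w"
  shows "(\<Sum>v\<in>S. \<Sum>w\<in>S. f v w) = 0"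
  using assms(1)
proof induction
  case (insert a S)
  have "(\<Sum>v\<in>insert a S. \<Sum>w\<in>insert a S. f v w) =
      f a a + (\<Sum>w\<in>S. f a w) + ((\<Sum>v\<in>S. f v a) + (\<Sum>v\<in>S. \<Sum>w\<in>S. f v w))"
    using insert.hyps by (simp add: sum.distrib)
  also have "(\<Sum>v\<in>S. f v a) = - (\<Sum>v\<in>S. f a v)"
    unfolding sum_negf[symmetric] by (rule sum.cong[OF refl assms(3)])
  finally show ?case using insert.IH assms(2) by simp
qed simp

lemma boundary_boundary:
  fixes c :: "'v list \<Rightarrow> 'f::field"
  assumes "c \<in> chains l L" "finite (\<Union>L)"
  shows "boundary L (boundary L c) = 0"
proof
  fix vs
  let ?f = "\<lambda>v w. c (w # v # vs)"
  have "(\<Sum>v\<in>\<Union>L. \<Sum>w\<in>\<Union>L. ?f v w) = 0"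
  proof (rule alternating_double_sum[OF assms(2)])
    show "?f v v = 0" for v using chains_nonzeroD[OF assms(1), of "v # v # vs"] by auto
    show "?f w v = - ?f v w" for v w
      using chains_antisym[OF assms(1), of 0 1 "w # v # vs"] by simp
  qed
  then show "boundary L (boundary L c) vs = 0 vs"
    by (simp add: boundary_def)
qed

text \<open>A chain of \<open>L\<close> bounds a cycle of \<open>K\<close> exactly if it is a relative cycle. So the cycles of \<open>K\<close> that die
  in \<open>L\<close> are an image of relative cycles, and their number can be expressed by kernels alone.\<close>

lemma boundary_relative_cycles:
  fixes K L :: "'v set set"
  assumes "K \<subseteq> L" "finite (\<Union>L)"
  shows "boundary L ` relative_cycles (Suc l) K L = (cycles l K \<inter> boundaries l L :: ('v list \<Rightarrow> 'f::field) set)"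
proof (intro equalityI subsetI)
  fix d assume "d \<in> boundary L ` relative_cycles (Suc l) K L"
  then obtain c where c: "c \<in> chains (Suc l) L" "\<forall>vs. boundary L c vs \<noteq> 0 \<longrightarrow> set vs \<in> K"
    and d: "d = boundary L c" by (auto simp: relative_cycles_def)
  have ch: "d \<in> chains l K"
    unfolding chains_def
  proof (intro CollectI conjI allI impI)
    fix vs assume nz: "d vs \<noteq> 0"
    then obtain v where "c (v # vs) \<noteq> 0" using d boundary_nonzeroE by metis
    then show "length vs = Suc l" "distinct vs" using chains_nonzeroD[OF c(1)] by force+
    show "set vs \<in> K" using nz c(2) d by blast
  next
    fix vs :: "'v list" and i j assume ij: "i < j \<and> j < length vs"
    have "c (v # vs[i := vs ! j, j := vs ! i]) = - c (v # vs)" for v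
      using chains_antisym[OF c(1), of "Suc i" "Suc j" "v # vs"] ij by simp
    moreover have "vs \<noteq> []" using ij by auto
    ultimately show "d (vs[i := vs ! j, j := vs ! i]) = - d vs"
      unfolding d by (simp add: boundary_def sum_negf)
  qed
  have "boundary K d = 0"
    using boundary_mono[OF ch assms] boundary_boundary[OF c(1) assms(2)] d by simp
  then show "d \<in> cycles l K \<inter> boundaries l L"
    using ch c(1) d by (auto simp: cycles_def boundaries_def)
next
  fix d assume "d \<in> cycles l K \<inter> boundaries l L"
  then obtain c where "d \<in> chains l K" "c \<in> chains (Suc l) L" "d = boundary L c"
    by (auto simp: cycles_def boundaries_def)
  moreover from this have "c \<in> relative_cycles (Suc l) K L"
    using chains_nonzeroD[of d l K] by (auto simp: relative_cycles_def)
  ultimately show "d \<in> boundary L ` relative_cycles (Suc l) K L"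
    by blast
qed

text \<open>Rank-nullity for the boundary map on the relative cycles, whose kernel consists of the absolute
  cycles of \<open>L\<close>. Only the last term depends on both complexes.\<close>

lemma persistent_betti_eq:
  assumes "K \<subseteq> L" "finite (\<Union>L)"
  shows "int (persistent_betti TYPE('f::field) l K L) =
    int (chain_space.dim (cycles l K :: ('v list \<Rightarrow> 'f) set))
    + int (chain_space.dim (cycles (Suc l) L :: ('v list \<Rightarrow> 'f) set))
    - int (chain_space.dim (relative_cycles (Suc l) K L :: ('v list \<Rightarrow> 'f) set))"
proof -
  let ?R = "relative_cycles (Suc l) K L :: ('v list \<Rightarrow> 'f) set"
  have "{c \<in> ?R. boundary L c = 0} = cycles (Suc l) L"
    by (auto simp: relative_cycles_def cycles_def)
  then have "chain_space.dim ?R = chain_space.dim (cycles (Suc l) L :: ('v list \<Rightarrow> 'f) set)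
      + chain_space.dim (cycles l K \<inter> boundaries l L :: ('v list \<Rightarrow> 'f) set)"
    using rank_nullity_supported[OF linear_boundary[of L] subspace_relative_cycles[of "Suc l" K L, where 'f='f] finite_orderings[OF assms(2)] relative_cycles_supported]
    by (simp add: boundary_relative_cycles[OF assms])
  moreover have "finite (\<Union>K)" using assms finite_subset by (metis Union_mono)
  then have "chain_space.dim (cycles l K \<inter> boundaries l L :: ('v list \<Rightarrow> 'f) set)
      \<le> chain_space.dim (cycles l K :: ('v list \<Rightarrow> 'f) set)"
    using chains_supported[of l K] by (intro dim_supported_mono[OF finite_orderings[of K l]]) (auto simp: cycles_def)
  ultimately show ?thesis by (simp add: persistent_betti_def)
qed

text \<open>The sets \<open>B i\<close> will be disjoint. The index set \<open>J\<close> is a parameter because the blocks are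
  added one at a time.\<close>

definition blockwise :: "nat \<Rightarrow> 'v set set \<Rightarrow> 'v set set \<Rightarrow> ('i \<Rightarrow> 'v set) \<Rightarrow> 'i set \<Rightarrow> ('v list \<Rightarrow> 'f::field) set" where
  "blockwise l K L B J = {c \<in> relative_cycles l K L. \<forall>vs. c vs \<noteq> 0 \<longrightarrow> (\<exists>i\<in>J. set vs \<subseteq> B i)}"

lemma subspace_blockwise: "chain_space.subspace (blockwise l K L B J :: ('v list \<Rightarrow> 'f::field) set)"
proof -
  have "chain_space.subspace {c :: 'v list \<Rightarrow> 'f. \<forall>vs. c vs \<noteq> 0 \<longrightarrow> (\<exists>i\<in>J. set vs \<subseteq> B i)}" (is "chain_space.subspace ?S")
  proof (rule subspace_chainI)
    fix c d :: "'v list \<Rightarrow> 'f" assume *: "c \<in> ?S" "d \<in> ?S"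
    have "c vs \<noteq> 0 \<or> d vs \<noteq> 0" if "(c + d) vs \<noteq> 0" for vs
      using that by auto
    then show "c + d \<in> ?S" using * by blast
  qed (auto simp: chain_scale_def)
  moreover have "blockwise l K L B J = relative_cycles l K L \<inter> ?S"
    by (auto simp: blockwise_def)
  ultimately show ?thesis
    using chain_space.subspace_inter[OF subspace_relative_cycles] by simp
qed

text \<open>Two simplices in different blocks have no nonempty face in common, so each boundary condition only
  sees the simplices of one block, and the restriction of a relative cycle to a block is again one.\<close>

lemma restrict_chain_blockwise:
  fixes B :: "'i \<Rightarrow> 'v set"
  assumes "finite (\<Union>L)" "disjoint_family_on B (insert i J)" "i \<notin> J"
  shows "restrict_chain {vs. set vs \<subseteq> B i} ` blockwise l K L B (insert i J) =
         (relative_cycles l (K \<inter> Pow (B i)) (L \<inter> Pow (B i)) :: ('v list \<Rightarrow> 'f::field) set)" (is "?r ` ?V = ?R")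
proof (intro equalityI subsetI)
  fix d assume "d \<in> ?r ` ?V"
  then obtain c where c: "c \<in> chains l L" "\<forall>vs. boundary L c vs \<noteq> 0 \<longrightarrow> set vs \<in> K"
      "\<And>vs. c vs \<noteq> 0 \<Longrightarrow> \<exists>j\<in>insert i J. set vs \<subseteq> B j" and d: "d = ?r c"
    by (auto simp: blockwise_def relative_cycles_def)
  have ch: "d \<in> chains l (L \<inter> Pow (B i))"
    unfolding chains_def
  proof (intro CollectI conjI allI impI)
    fix vs assume nz: "d vs \<noteq> 0"
    then have "c vs \<noteq> 0" "set vs \<subseteq> B i" using d by (auto simp: restrict_chain_def split: if_splits)
    then show "length vs = Suc l" "distinct vs" "set vs \<in> L \<inter> Pow (B i)" using chains_nonzeroD[OF c(1)] by force+
  next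
    fix vs :: "'v list" and a b assume "a < b \<and> b < length vs"
    then show "d (vs[a := vs ! b, b := vs ! a]) = - d vs"
      using chains_antisym[OF c(1), of a b vs] unfolding d by (simp add: restrict_chain_def)
  qed
  have "set vs \<in> K \<inter> Pow (B i)" if nz: "boundary (L \<inter> Pow (B i)) d vs \<noteq> 0" for vs
  proof -
    obtain w where w: "vs \<noteq> []" "d (w # vs) \<noteq> 0" using nz boundary_nonzeroE by metis
    then have vsB: "set vs \<subseteq> B i" using d by (auto simp: restrict_chain_def split: if_splits)
    have "c (v # vs) = d (v # vs)" for v
    proof (cases "c (v # vs) = 0")
      case False
      then obtain j where j: "j \<in> insert i J" "set (v # vs) \<subseteq> B j" using c(3) by blast
      then have "B i \<inter> B j \<noteq> {}" using w(1) vsB by (cases vs) auto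
      then have "j = i" using assms(2) j(1) by (auto simp: disjoint_family_on_def)
      then show ?thesis using j(2) d by (simp add: restrict_chain_def)
    qed (use d in \<open>auto simp: restrict_chain_def\<close>)
    then have "boundary L c vs = (\<Sum>v\<in>\<Union>L. d (v # vs))"
      using w(1) by (simp add: boundary_def)
    also have "\<dots> = boundary (L \<inter> Pow (B i)) d vs"
      by (rule boundary_eq_sum[OF ch _ assms(1) w(1), symmetric]) auto
    finally show ?thesis using nz c(2) vsB by auto
  qed
  then show "d \<in> ?R" using ch by (auto simp: relative_cycles_def)
next
  fix c assume "c \<in> ?R"
  then have c: "c \<in> chains l (L \<inter> Pow (B i))"
    "\<And>vs. boundary (L \<inter> Pow (B i)) c vs \<noteq> 0 \<Longrightarrow> set vs \<in> K \<inter> Pow (B i)"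
    by (auto simp: relative_cycles_def)
  have "c \<in> chains l L" using c(1) by (auto simp: chains_def)
  moreover have "boundary L c = boundary (L \<inter> Pow (B i)) c"
    using assms(1) by (intro boundary_mono[OF c(1)]) auto
  ultimately have V: "c \<in> ?V"
    using c(2) chains_nonzeroD[OF c(1)] by (auto simp: blockwise_def relative_cycles_def)
  have "?r c = c" using chains_nonzeroD[OF c(1)] by (intro ext) (auto simp: restrict_chain_def)
  then show "c \<in> ?r ` ?V" using V by (metis imageI)
qed

text \<open>Rank-nullity for the restriction to a new block: its kernel consists of the chains on the old blocks.\<close>

lemma dim_blockwise:
  fixes B :: "'i \<Rightarrow> 'v set"
  assumes "finite (\<Union>L)" "finite J" "disjoint_family_on B J"
  shows "chain_space.dim (blockwise l K L B J :: ('v list \<Rightarrow> 'f::field) set) =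
         (\<Sum>i\<in>J. chain_space.dim (relative_cycles l (K \<inter> Pow (B i)) (L \<inter> Pow (B i)) :: ('v list \<Rightarrow> 'f) set))"
  using assms(2,3)
proof (induction)
  case empty
  have "blockwise l K L B {} \<subseteq> (supported {} :: ('v list \<Rightarrow> 'f::field) set)"
    by (auto simp: blockwise_def supported_def)
  from dim_supported_le_card[OF _ this] show ?case by simp
next
  case (insert i J)
  let ?V = "blockwise l K L B (insert i J) :: ('v list \<Rightarrow> 'f) set"
  let ?r = "restrict_chain {vs. set vs \<subseteq> B i} :: ('v list \<Rightarrow> 'f) \<Rightarrow> 'v list \<Rightarrow> 'f"
  have "?V \<subseteq> supported (orderings l L)"
    using relative_cycles_supported by (auto simp: blockwise_def)
  from rank_nullity_supported[OF linear_restrict_chain subspace_blockwise finite_orderings[OF assms(1)] this]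
  have "chain_space.dim ?V = chain_space.dim {c \<in> ?V. ?r c = 0} + chain_space.dim (?r ` ?V)" .
  also have "{c \<in> ?V. ?r c = 0} = blockwise l K L B J"
  proof (intro equalityI subsetI)
    fix c assume c: "c \<in> {c \<in> ?V. ?r c = 0}"
    have "\<exists>j\<in>J. set vs \<subseteq> B j" if "c vs \<noteq> 0" for vs
    proof -
      have "restrict_chain {vs. set vs \<subseteq> B i} c vs = 0" using c by (simp add: zero_fun_def)
      then have "\<not> set vs \<subseteq> B i" using that by (auto simp: restrict_chain_def)
      then show ?thesis using c that by (auto simp: blockwise_def)
    qed
    then show "c \<in> blockwise l K L B J" using c by (auto simp: blockwise_def)
  next
    fix c :: "'v list \<Rightarrow> 'f" assume c: "c \<in> blockwise l K L B J"
    have "c vs = 0" if "set vs \<subseteq> B i" for vs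
    proof (rule ccontr)
      assume nz: "c vs \<noteq> 0"
      then obtain j where j: "j \<in> J" "set vs \<subseteq> B j" using c by (auto simp: blockwise_def)
      have "vs \<noteq> []" using c nz chains_nonzeroD by (fastforce simp: blockwise_def relative_cycles_def)
      then have "B i \<inter> B j \<noteq> {}" using j that by (cases vs) auto
      then show False using insert.prems insert.hyps j(1) by (auto simp: disjoint_family_on_def)
    qed
    then have "?r c = 0" by (auto simp: restrict_chain_def)
    then show "c \<in> {c \<in> ?V. ?r c = 0}" using c by (auto simp: blockwise_def)
  qed
  also have "chain_space.dim (blockwise l K L B J :: ('v list \<Rightarrow> 'f) set) =
     (\<Sum>i\<in>J. chain_space.dim (relative_cycles l (K \<inter> Pow (B i)) (L \<inter> Pow (B i)) :: ('v list \<Rightarrow> 'f) set))"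
    using insert by (intro insert.IH) (auto simp: disjoint_family_on_def)
  finally show ?case
    using insert.hyps by (simp add: restrict_chain_blockwise[OF assms(1) insert.prems insert.hyps(2)])
qed

text \<open>Almost-additivity. The blockwise relative cycles are a subspace, and they are cut out by the condition
  that the chain vanishes at the orderings of simplices that lie in no block.\<close>

lemma dim_relative_cycles_blocks:
  fixes B :: "'i \<Rightarrow> 'v set" and l :: nat
  assumes "finite (\<Union>L)" "finite J" "disjoint_family_on B J"
  defines "d \<equiv> \<lambda>K L. chain_space.dim (relative_cycles l K L :: ('v list \<Rightarrow> 'f::field) set)"
  shows "(\<Sum>i\<in>J. d (K \<inter> Pow (B i)) (L \<inter> Pow (B i))) \<le> d K L"
    and "d K L \<le> (\<Sum>i\<in>J. d (K \<inter> Pow (B i)) (L \<inter> Pow (B i)))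
               + card {vs \<in> orderings l L. \<forall>i\<in>J. \<not> set vs \<subseteq> B i}" (is "_ \<le> _ + card ?T")
proof -
  let ?V = "relative_cycles l K L :: ('v list \<Rightarrow> 'f) set"
  have fin: "finite (orderings l L)" using finite_orderings assms(1) by blast
  show "(\<Sum>i\<in>J. d (K \<inter> Pow (B i)) (L \<inter> Pow (B i))) \<le> d K L"
    unfolding d_def dim_blockwise[OF assms(1-3), symmetric]
    by (rule dim_supported_mono[OF fin relative_cycles_supported]) (auto simp: blockwise_def)
  have "{c \<in> ?V. restrict_chain ?T c = 0} \<subseteq> blockwise l K L B J"
  proof
    fix c assume c: "c \<in> {c \<in> ?V. restrict_chain ?T c = 0}"
    have "\<exists>i\<in>J. set vs \<subseteq> B i" if "c vs \<noteq> 0" for vs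
    proof (rule ccontr)
      assume "\<not> (\<exists>i\<in>J. set vs \<subseteq> B i)"
      moreover have "vs \<in> orderings l L" using c that relative_cycles_supported by (fastforce simp: supported_def)
      ultimately have "restrict_chain ?T c vs = c vs" by (auto simp: restrict_chain_def)
      then show False using c that by (simp add: zero_fun_def)
    qed
    then show "c \<in> blockwise l K L B J" using c by (auto simp: blockwise_def)
  qed
  then have "chain_space.dim {c \<in> ?V. restrict_chain ?T c = 0} \<le> chain_space.dim (blockwise l K L B J :: ('v list \<Rightarrow> 'f) set)"
    using relative_cycles_supported[of l K L]
    by (intro dim_supported_mono[OF fin]) (auto simp: blockwise_def)
  then show "d K L \<le> (\<Sum>i\<in>J. d (K \<inter> Pow (B i)) (L \<inter> Pow (B i))) + card ?T"
    using dim_restrict_chain_le[OF subspace_relative_cycles[of l K L, where 'f='f] fin relative_cycles_supported, of ?T] fin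
    unfolding d_def dim_blockwise[OF assms(1-3), symmetric] by simp
qed

text \<open>Chains are transported along the inverse of \<open>\<phi>\<close>. The lists with entries outside \<open>Y\<close> get the value \<open>0\<close>, so
  that the transported chain is supported on orderings of simplices of \<open>L'\<close>.\<close>

lemma dim_relative_cycles_le_image:
  fixes \<phi> :: "'v \<Rightarrow> 'w"
  assumes X: "finite X" "L \<subseteq> Pow X" and Y: "L' \<subseteq> Pow Y" and bij: "bij_betw \<phi> X Y"
    and L: "\<And>\<sigma>. \<sigma> \<subseteq> X \<Longrightarrow> \<sigma> \<in> L \<Longrightarrow> \<phi> ` \<sigma> \<in> L'" and K: "\<And>\<sigma>. \<sigma> \<subseteq> X \<Longrightarrow> \<sigma> \<in> K \<Longrightarrow> \<phi> ` \<sigma> \<in> K'"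
  shows "chain_space.dim (relative_cycles l K L :: ('v list \<Rightarrow> 'f::field) set)
       \<le> chain_space.dim (relative_cycles l K' L' :: ('w list \<Rightarrow> 'f) set)"
proof -
  define \<psi> where "\<psi> = inv_into X \<phi>"
  have bij': "bij_betw \<psi> Y X" unfolding \<psi>_def by (rule bij_betw_inv_into[OF bij])
  have \<phi>\<psi>: "\<phi> (\<psi> y) = y" if "y \<in> Y" for y
    using bij that unfolding \<psi>_def by (simp add: bij_betw_inv_into_right)
  have \<psi>\<phi>: "\<psi> (\<phi> x) = x" if "x \<in> X" for x
    using bij that unfolding \<psi>_def by (simp add: bij_betw_inv_into_left)
  have finY: "finite Y" using bij X(1) bij_betw_finite by blast
  define \<Phi> :: "('v list \<Rightarrow> 'f) \<Rightarrow> 'w list \<Rightarrow> 'f"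
    where "\<Phi> c = (\<lambda>ws. if set ws \<subseteq> Y then c (map \<psi> ws) else 0)" for c
  let ?R = "relative_cycles l K L :: ('v list \<Rightarrow> 'f) set"
  have lin: "Vector_Spaces.linear chain_scale chain_scale \<Phi>"
    by (rule linear_chainI) (auto simp: \<Phi>_def chain_scale_def)
  have "\<Union>L \<subseteq> X" "\<Union>L' \<subseteq> Y" using X(2) Y by auto
  then have finL: "finite (\<Union>L)" and finL': "finite (\<Union>L')" using X(1) finY finite_subset by blast+
  have im: "\<phi> ` \<psi> ` set ws = set ws" if "set ws \<subseteq> Y" for ws
    using \<phi>\<psi> that by (force simp: image_image)
  have imX: "\<psi> ` set ws \<subseteq> X" if "set ws \<subseteq> Y" for ws
    using bij' that by (auto simp: bij_betw_def)
  have "\<Phi> c \<in> relative_cycles l K' L'" if "c \<in> ?R" for c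
  proof -
    have c: "c \<in> chains l L" "\<And>vs. boundary L c vs \<noteq> 0 \<Longrightarrow> set vs \<in> K"
      using that by (auto simp: relative_cycles_def)
    have ch: "\<Phi> c \<in> chains l L'"
      unfolding chains_def
    proof (intro CollectI conjI allI impI)
      fix ws assume "\<Phi> c ws \<noteq> 0"
      then have ws: "set ws \<subseteq> Y" "c (map \<psi> ws) \<noteq> 0" by (auto simp: \<Phi>_def split: if_splits)
      note * = chains_nonzeroD[OF c(1) ws(2)]
      show "length ws = Suc l" "distinct ws" using * by (auto simp: distinct_map)
      have "\<phi> ` set (map \<psi> ws) \<in> L'" using * L X(2) by blast
      then show "set ws \<in> L'" using im[OF ws(1)] by simp
    next
      fix ws :: "'w list" and i j assume ij: "i < j \<and> j < length ws"
      then show "\<Phi> c (ws[i := ws ! j, j := ws ! i]) = - \<Phi> c ws"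
        using chains_antisym[OF c(1), of i j "map \<psi> ws"] by (simp add: \<Phi>_def map_update)
    qed
    have "set ws \<in> K'" if nz: "boundary L' (\<Phi> c) ws \<noteq> 0" for ws
    proof -
      obtain w where w: "ws \<noteq> []" "\<Phi> c (w # ws) \<noteq> 0" using nz boundary_nonzeroE by metis
      then have Y': "set ws \<subseteq> Y" by (auto simp: \<Phi>_def split: if_splits)
      have "boundary L' (\<Phi> c) ws = (\<Sum>w\<in>Y. \<Phi> c (w # ws))"
        using Y by (intro boundary_eq_sum[OF ch _ finY w(1)]) auto
      also have "\<dots> = (\<Sum>w\<in>Y. c (\<psi> w # map \<psi> ws))"
        using Y' by (intro sum.cong) (auto simp: \<Phi>_def)
      also have "\<dots> = (\<Sum>v\<in>X. c (v # map \<psi> ws))"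
        using sum.reindex_bij_betw[OF bij'] .
      also have "\<dots> = boundary L c (map \<psi> ws)"
        using X w(1) by (intro boundary_eq_sum[OF c(1), symmetric]) auto
      finally have "boundary L c (map \<psi> ws) \<noteq> 0" using nz by simp
      from c(2)[OF this] have "set (map \<psi> ws) \<in> K" .
      then have "\<phi> ` set (map \<psi> ws) \<in> K'" using K imX[OF Y'] by auto
      then show ?thesis using im[OF Y'] by simp
    qed
    then show ?thesis using ch by (auto simp: relative_cycles_def)
  qed
  then have sub: "\<Phi> ` ?R \<subseteq> relative_cycles l K' L'" by blast
  have "{c \<in> ?R. \<Phi> c = 0} \<subseteq> supported {}"
  proof
    fix c assume c: "c \<in> {c \<in> ?R. \<Phi> c = 0}"
    have "c vs = 0" for vs
    proof (rule ccontr)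
      assume nz: "c vs \<noteq> 0"
      then have "set vs \<subseteq> X" using c X(2) chains_nonzeroD by (fastforce simp: relative_cycles_def)
      then have "map \<psi> (map \<phi> vs) = vs" "set (map \<phi> vs) \<subseteq> Y"
        using \<psi>\<phi> bij by (auto simp: bij_betw_def intro!: map_idI)
      then have "\<Phi> c (map \<phi> vs) = c vs" unfolding \<Phi>_def by (metis (full_types))
      then show False using c nz by (simp add: zero_fun_def)
    qed
    then show "c \<in> supported {}" by (simp add: supported_def)
  qed
  then have "chain_space.dim {c \<in> ?R. \<Phi> c = 0} = 0"
    using dim_supported_le_card[OF finite.emptyI, of "{c \<in> ?R. \<Phi> c = 0}"] by simp
  then have "chain_space.dim ?R = chain_space.dim (\<Phi> ` ?R)"
    using rank_nullity_supported[OF lin subspace_relative_cycles[of l K L, where 'f='f] finite_orderings[OF finL] relative_cycles_supported]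
    by simp
  also have "\<dots> \<le> chain_space.dim (relative_cycles l K' L' :: ('w list \<Rightarrow> 'f) set)"
    by (rule dim_supported_mono[OF finite_orderings[OF finL'] relative_cycles_supported sub])
  finally show ?thesis .
qed

lemma dim_relative_cycles_iso:
  fixes \<phi> :: "'v \<Rightarrow> 'w"
  assumes X: "finite X" "L \<subseteq> Pow X" and Y: "L' \<subseteq> Pow Y" and bij: "bij_betw \<phi> X Y"
    and L: "\<And>\<sigma>. \<sigma> \<subseteq> X \<Longrightarrow> \<phi> ` \<sigma> \<in> L' \<longleftrightarrow> \<sigma> \<in> L" and K: "\<And>\<sigma>. \<sigma> \<subseteq> X \<Longrightarrow> \<phi> ` \<sigma> \<in> K' \<longleftrightarrow> \<sigma> \<in> K"
  shows "chain_space.dim (relative_cycles l K L :: ('v list \<Rightarrow> 'f::field) set)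
       = chain_space.dim (relative_cycles l K' L' :: ('w list \<Rightarrow> 'f) set)"
proof (rule antisym)
  show "chain_space.dim (relative_cycles l K L :: ('v list \<Rightarrow> 'f::field) set)
       \<le> chain_space.dim (relative_cycles l K' L' :: ('w list \<Rightarrow> 'f) set)"
    by (rule dim_relative_cycles_le_image[OF X Y bij]) (simp_all add: L K)
  define \<psi> where "\<psi> = inv_into X \<phi>"
  have bij': "bij_betw \<psi> Y X" unfolding \<psi>_def by (rule bij_betw_inv_into[OF bij])
  have inv: "\<psi> ` \<sigma> \<subseteq> X" "\<phi> ` \<psi> ` \<sigma> = \<sigma>" if "\<sigma> \<subseteq> Y" for \<sigma>
  proof -
    show "\<psi> ` \<sigma> \<subseteq> X" using bij' that by (auto simp: bij_betw_def)
    have "\<phi> (\<psi> y) = y" if "y \<in> Y" for y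
      using bij that unfolding \<psi>_def by (simp add: bij_betw_inv_into_right)
    then show "\<phi> ` \<psi> ` \<sigma> = \<sigma>" using that by (force simp: image_image)
  qed
  show "chain_space.dim (relative_cycles l K' L' :: ('w list \<Rightarrow> 'f) set)
       \<le> chain_space.dim (relative_cycles l K L :: ('v list \<Rightarrow> 'f::field) set)"
  proof (rule dim_relative_cycles_le_image[OF _ Y X(2) bij'])
    show "finite Y" using bij_betw_finite[OF bij] X(1) by simp
    show "\<psi> ` \<sigma> \<in> L" if "\<sigma> \<subseteq> Y" "\<sigma> \<in> L'" for \<sigma>
      using L[OF inv(1)[OF that(1)]] that inv(2) by simp
    show "\<psi> ` \<sigma> \<in> K" if "\<sigma> \<subseteq> Y" "\<sigma> \<in> K'" for \<sigma>
      using K[OF inv(1)[OF that(1)]] that inv(2) by simp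
  qed
qed

section \<open>Persistence diagrams of Cech filtrations\<close>

text \<open>The differences \<open>d J L' - d J L\<close> are dimensions of images of \<open>relative_cycles l J L'\<close> under one and the same
  map, the restriction to the simplices outside \<open>L\<close>; so they grow with \<open>J\<close>. This is why the
  multiplicities of a persistence diagram are nonnegative.\<close>

lemma dim_relative_cycles_supermodular:
  fixes K K' L L' :: "'v set set" and l :: nat
  assumes "K \<subseteq> K'" "L \<subseteq> L'" "finite (\<Union>L')"
  defines "d \<equiv> \<lambda>K L. chain_space.dim (relative_cycles l K L :: ('v list \<Rightarrow> 'f::field) set)"
  shows "d K' L + d K L' \<le> d K' L' + d K L"
proof -
  let ?r = "restrict_chain {vs. set vs \<notin> L} :: ('v list \<Rightarrow> 'f) \<Rightarrow> 'v list \<Rightarrow> 'f"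
  have ker: "{c \<in> relative_cycles l J L'. ?r c = 0} = relative_cycles l J L" for J
  proof (intro equalityI subsetI)
    fix c assume c: "c \<in> {c \<in> relative_cycles l J L'. ?r c = 0}"
    have nz: "set vs \<in> L" if "c vs \<noteq> 0" for vs
    proof (rule ccontr)
      assume "set vs \<notin> L"
      then have "?r c vs = c vs" by (simp add: restrict_chain_def)
      then show False using c that by (simp add: zero_fun_def)
    qed
    have ch: "c \<in> chains l L" using c nz by (auto simp: chains_def relative_cycles_def)
    then show "c \<in> relative_cycles l J L"
      using c boundary_mono[OF ch assms(2,3)] by (auto simp: relative_cycles_def)
  next
    fix c :: "'v list \<Rightarrow> 'f" assume c: "c \<in> relative_cycles l J L"
    then have ch: "c \<in> chains l L" by (auto simp: relative_cycles_def)
    then have "c \<in> chains l L'" using assms(2) by (auto simp: chains_def)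
    moreover have "?r c = 0" using chains_nonzeroD[OF ch] by (intro ext) (auto simp: restrict_chain_def)
    ultimately show "c \<in> {c \<in> relative_cycles l J L'. ?r c = 0}"
      using c boundary_mono[OF ch assms(2,3)] by (auto simp: relative_cycles_def)
  qed
  have rn: "d J L' = d J L + chain_space.dim (?r ` relative_cycles l J L')" for J
    using rank_nullity_supported[OF linear_restrict_chain subspace_relative_cycles[of l J L', where 'f='f]
        finite_orderings[OF assms(3)] relative_cycles_supported, of "{vs. set vs \<notin> L}"]
    unfolding d_def ker by simp
  have "relative_cycles l K L' \<subseteq> (relative_cycles l K' L' :: ('v list \<Rightarrow> 'f) set)"
    using assms(1) by (auto simp: relative_cycles_def)
  moreover have "?r ` relative_cycles l K' L' \<subseteq> supported (orderings l L')"
    using relative_cycles_supported[of l K' L'] by (fastforce simp: supported_def restrict_chain_def)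
  ultimately have "chain_space.dim (?r ` relative_cycles l K L') \<le> chain_space.dim (?r ` relative_cycles l K' L')"
    by (intro dim_supported_mono[OF finite_orderings[OF assms(3)]] image_mono)
  then show ?thesis using rn[of K] rn[of K'] by simp
qed

lemma cech_subset: "cech X r \<subseteq> Pow X" and Union_cech: "\<Union>(cech X r) \<subseteq> X"
  by (auto simp: cech_def)

lemma finite_Union_cech: "finite X \<Longrightarrow> finite (\<Union>(cech X r))"
  using Union_cech finite_subset by blast

lemma cech_mono: "r \<le> s \<Longrightarrow> cech X r \<subseteq> cech X s"
proof
  fix \<sigma> assume rs: "r \<le> s" and "\<sigma> \<in> cech X r"
  then obtain y where "\<sigma> \<noteq> {}" "\<sigma> \<subseteq> X" "\<forall>x\<in>\<sigma>. dist x y \<le> r" by (auto simp: cech_def)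
  moreover from this have "y \<in> (\<Inter>x\<in>\<sigma>. cball x s)" using rs by fastforce
  ultimately show "\<sigma> \<in> cech X s" unfolding cech_def by blast
qed

lemma cech_Int: "cech (X \<inter> B) r = cech X r \<inter> Pow B"
  by (auto simp: cech_def)

text \<open>The threshold is the radius of the smallest ball that contains \<open>\<sigma>\<close>. It is attained because the pairs
  of a centre and an admissible radius, with the centre not too far from \<open>\<sigma>\<close>, form a compact set.\<close>

lemma cech_threshold:
  fixes \<sigma> :: "'a::euclidean_space set"
  assumes "finite \<sigma>" "\<sigma> \<noteq> {}"
  shows "\<exists>t. \<forall>r. (\<Inter>x\<in>\<sigma>. cball x r) \<noteq> {} \<longleftrightarrow> t \<le> r"
proof -
  obtain x0 where x0: "x0 \<in> \<sigma>" using assms by auto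
  define R where "R = Max (dist x0 ` \<sigma>)"
  have R: "dist x x0 \<le> R" if "x \<in> \<sigma>" for x
    using assms that unfolding R_def by (subst dist_commute) (auto intro!: Max_ge)
  define C where "C = cball x0 R \<times> {0..R} \<inter> (\<Inter>x\<in>\<sigma>. {p. dist x (fst p) \<le> snd p})"
  have "compact C"
    unfolding C_def
    by (intro compact_Int_closed compact_Times closed_INT ballI closed_Collect_le continuous_intros) auto
  moreover have "(x0, R) \<in> C" using R R[OF x0] x0 by (auto simp: C_def)
  moreover have "continuous_on C snd" by (intro continuous_intros)
  ultimately have "\<exists>p\<in>C. \<forall>q\<in>C. snd p \<le> snd q"
    by (intro continuous_attains_inf) auto
  then obtain p where p: "p \<in> C" "\<And>q. q \<in> C \<Longrightarrow> snd p \<le> snd q" by blast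
  have "(\<Inter>x\<in>\<sigma>. cball x r) \<noteq> {} \<longleftrightarrow> snd p \<le> r" for r
  proof
    assume "snd p \<le> r"
    then have "fst p \<in> (\<Inter>x\<in>\<sigma>. cball x r)" using p(1) by (fastforce simp: C_def)
    then show "(\<Inter>x\<in>\<sigma>. cball x r) \<noteq> {}" by blast
  next
    assume "(\<Inter>x\<in>\<sigma>. cball x r) \<noteq> {}"
    then obtain y where "\<forall>x\<in>\<sigma>. dist x y \<le> r" by auto
    then have y: "dist x y \<le> r" if "x \<in> \<sigma>" for x using that by blast
    show "snd p \<le> r"
    proof (cases "r \<le> R")
      case True
      have "0 \<le> r" using y[OF x0] zero_le_dist order_trans by blast
      then have "(y, r) \<in> C" using y y[OF x0] True by (auto simp: C_def)
      then show ?thesis using p(2) by fastforce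
    next
      case False
      then show ?thesis using p(1) by (auto simp: C_def)
    qed
  qed
  then show ?thesis by blast
qed

text \<open>A finite set has finitely many simplices, and each of them enters at its threshold and stays.\<close>

lemma cech_critical_values:
  fixes X :: "'a::euclidean_space set"
  assumes "finite X"
  obtains T where "finite T" "\<And>r s. r \<le> s \<Longrightarrow> {r<..s} \<inter> T = {} \<Longrightarrow> cech X r = cech X s"
proof -
  let ?S = "Pow X - {{}}"
  have "\<forall>\<sigma>\<in>?S. \<exists>t. \<forall>r. (\<Inter>x\<in>\<sigma>. cball x r) \<noteq> {} \<longleftrightarrow> t \<le> r"
    using assms finite_subset by (intro ballI cech_threshold) auto
  then obtain t where t: "\<And>\<sigma> r. \<sigma> \<in> ?S \<Longrightarrow> (\<Inter>x\<in>\<sigma>. cball x r) \<noteq> {} \<longleftrightarrow> t \<sigma> \<le> r"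
    by metis
  have mem: "\<sigma> \<in> cech X r \<longleftrightarrow> \<sigma> \<in> ?S \<and> t \<sigma> \<le> r" for \<sigma> r
    using t[of \<sigma> r] by (auto simp: cech_def)
  have "cech X r = cech X s" if "r \<le> s" "{r<..s} \<inter> t ` ?S = {}" for r s
  proof
    show "cech X s \<subseteq> cech X r"
    proof
      fix \<sigma> assume \<sigma>: "\<sigma> \<in> cech X s"
      then have "t \<sigma> \<notin> {r<..s}" using that(2) mem by blast
      then show "\<sigma> \<in> cech X r" using \<sigma> mem by auto
    qed
  qed (rule cech_mono[OF that(1)])
  then show thesis using that[of "t ` ?S"] assms by simp
qed

lemma finite_gap:
  fixes T :: "real set"
  assumes "finite T"
  obtains \<epsilon> where "\<epsilon> > 0" "\<And>t t'. t \<in> T \<Longrightarrow> t' \<in> T \<Longrightarrow> t < t' \<Longrightarrow> t \<le> t' - \<epsilon>"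
proof -
  let ?D = "insert 1 ((\<lambda>(t, t'). t' - t) ` {p \<in> T \<times> T. fst p < snd p})"
  have fin: "finite ?D" using assms by auto
  have "Min ?D > 0" using fin by (subst Min_gr_iff) auto
  moreover have "t \<le> t' - Min ?D" if "t \<in> T" "t' \<in> T" "t < t'" for t t'
  proof -
    have "t' - t \<in> ?D" using that by force
    from Min_le[OF fin this] show ?thesis by simp
  qed
  ultimately show thesis using that by blast
qed

text \<open>A telescoping sum: the largest point of \<open>T\<close> in the interval is split off. The number \<open>\<epsilon>\<close> is smaller than
  all gaps of \<open>T\<close>, so \<open>h (t - \<epsilon>)\<close> is the left limit of \<open>h\<close> at every \<open>t \<in> T\<close>.\<close>

lemma step_function_sum_jumps:
  fixes h :: "real \<Rightarrow> 'b::ab_group_add"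
  assumes T: "finite T" and step: "\<And>r s. r \<le> s \<Longrightarrow> {r<..s} \<inter> T = {} \<Longrightarrow> h r = h s"
    and \<epsilon>: "\<epsilon> > 0" "\<And>t t'. t \<in> T \<Longrightarrow> t' \<in> T \<Longrightarrow> t < t' \<Longrightarrow> t \<le> t' - \<epsilon>"
    and "a \<le> b"
  shows "(\<Sum>t\<in>T \<inter> {a<..b}. h t - h (t - \<epsilon>)) = h b - h a"
  using \<open>a \<le> b\<close>
proof (induction "card (T \<inter> {a<..b})" arbitrary: b rule: less_induct)
  case less
  show ?case
  proof (cases "T \<inter> {a<..b} = {}")
    case True
    then show ?thesis using step[OF less.prems] by (simp add: Int_commute)
  next
    case False
    define m where "m = Max (T \<inter> {a<..b})"
    have "m \<in> T \<inter> {a<..b}" unfolding m_def using T False by (intro Max_in) auto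
    then have m: "m \<in> T" "a < m" "m \<le> b" by auto
    have max: "t \<le> m" if "t \<in> T" "a < t" "t \<le> b" for t
      using that T by (auto simp: m_def)
    have hb: "h m = h b" using m max by (intro step) fastforce+
    \<comment> \<open>The left limit at \<open>m\<close> is the value at \<open>m - \<epsilon>\<close>, which may lie to the left of \<open>a\<close>.\<close>
    define c where "c = max a (m - \<epsilon>)"
    have hc: "h c = h (m - \<epsilon>)"
    proof (cases "a \<le> m - \<epsilon>")
      case False
      then have "h (m - \<epsilon>) = h a" using m \<epsilon> by (intro step) fastforce+
      then show ?thesis using False by (simp add: c_def)
    qed (simp add: c_def)
    have eq: "T \<inter> {a<..b} = insert m (T \<inter> {a<..c})"
      using m max \<epsilon> by (fastforce simp: c_def)
    have notin: "m \<notin> T \<inter> {a<..c}" using \<epsilon>(1) m by (auto simp: c_def)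
    have "card (T \<inter> {a<..c}) < card (T \<inter> {a<..b})" using T notin unfolding eq by simp
    then have "(\<Sum>t\<in>T \<inter> {a<..c}. h t - h (t - \<epsilon>)) = h c - h a"
      by (rule less.hyps) (simp add: c_def)
    then show ?thesis unfolding eq using T notin hb hc by simp
  qed
qed

text \<open>As a function of \<open>(r, s)\<close> this number plays the role of a distribution function of the diagram in degree
  \<open>l\<close>: its rectangle increments count the points of the diagram.\<close>

definition rel_rank :: "'f::field itself \<Rightarrow> nat \<Rightarrow> real \<Rightarrow> real \<Rightarrow> 'a::euclidean_space set \<Rightarrow> nat" where
  "rel_rank F l r s X = chain_space.dim (relative_cycles (Suc l) (cech X r) (cech X s) :: ('a list \<Rightarrow> 'f) set)"

definition rect_mass :: "'f::field itself \<Rightarrow> nat \<Rightarrow> 'a::euclidean_space set \<Rightarrow> real \<Rightarrow> real \<Rightarrow> real \<Rightarrow> real \<Rightarrow> int" where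
  "rect_mass F l X b1 b2 d1 d2 = int (rel_rank F l b2 d2 X) - int (rel_rank F l b2 d1 X)
     - (int (rel_rank F l b1 d2 X) - int (rel_rank F l b1 d1 X))"

lemma rect_mass_nonneg:
  fixes F :: "'f::field itself" and X :: "'a::euclidean_space set"
  assumes "finite X" "b1 \<le> b2" "d1 \<le> d2"
  shows "rect_mass F l X b1 b2 d1 d2 \<ge> 0"
  using dim_relative_cycles_supermodular[OF cech_mono[OF assms(2)] cech_mono[OF assms(3)] finite_Union_cech[OF assms(1)], of "Suc l" X, where 'f='f]
  by (simp add: rect_mass_def rel_rank_def)

text \<open>In the expression of the persistent Betti number by dimensions of cycles, the two terms that depend
  on a single radius cancel.\<close>

lemma persistent_betti_rectangle:
  fixes F :: "'f::field itself" and X :: "'a::euclidean_space set" and l :: nat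
  assumes "finite X" "b1 \<le> b2" "b2 \<le> d1" "d1 \<le> d2"
  defines "\<beta> \<equiv> \<lambda>r s. int (persistent_betti F l (cech X r) (cech X s))"
  shows "(\<beta> b2 d1 - \<beta> b1 d1) - (\<beta> b2 d2 - \<beta> b1 d2) = rect_mass F l X b1 b2 d1 d2"
proof -
  have F: "persistent_betti F = persistent_betti TYPE('f)"
    by (intro ext) (simp add: persistent_betti_def)
  have "\<beta> r s = int (chain_space.dim (cycles l (cech X r) :: ('a list \<Rightarrow> 'f) set))
      + int (chain_space.dim (cycles (Suc l) (cech X s) :: ('a list \<Rightarrow> 'f) set)) - int (rel_rank F l r s X)"
    if "r \<le> s" for r s
    unfolding \<beta>_def rel_rank_def F
    by (rule persistent_betti_eq[OF cech_mono[OF that] finite_Union_cech[OF assms(1)]])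
  from this[of b2 d1] this[of b1 d1] this[of b2 d2] this[of b1 d2] show ?thesis
    using assms(2-4) by (simp add: rect_mass_def)
qed

text \<open>Cech complexes are built from closed balls, hence they do not change just after a radius; they are
  also constant just before it. So the increments in the definition of the multiplicity are eventually
  constant, and they vanish unless \<open>b\<close> and \<open>d\<close> are both critical.\<close>

lemma persistence_multiplicity_cech:
  fixes X :: "'a::euclidean_space set"
  assumes X: "finite X" and T: "finite T" "\<And>r s. r \<le> s \<Longrightarrow> {r<..s} \<inter> T = {} \<Longrightarrow> cech X r = cech X s"
    and \<epsilon>: "\<epsilon> > 0" "\<And>t t'. t \<in> T \<Longrightarrow> t' \<in> T \<Longrightarrow> t < t' \<Longrightarrow> t \<le> t' - \<epsilon>"
    and bd: "b < d"
  shows "int (persistence_multiplicity F l (cech X) (b, d)) =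
    (if b \<in> T \<and> d \<in> T then rect_mass F l X (b - \<epsilon>) b (d - \<epsilon>) d else 0)" (is "_ = ?m")
proof -
  have ev: "\<forall>\<^sub>F e in at_right 0. cech X (a + e) = cech X a \<and>
      cech X (a - e) = cech X (if a \<in> T then a - \<epsilon> else a)" for a
  proof -
    \<comment> \<open>Just below a critical \<open>a\<close> the complex is the one at \<open>a - \<epsilon>\<close>; below any other \<open>a\<close> it is the one at \<open>a\<close>.\<close>
    obtain \<delta> where \<delta>: "\<delta> > 0" "\<And>x. x \<in> T \<Longrightarrow> x \<noteq> a \<Longrightarrow> \<delta> \<le> dist a x"
      using finite_set_avoid[OF T(1)] by blast
    have "cech X (a + e) = cech X a \<and> cech X (a - e) = cech X (if a \<in> T then a - \<epsilon> else a)"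
      if e: "0 < e" "e < min \<delta> \<epsilon>" for e
    proof (intro conjI)
      have "{a<..a + e} \<inter> T = {}" using \<delta> e by (fastforce simp: dist_real_def)
      then show "cech X (a + e) = cech X a" using e T(2)[of a "a + e"] by simp
      show "cech X (a - e) = cech X (if a \<in> T then a - \<epsilon> else a)"
      proof (cases "a \<in> T")
        case True
        have "{a - \<epsilon><..a - e} \<inter> T = {}" using \<epsilon>(2)[OF _ True] e by fastforce
        then show ?thesis using True e T(2)[of "a - \<epsilon>" "a - e"] by simp
      next
        case False
        then have "{a - e<..a} \<inter> T = {}" using \<delta> e by (fastforce simp: dist_real_def)
        then show ?thesis using False e T(2)[of "a - e" a] by simp
      qed
    qed
    then show ?thesis
      using \<delta>(1) \<epsilon>(1) unfolding eventually_at_right_field by (intro exI[of _ "min \<delta> \<epsilon>"]) auto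
  qed
  have small: "\<forall>\<^sub>F e in at_right 0. 0 < e \<and> e < (d - b) / 2"
    using bd unfolding eventually_at_right_field by (intro exI[of _ "(d - b) / 2"]) auto
  let ?\<beta> = "\<lambda>r s. int (persistent_betti F l (cech X r) (cech X s))"
  have ev_eq: "\<forall>\<^sub>F e in at_right 0. (?\<beta> (b + e) (d - e) - ?\<beta> (b - e) (d - e)) - (?\<beta> (b + e) (d + e) - ?\<beta> (b - e) (d + e)) = ?m"
    using ev[of b] ev[of d] small
  proof eventually_elim
    case (elim e)
    then have "(?\<beta> (b + e) (d - e) - ?\<beta> (b - e) (d - e)) - (?\<beta> (b + e) (d + e) - ?\<beta> (b - e) (d + e))
       = rect_mass F l X (b - e) (b + e) (d - e) (d + e)"
      using persistent_betti_rectangle[OF X, of "b - e" "b + e" "d - e" "d + e" F l] by (simp add: field_simps)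
    also have "\<dots> = rect_mass F l X (if b \<in> T then b - \<epsilon> else b) b (if d \<in> T then d - \<epsilon> else d) d"
      using elim by (simp add: rect_mass_def rel_rank_def)
    also have "\<dots> = ?m" by (auto simp: rect_mass_def)
    finally show ?case .
  qed
  have "?m \<ge> 0" using rect_mass_nonneg[OF X, of "b - \<epsilon>" b "d - \<epsilon>" d F l] \<epsilon>(1) by simp
  then obtain m where m: "?m = int m" using zero_le_imp_eq_int by blast
  have "persistence_multiplicity F l (cech X) (b, d) = m"
    unfolding persistence_multiplicity_def Let_def prod.case
  proof (rule the_equality)
    show "\<forall>\<^sub>F e in at_right 0. int m = (?\<beta> (b + e) (d - e) - ?\<beta> (b - e) (d - e)) - (?\<beta> (b + e) (d + e) - ?\<beta> (b - e) (d + e))"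
      using ev_eq unfolding m by (rule eventually_mono) simp
  next
    fix k assume "\<forall>\<^sub>F e in at_right 0. int k = (?\<beta> (b + e) (d - e) - ?\<beta> (b - e) (d - e)) - (?\<beta> (b + e) (d + e) - ?\<beta> (b - e) (d + e))"
    with ev_eq have "\<forall>\<^sub>F e in at_right (0::real). k = m"
      unfolding m by eventually_elim simp
    then show "k = m" by (simp add: eventually_const_iff trivial_limit_at_right_real)
  qed
  then show ?thesis unfolding m by simp
qed

lemma size_filter_mset_eq_sum:
  assumes "finite S" "\<And>x. x \<in> B \<Longrightarrow> count D x \<noteq> 0 \<Longrightarrow> x \<in> S" "S \<subseteq> B"
  shows "size (filter_mset (\<lambda>x. x \<in> B) D) = (\<Sum>x\<in>S. count D x)"
proof -
  have "size (filter_mset (\<lambda>x. x \<in> B) D) = (\<Sum>x\<in>set_mset (filter_mset (\<lambda>x. x \<in> B) D). count D x)"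
    by (simp add: size_multiset_overloaded_eq)
  also have "\<dots> = (\<Sum>x\<in>S. count D x)"
    using assms by (intro sum.mono_neutral_left) (auto simp: not_in_iff)
  finally show ?thesis .
qed

text \<open>The multiplicities are the mixed jumps of \<open>rel_rank\<close> in both radii; summing them first over the deaths
  and then over the births gives the rectangle increment.\<close>

lemma Dgm_rectangle:
  fixes X :: "'a::euclidean_space set"
  assumes X: "finite X" and "b1 \<le> b2" "b2 \<le> d1" "d1 \<le> d2"
  shows "int (size (filter_mset (\<lambda>x. x \<in> {b1<..b2} \<times> {d1<..d2}) (Dgm F l X))) = rect_mass F l X b1 b2 d1 d2"
proof -
  obtain T where T: "finite T" "\<And>r s. r \<le> s \<Longrightarrow> {r<..s} \<inter> T = {} \<Longrightarrow> cech X r = cech X s"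
    using cech_critical_values[OF X] by blast
  obtain \<epsilon> where \<epsilon>: "\<epsilon> > 0" "\<And>t t'. t \<in> T \<Longrightarrow> t' \<in> T \<Longrightarrow> t < t' \<Longrightarrow> t \<le> t' - \<epsilon>"
    using finite_gap[OF T(1)] by blast
  define f where "f = (\<lambda>p. if p \<in> Delta then persistence_multiplicity F l (cech X) p else 0)"
  have f: "int (f (b, d)) = (if b \<in> T \<and> d \<in> T then rect_mass F l X (b - \<epsilon>) b (d - \<epsilon>) d else 0)" if "b < d" for b d
    using persistence_multiplicity_cech[OF X T \<epsilon> that, of F l] that by (simp add: f_def Delta_def)
  have f0: "p \<in> T \<times> T \<and> p \<in> Delta" if "f p \<noteq> 0" for p
  proof -
    obtain b d where p: "p = (b, d)" by fastforce
    have "p \<in> Delta" using that by (simp add: f_def split: if_splits)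
    moreover from this have "b < d" by (simp add: Delta_def p)
    ultimately show ?thesis using f[of b d] that p by (auto split: if_splits)
  qed
  have fin: "finite {p. f p > 0}"
    by (rule finite_subset[of _ "T \<times> T"]) (use f0 T(1) in auto)
  have count: "count (Dgm F l X) = f"
    unfolding Dgm_def persistence_diagram_def f_def[symmetric] using count_Abs_multiset[OF fin] .
  let ?S = "(T \<inter> {b1<..b2}) \<times> (T \<inter> {d1<..d2})"
  let ?g = "\<lambda>b d. int (rel_rank F l b d X)"
  have "int (size (filter_mset (\<lambda>x. x \<in> {b1<..b2} \<times> {d1<..d2}) (Dgm F l X))) = (\<Sum>p\<in>?S. int (f p))"
    using f0 T(1) by (subst size_filter_mset_eq_sum[of ?S]) (auto simp: count)
  also have "\<dots> = (\<Sum>b\<in>T \<inter> {b1<..b2}. \<Sum>d\<in>T \<inter> {d1<..d2}. int (f (b, d)))"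
    by (simp add: sum.cartesian_product)
  also have "\<dots> = (\<Sum>b\<in>T \<inter> {b1<..b2}. \<Sum>d\<in>T \<inter> {d1<..d2}. (?g b d - ?g (b - \<epsilon>) d) - (?g b (d - \<epsilon>) - ?g (b - \<epsilon>) (d - \<epsilon>)))"
    using assms(3) by (intro sum.cong refl) (subst f, auto simp: rect_mass_def)
  also have "\<dots> = (\<Sum>b\<in>T \<inter> {b1<..b2}. (?g b d2 - ?g (b - \<epsilon>) d2) - (?g b d1 - ?g (b - \<epsilon>) d1))"
    by (intro sum.cong refl step_function_sum_jumps[OF T(1) _ \<epsilon> assms(4), of "\<lambda>d. ?g b d - ?g (b - \<epsilon>) d" for b])
      (simp_all add: rel_rank_def T(2))
  also have "\<dots> = (\<Sum>b\<in>T \<inter> {b1<..b2}. (?g b d2 - ?g b d1) - (?g (b - \<epsilon>) d2 - ?g (b - \<epsilon>) d1))"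
    by (intro sum.cong) auto
  also have "\<dots> = (?g b2 d2 - ?g b2 d1) - (?g b1 d2 - ?g b1 d1)"
    by (rule step_function_sum_jumps[OF T(1) _ \<epsilon> assms(2), of "\<lambda>b. ?g b d2 - ?g b d1"]) (simp add: rel_rank_def T(2))
  finally show ?thesis by (simp add: rect_mass_def)
qed

section \<open>Grids, and perturbation of the vertices\<close>

text \<open>The lower corner of the half-open cube of side \<open>h\<close> of the standard grid that contains \<open>x\<close>.\<close>

definition grid :: "real \<Rightarrow> 'a::euclidean_space \<Rightarrow> 'a" where
  "grid h x = (\<Sum>i\<in>Basis. (h * of_int \<lfloor>(x \<bullet> i) / h\<rfloor>) *\<^sub>R i)"

lemma grid_inner: "i \<in> Basis \<Longrightarrow> grid h x \<bullet> i = h * of_int \<lfloor>(x \<bullet> i) / h\<rfloor>"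
  by (simp add: grid_def inner_sum_left_Basis)

lemma grid_bounds:
  assumes "h > 0" "i \<in> Basis"
  shows "grid h x \<bullet> i \<le> x \<bullet> i" "x \<bullet> i < grid h x \<bullet> i + h"
proof -
  have 1: "of_int \<lfloor>(x \<bullet> i) / h\<rfloor> \<le> (x \<bullet> i) / h" "(x \<bullet> i) / h < of_int \<lfloor>(x \<bullet> i) / h\<rfloor> + 1"
    by linarith+
  show "grid h x \<bullet> i \<le> x \<bullet> i" "x \<bullet> i < grid h x \<bullet> i + h"
    using 1 unfolding pos_le_divide_eq[OF assms(1)] pos_divide_less_eq[OF assms(1)]
    by (simp_all add: grid_inner[OF assms(2)] algebra_simps)
qed

lemma dist_grid: "h > 0 \<Longrightarrow> dist x (grid h x) \<le> h * DIM('a)" for x :: "'a::euclidean_space"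
proof -
  assume h: "h > 0"
  have "dist x (grid h x) \<le> (\<Sum>i\<in>Basis. \<bar>(x - grid h x) \<bullet> i\<bar>)"
    unfolding dist_norm by (rule norm_le_l1)
  also have "\<dots> \<le> (\<Sum>i\<in>(Basis::'a set). h)"
  proof (rule sum_mono)
    fix i :: 'a assume "i \<in> Basis"
    from grid_bounds[OF h this, of x] show "\<bar>(x - grid h x) \<bullet> i\<bar> \<le> h"
      unfolding inner_diff_left by linarith
  qed
  finally show ?thesis by (simp add: mult.commute)
qed

lemma grid_measurable [measurable]: "grid h \<in> borel_measurable borel"
  unfolding grid_def by measurable

lemma finite_grid_image:
  fixes A :: "'a::euclidean_space set"
  assumes "bounded A" "h > 0"
  shows "finite (grid h ` A)"
proof -
  obtain R where R: "\<And>x. x \<in> A \<Longrightarrow> norm x \<le> R" using assms(1) by (auto simp: bounded_iff)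
  define N where "N = \<lceil>R / h\<rceil> + 1"
  let ?F = "(\<lambda>f. \<Sum>i\<in>Basis. (h * of_int (f i)) *\<^sub>R i) ` (Basis \<rightarrow>\<^sub>E {-N..N}) :: 'a set"
  have "grid h x \<in> ?F" if "x \<in> A" for x
  proof -
    let ?f = "restrict (\<lambda>i. \<lfloor>(x \<bullet> i) / h\<rfloor>) Basis"
    have "\<lfloor>(x \<bullet> i) / h\<rfloor> \<in> {-N..N}" if i: "i \<in> Basis" for i
    proof -
      have "x \<bullet> i \<le> R" "- R \<le> x \<bullet> i" using R[OF \<open>x \<in> A\<close>] Basis_le_norm[OF i, of x] by linarith+
      then have "(x \<bullet> i) / h \<le> R / h" "(- R) / h \<le> (x \<bullet> i) / h"
        using assms(2) by (simp_all only: divide_right_mono less_imp_le)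
      then show ?thesis unfolding N_def atLeastAtMost_iff minus_divide_left[symmetric] by linarith
    qed
    then have "?f \<in> Basis \<rightarrow>\<^sub>E {-N..N}" by auto
    moreover have "grid h x = (\<Sum>i\<in>Basis. (h * of_int (?f i)) *\<^sub>R i)"
      unfolding grid_def by (intro sum.cong) auto
    ultimately show ?thesis by blast
  qed
  then have "grid h ` A \<subseteq> ?F" by blast
  then show ?thesis by (rule finite_subset) (intro finite_imageI finite_PiE; simp)
qed

lemma grid_translate:
  assumes "h > 0" "p \<in> range (grid h)"
  shows "grid h (x + p) = grid h x + p"
proof (rule euclidean_eqI)
  fix i :: 'a assume i: "i \<in> Basis"
  obtain y where p: "p = grid h y" using assms(2) by auto
  have "(x + p) \<bullet> i / h = x \<bullet> i / h + of_int \<lfloor>(y \<bullet> i) / h\<rfloor>"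
    using assms(1) by (simp add: p grid_inner[OF i] inner_add_left add_divide_distrib)
  then have "\<lfloor>(x + p) \<bullet> i / h\<rfloor> = \<lfloor>x \<bullet> i / h\<rfloor> + \<lfloor>(y \<bullet> i) / h\<rfloor>" by simp
  then show "grid h (x + p) \<bullet> i = (grid h x + p) \<bullet> i"
    by (simp add: grid_inner[OF i] inner_add_left p distrib_left)
qed

lemma grid_eqI:
  assumes "m > 0" and "\<And>i. i \<in> Basis \<Longrightarrow> grid m x \<bullet> i \<le> y \<bullet> i \<and> y \<bullet> i < grid m x \<bullet> i + m"
  shows "grid m y = grid m x"
  unfolding grid_def
proof (rule sum.cong[OF refl])
  fix i :: 'a assume i: "i \<in> Basis"
  have "\<lfloor>(y \<bullet> i) / m\<rfloor> = \<lfloor>(x \<bullet> i) / m\<rfloor>"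
  proof (rule floor_unique)
    show "of_int \<lfloor>(x \<bullet> i) / m\<rfloor> \<le> (y \<bullet> i) / m" "(y \<bullet> i) / m < of_int \<lfloor>(x \<bullet> i) / m\<rfloor> + 1"
      unfolding pos_le_divide_eq[OF assms(1)] pos_divide_less_eq[OF assms(1)]
      using assms(2)[OF i] by (simp_all add: grid_inner[OF i] algebra_simps)
  qed
  then show "(m * of_int \<lfloor>(y \<bullet> i) / m\<rfloor>) *\<^sub>R i = (m * of_int \<lfloor>(x \<bullet> i) / m\<rfloor>) *\<^sub>R i" by simp
qed

definition cell :: "real \<Rightarrow> 'a::euclidean_space \<Rightarrow> 'a set" where
  "cell h p = {x. grid h x = p}"

lemma cell_borel [measurable, simp]: "cell h p \<in> sets borel"
proof -
  have "grid h -` {p} \<inter> space borel \<in> sets borel" by measurable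
  moreover have "grid h -` {p} \<inter> space borel = cell h p" by (auto simp: cell_def)
  ultimately show ?thesis by metis
qed

lemma bounded_cell: "h > 0 \<Longrightarrow> bounded (cell h p)" for p :: "'a::euclidean_space"
  by (rule bounded_subset[of "cball p (h * DIM('a))"]) (auto simp: cell_def dist_commute intro: dist_grid)

lemma disjoint_cells: "disjoint_family_on (cell h) S"
  by (auto simp: disjoint_family_on_def cell_def)

lemma grid_zero [simp]: "grid h 0 = 0"
  by (simp add: grid_def)

lemma cell_translate:
  assumes "h > 0" "p \<in> range (grid h)"
  shows "cell h p = (\<lambda>x. x + p) ` cell h 0"
proof -
  have *: "grid h (x - p) = grid h x - p" for x
    using grid_translate[OF assms, of "x - p"] by simp
  show ?thesis
  proof (intro equalityI subsetI)
    fix x assume "x \<in> cell h p"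
    then have "x - p \<in> cell h 0" using * by (simp add: cell_def)
    then show "x \<in> (\<lambda>x. x + p) ` cell h 0" by (metis diff_add_cancel imageI)
  qed (use grid_translate[OF assms] in \<open>auto simp: cell_def\<close>)
qed

lemma rel_rank_blocks:
  fixes X :: "'a::euclidean_space set"
  assumes "finite X" "finite J" "disjoint_family_on B J"
  shows "(\<Sum>i\<in>J. rel_rank F l r s (X \<inter> B i)) \<le> rel_rank F l r s X"
    and "rel_rank F l r s X \<le> (\<Sum>i\<in>J. rel_rank F l r s (X \<inter> B i))
           + card {vs \<in> orderings (Suc l) (cech X s). \<forall>i\<in>J. \<not> set vs \<subseteq> B i}"
  unfolding rel_rank_def cech_Int
  using dim_relative_cycles_blocks[OF finite_Union_cech[OF assms(1)] assms(2,3)] by blast+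

lemma rel_rank_mono:
  assumes "finite Y" "X \<subseteq> Y"
  shows "rel_rank F l r s X \<le> rel_rank F l r s Y"
  using rel_rank_blocks(1)[OF assms(1), of "{()}" "\<lambda>_. X" F l r s] assms(2)
  by (simp add: disjoint_family_on_def Int_absorb1)

lemma rel_rank_le_card:
  assumes "finite X"
  shows "rel_rank F l r s X \<le> card X ^ (l + 2)"
proof -
  have "rel_rank F l r s X \<le> card (orderings (Suc l) (cech X s))"
    unfolding rel_rank_def
    by (rule dim_supported_le_card[OF finite_orderings[OF finite_Union_cech[OF assms]] relative_cycles_supported])
  also have "\<dots> \<le> card {vs. set vs \<subseteq> X \<and> length vs = l + 2}"
    using assms cech_subset[of X s] by (intro card_mono finite_lists_length_eq) (auto simp: orderings_def)
  finally show ?thesis using assms by (simp add: card_lists_length_eq)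
qed

lemma rel_rank_iso:
  fixes X :: "'a::euclidean_space set" and Y :: "'b::euclidean_space set"
  assumes "finite X" "bij_betw \<phi> X Y"
    and "\<And>\<sigma>. \<sigma> \<subseteq> X \<Longrightarrow> \<phi> ` \<sigma> \<in> cech Y r' \<longleftrightarrow> \<sigma> \<in> cech X r"
    and "\<And>\<sigma>. \<sigma> \<subseteq> X \<Longrightarrow> \<phi> ` \<sigma> \<in> cech Y s' \<longleftrightarrow> \<sigma> \<in> cech X s"
  shows "rel_rank F l r s X = rel_rank F l r' s' Y"
  unfolding rel_rank_def
  by (rule dim_relative_cycles_iso[OF assms(1) cech_subset cech_subset assms(2) assms(4) assms(3)])

lemma rel_rank_translate:
  assumes "finite X"
  shows "rel_rank F l r s ((\<lambda>x. x + v) ` X) = rel_rank F l r s X"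
proof (rule rel_rank_iso[OF assms, symmetric])
  show "bij_betw (\<lambda>x. x + v) X ((\<lambda>x. x + v) ` X)" by (auto simp: bij_betw_def)
  have *: "(\<lambda>x. x + v) ` \<sigma> \<in> cech ((\<lambda>x. x + v) ` X) t \<longleftrightarrow> \<sigma> \<in> cech X t" if "\<sigma> \<subseteq> X" for \<sigma> t
  proof -
    have "(\<Inter>x\<in>\<sigma>. cball (x + v) t) \<noteq> {} \<longleftrightarrow> (\<Inter>x\<in>\<sigma>. cball x t) \<noteq> {}"
    proof
      assume "(\<Inter>x\<in>\<sigma>. cball (x + v) t) \<noteq> {}"
      then obtain y where "\<forall>x\<in>\<sigma>. dist (x + v) y \<le> t" by auto
      then have "y - v \<in> (\<Inter>x\<in>\<sigma>. cball x t)" by (auto simp: dist_norm algebra_simps)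
      then show "(\<Inter>x\<in>\<sigma>. cball x t) \<noteq> {}" by blast
    next
      assume "(\<Inter>x\<in>\<sigma>. cball x t) \<noteq> {}"
      then obtain y where "\<forall>x\<in>\<sigma>. dist x y \<le> t" by auto
      then have "y + v \<in> (\<Inter>x\<in>\<sigma>. cball (x + v) t)" by auto
      then show "(\<Inter>x\<in>\<sigma>. cball (x + v) t) \<noteq> {}" by blast
    qed
    then show ?thesis using that by (auto simp: cech_def)
  qed
  show "(\<lambda>x. x + v) ` \<sigma> \<in> cech ((\<lambda>x. x + v) ` X) r \<longleftrightarrow> \<sigma> \<in> cech X r"
       "(\<lambda>x. x + v) ` \<sigma> \<in> cech ((\<lambda>x. x + v) ` X) s \<longleftrightarrow> \<sigma> \<in> cech X s" if "\<sigma> \<subseteq> X" for \<sigma>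
    using *[OF that] by blast+
qed

lemma cech_right_continuous:
  fixes X :: "'a::euclidean_space set"
  assumes "finite X"
  shows "\<exists>\<delta>>0. \<forall>e. 0 \<le> e \<and> e < \<delta> \<longrightarrow> cech X (r + e) = cech X r"
proof -
  obtain T where T: "finite T" "\<And>r s. r \<le> s \<Longrightarrow> {r<..s} \<inter> T = {} \<Longrightarrow> cech X r = cech X s"
    using cech_critical_values[OF assms] by blast
  obtain \<delta> where \<delta>: "\<delta> > 0" "\<And>x. x \<in> T \<Longrightarrow> x \<noteq> r \<Longrightarrow> \<delta> \<le> dist r x"
    using finite_set_avoid[OF T(1)] by blast
  have "cech X (r + e) = cech X r" if "0 \<le> e" "e < \<delta>" for e
  proof -
    have "{r<..r + e} \<inter> T = {}" using \<delta> that by (fastforce simp: dist_real_def)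
    then show ?thesis using that T(2)[of r "r + e"] by simp
  qed
  then show ?thesis using \<delta>(1) by blast
qed

text \<open>If all vertices move by at most \<open>\<delta>\<close> and the radii grow by \<open>\<delta>\<close>, no simplex is lost, and every simplex of
  the perturbed complex comes from a simplex at radius at most \<open>2 * \<delta>\<close> larger. For small \<open>\<delta>\<close> there is no
  critical value in between.\<close>

lemma rel_rank_perturb:
  fixes X :: "'a::euclidean_space set" and r s :: real
  assumes X: "finite X"
  shows "\<exists>\<epsilon>>0. \<forall>\<delta> \<phi>. \<delta> < \<epsilon> \<and> (\<forall>x\<in>X. dist x (\<phi> x) \<le> \<delta>) \<longrightarrow>
    rel_rank F l (r + \<delta>) (s + \<delta>) (\<phi> ` X) = rel_rank F l r s X"
proof (cases "X = {}")
  case False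
  obtain \<delta>1 where \<delta>1: "\<delta>1 > 0" "\<And>e. 0 \<le> e \<and> e < \<delta>1 \<longrightarrow> cech X (r + e) = cech X r"
    using cech_right_continuous[OF X] by blast
  obtain \<delta>2 where \<delta>2: "\<delta>2 > 0" "\<And>e. 0 \<le> e \<and> e < \<delta>2 \<longrightarrow> cech X (s + e) = cech X s"
    using cech_right_continuous[OF X] by blast
  have "\<exists>d>0. \<forall>x\<in>X. \<forall>y\<in>X. x \<noteq> y \<longrightarrow> d \<le> dist x y"
  proof -
    have "\<forall>y\<in>X. \<exists>d>0. \<forall>x\<in>X. x \<noteq> y \<longrightarrow> d \<le> dist y x"
      using finite_set_avoid[OF X] by blast
    then obtain d where d: "\<And>y. y \<in> X \<Longrightarrow> d y > 0" "\<And>x y. y \<in> X \<Longrightarrow> x \<in> X \<Longrightarrow> x \<noteq> y \<Longrightarrow> d y \<le> dist y x"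
      by metis
    have "Min (d ` X) > 0" using X False d(1) by (subst Min_gr_iff) auto
    moreover have "Min (d ` X) \<le> dist x y" if "x \<in> X" "y \<in> X" "x \<noteq> y" for x y
    proof -
      have "Min (d ` X) \<le> d x" using X that(1) by (intro Min_le) auto
      also have "\<dots> \<le> dist x y" using d(2)[OF that(1,2)] that(3) by blast
      finally show ?thesis .
    qed
    ultimately show ?thesis by blast
  qed
  then obtain \<delta>3 where \<delta>3: "\<delta>3 > 0" "\<And>x y. x \<in> X \<Longrightarrow> y \<in> X \<Longrightarrow> x \<noteq> y \<Longrightarrow> \<delta>3 \<le> dist x y"
    by blast
  \<comment> \<open>The radii change by up to \<open>2 * \<delta>\<close>, and points that are merged by \<open>\<phi>\<close> have distance at most \<open>2 * \<delta>\<close>.\<close>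
  define \<epsilon> where "\<epsilon> = min \<delta>1 (min \<delta>2 \<delta>3) / 2"
  have "rel_rank F l (r + \<delta>) (s + \<delta>) (\<phi> ` X) = rel_rank F l r s X"
    if \<delta>: "\<delta> < \<epsilon>" and \<phi>: "\<And>x. x \<in> X \<Longrightarrow> dist x (\<phi> x) \<le> \<delta>" for \<delta> \<phi>
  proof (rule rel_rank_iso[OF X, symmetric])
    obtain x where "x \<in> X" using False by blast
    then have "0 \<le> \<delta>" using \<phi>[of x] zero_le_dist[of x "\<phi> x"] by linarith
    then have small: "0 \<le> 2 * \<delta>" "2 * \<delta> < \<delta>1" "2 * \<delta> < \<delta>2" "2 * \<delta> < \<delta>3"
      using \<delta> by (simp_all add: \<epsilon>_def)
    have "inj_on \<phi> X"
    proof (rule inj_onI, rule ccontr)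
      fix x y assume xy: "x \<in> X" "y \<in> X" "\<phi> x = \<phi> y" "x \<noteq> y"
      have "dist x y \<le> dist x (\<phi> x) + dist y (\<phi> y)" using xy(3) dist_triangle2 by metis
      then show False using \<phi>[OF xy(1)] \<phi>[OF xy(2)] \<delta>3(2)[OF xy(1,2,4)] small by linarith
    qed
    then show "bij_betw \<phi> X (\<phi> ` X)" by (simp add: bij_betw_def)
    have *: "\<phi> ` \<sigma> \<in> cech (\<phi> ` X) (t + \<delta>) \<longleftrightarrow> \<sigma> \<in> cech X t"
      if \<sigma>: "\<sigma> \<subseteq> X" and t: "cech X (t + 2 * \<delta>) = cech X t" for \<sigma> t
    proof
      assume "\<phi> ` \<sigma> \<in> cech (\<phi> ` X) (t + \<delta>)"
      then obtain y where y: "\<sigma> \<noteq> {}" "\<forall>x\<in>\<sigma>. dist (\<phi> x) y \<le> t + \<delta>" by (auto simp: cech_def)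
      have "dist x y \<le> t + 2 * \<delta>" if "x \<in> \<sigma>" for x
        using y(2) that \<phi>[of x] \<sigma> dist_triangle[of x y "\<phi> x"] by fastforce
      then have "y \<in> (\<Inter>x\<in>\<sigma>. cball x (t + 2 * \<delta>))" by auto
      then have "\<sigma> \<in> cech X (t + 2 * \<delta>)" using y(1) \<sigma> unfolding cech_def by blast
      then show "\<sigma> \<in> cech X t" using t by simp
    next
      assume "\<sigma> \<in> cech X t"
      then obtain y where y: "\<sigma> \<noteq> {}" "\<forall>x\<in>\<sigma>. dist x y \<le> t" by (auto simp: cech_def)
      have "dist (\<phi> x) y \<le> t + \<delta>" if "x \<in> \<sigma>" for x
        using y(2) that \<phi>[of x] \<sigma> dist_triangle3[of "\<phi> x" y x] by fastforce
      then have "y \<in> (\<Inter>x\<in>\<phi> ` \<sigma>. cball x (t + \<delta>))" by auto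
      then show "\<phi> ` \<sigma> \<in> cech (\<phi> ` X) (t + \<delta>)" using y(1) \<sigma> unfolding cech_def by blast
    qed
    show "\<phi> ` \<sigma> \<in> cech (\<phi> ` X) (r + \<delta>) \<longleftrightarrow> \<sigma> \<in> cech X r" if "\<sigma> \<subseteq> X" for \<sigma>
      using *[OF that] \<delta>1(2) small by blast
    show "\<phi> ` \<sigma> \<in> cech (\<phi> ` X) (s + \<delta>) \<longleftrightarrow> \<sigma> \<in> cech X s" if "\<sigma> \<subseteq> X" for \<sigma>
      using *[OF that] \<delta>2(2) small by blast
  qed
  moreover have "\<epsilon> > 0" using \<delta>1 \<delta>2 \<delta>3 by (simp add: \<epsilon>_def)
  ultimately show ?thesis by blast
next
  case True
  have "rel_rank F l r' s' ({}::'a set) = 0" for r' s'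
    using rel_rank_le_card[of "{}" F l r' s'] by simp
  then show ?thesis using True by (intro exI[of _ 1]) auto
qed

text \<open>This exhibits \<open>rel_rank\<close> as a limit of functions that depend on \<open>X\<close> only through the grid cells that
  it meets. It is the source of all measurability statements.\<close>

lemma rel_rank_grid_eventually:
  fixes X :: "'a::euclidean_space set" and r s :: real
  assumes X: "finite X"
  shows "\<forall>\<^sub>F m in sequentially. rel_rank F l (r + DIM('a) / 2 ^ m) (s + DIM('a) / 2 ^ m) (grid (1 / 2 ^ m) ` X)
           = rel_rank F l r s X"
proof -
  obtain \<epsilon> where \<epsilon>: "\<epsilon> > 0" "\<And>\<delta> \<phi>. \<delta> < \<epsilon> \<and> (\<forall>x\<in>X. dist x (\<phi> x) \<le> \<delta>) \<longrightarrow>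
    rel_rank F l (r + \<delta>) (s + \<delta>) (\<phi> ` X) = rel_rank F l r s X"
    using rel_rank_perturb[OF X, of F l r s] by blast
  have "(\<lambda>m. DIM('a) / 2 ^ m) \<longlonglongrightarrow> 0" by real_asymp
  then have "\<forall>\<^sub>F m in sequentially. DIM('a) / 2 ^ m < \<epsilon>" using \<epsilon>(1) by (rule order_tendstoD)
  then show ?thesis
  proof eventually_elim
    case (elim m)
    then show ?case using dist_grid[of "1 / 2 ^ m", where 'a='a] by (intro \<epsilon>(2)[rule_format]) auto
  qed
qed

text \<open>A simplex of the Cech complex at radius \<open>s\<close> has diameter at most \<open>2 * s\<close>. If it leaves the cell of side
  \<open>m\<close> of one of its vertices in \<open>A\<close>, then the corner of the unit cell of that vertex belongs to this set.\<close>

definition straddling :: "real \<Rightarrow> real \<Rightarrow> 'a::euclidean_space set \<Rightarrow> 'a set" where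
  "straddling m s A = grid 1 ` {x \<in> A. \<exists>y. dist x y \<le> 2 * s \<and> grid m y \<noteq> grid m x}"

text \<open>An ordering of a simplex that is in no single cell of side \<open>m\<close> is charged to the unit cell of its first
  vertex. All its vertices are in the ball of radius \<open>DIM('a) + 2 * s\<close> about the corner of that cell, since the
  vertices have mutual distance at most \<open>2 * s\<close>.\<close>

lemma rel_rank_tiles:
  fixes X A :: "'a::euclidean_space set" and r s m :: real
  assumes X: "finite X" "X \<subseteq> A" and A: "bounded A" and m: "m > 0"
  shows "rel_rank F l r s X \<le> (\<Sum>p\<in>grid m ` A. rel_rank F l r s (X \<inter> cell m p))
     + (\<Sum>c\<in>straddling m s A. card (X \<inter> cball c (DIM('a) + 2 * s)) ^ (l + 2))"
proof -
  let ?T = "{vs \<in> orderings (Suc l) (cech X s). \<forall>p\<in>grid m ` A. \<not> set vs \<subseteq> cell m p}"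
  let ?L = "\<lambda>c. {vs. set vs \<subseteq> X \<inter> cball c (DIM('a) + 2 * s) \<and> length vs = l + 2}"
  have fin: "finite (straddling m s A)" unfolding straddling_def
    using A by (intro finite_grid_image bounded_subset[OF A]) auto
  have "?T \<subseteq> (\<Union>c\<in>straddling m s A. ?L c)"
  proof
    fix vs assume vs: "vs \<in> ?T"
    then have len: "length vs = l + 2" and cv: "set vs \<in> cech X s" by (auto simp: orderings_def)
    define x where "x = hd vs"
    have x: "x \<in> set vs" using len unfolding x_def by (cases vs) auto
    have sub: "set vs \<subseteq> X" using cv by (auto simp: cech_def)
    obtain z where z: "\<forall>v\<in>set vs. dist v z \<le> s" using cv by (auto simp: cech_def)
    have d: "dist x v \<le> 2 * s" if "v \<in> set vs" for v
      using z[rule_format, OF x] z[rule_format, OF that] dist_triangle2[of x v z] by simp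
    have xA: "x \<in> A" using x sub X(2) by auto
    then obtain v where v: "v \<in> set vs" "grid m v \<noteq> grid m x" using vs by (auto simp: cell_def)
    have "grid 1 x \<in> straddling m s A" using xA d[OF v(1)] v(2) by (auto simp: straddling_def)
    moreover have "dist (grid 1 x) w \<le> DIM('a) + 2 * s" if "w \<in> set vs" for w
      using d[OF that] dist_grid[of 1 x] dist_triangle3[of "grid 1 x" w x] by simp
    ultimately show "vs \<in> (\<Union>c\<in>straddling m s A. ?L c)" using len sub by (auto intro!: bexI[of _ "grid 1 x"])
  qed
  then have "card ?T \<le> card (\<Union>c\<in>straddling m s A. ?L c)"
    using fin X(1) by (intro card_mono finite_UN_I finite_lists_length_eq) auto
  also have "\<dots> \<le> (\<Sum>c\<in>straddling m s A. card (?L c))" by (rule card_UN_le[OF fin])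
  also have "\<dots> = (\<Sum>c\<in>straddling m s A. card (X \<inter> cball c (DIM('a) + 2 * s)) ^ (l + 2))"
    using X(1) by (intro sum.cong card_lists_length_eq refl) auto
  finally show ?thesis
    using rel_rank_blocks(2)[OF X(1) finite_grid_image[OF A m] disjoint_cells, of F l r s m] by simp
qed

section \<open>Point processes seen through their atoms\<close>

lemma bounded_borel_Int: "A \<in> bounded_borel \<Longrightarrow> B \<in> sets borel \<Longrightarrow> A \<inter> B \<in> bounded_borel"
  by (auto simp: bounded_borel_def intro: bounded_Int)

lemma cell_bounded_borel: "h > 0 \<Longrightarrow> cell h p \<in> bounded_borel"
  by (simp add: bounded_borel_def bounded_cell)

lemma cball_bounded_borel: "cball x r \<in> bounded_borel"
  by (simp add: bounded_borel_def)

lemma translate_borel: "A \<in> sets borel \<Longrightarrow> (\<lambda>x. x + v) ` A \<in> sets (borel :: 'a::euclidean_space measure)"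
proof -
  assume A: "A \<in> sets borel"
  have "(\<lambda>x. x - v) -` A \<inter> space borel \<in> sets borel"
    by (rule measurable_sets[OF _ A]) measurable
  moreover have "(\<lambda>x. x - v) -` A \<inter> space borel = (\<lambda>x. x + v) ` A"
    by (auto simp: image_iff) (metis diff_add_cancel)
  ultimately show ?thesis by metis
qed

lemma translate_bounded_borel: "A \<in> bounded_borel \<Longrightarrow> (\<lambda>x. x + v) ` A \<in> bounded_borel"
  using bounded_translation[of A v] by (auto simp: bounded_borel_def translate_borel add.commute)

lemma space_measure_algebra: "space measure_algebra = bdd_finite_measures"
proof -
  have "{} \<in> (bounded_borel :: 'a set set)" by (simp add: bounded_borel_def)
  then show ?thesis
    unfolding measure_algebra_def by (subst space_Sup_eq_UN) auto
qed

lemma measurable_emeasure_measure_algebra: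
  assumes "A \<in> bounded_borel"
  shows "(\<lambda>\<mu>. emeasure \<mu> A) \<in> borel_measurable measure_algebra"
  unfolding measure_algebra_def
  by (rule measurable_SUP1[OF assms]) (auto intro: measurable_vimage_algebra1)

lemma measurable_measure_algebraI:
  assumes "\<And>\<omega>. \<omega> \<in> space M \<Longrightarrow> f \<omega> \<in> bdd_finite_measures"
    and "\<And>A. A \<in> bounded_borel \<Longrightarrow> (\<lambda>\<omega>. emeasure (f \<omega>) A) \<in> borel_measurable M"
  shows "f \<in> M \<rightarrow>\<^sub>M measure_algebra"
  unfolding measure_algebra_def
proof (rule measurable_SUP2)
  show "bounded_borel \<noteq> ({} :: 'b set set)" by (auto simp: bounded_borel_def)
  show "f \<in> M \<rightarrow>\<^sub>M vimage_algebra bdd_finite_measures (\<lambda>\<mu>. emeasure \<mu> A) borel" if "A \<in> bounded_borel" for A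
    using assms(1) assms(2)[OF that] by (intro measurable_vimage_algebra2) auto
qed simp

definition counting_measure :: "'a::euclidean_space measure \<Rightarrow> bool" where
  "counting_measure \<mu> \<longleftrightarrow> \<mu> \<in> bdd_finite_measures \<and> (\<forall>A\<in>bounded_borel. \<exists>m::nat. emeasure \<mu> A = of_nat m)"

lemma counting_sets: "counting_measure \<mu> \<Longrightarrow> sets \<mu> = sets borel"
  by (simp add: counting_measure_def bdd_finite_measures_def)

lemma counting_ge_1:
  assumes "counting_measure \<mu>" "A \<in> bounded_borel" "emeasure \<mu> A > 0"
  shows "emeasure \<mu> A \<ge> 1"
proof -
  obtain m :: nat where m: "emeasure \<mu> A = of_nat m" using assms by (auto simp: counting_measure_def)
  then have "m \<noteq> 0" using assms(3) by (intro notI) simp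
  then have "1 \<le> m" by simp
  then have "(of_nat 1 :: ennreal) \<le> of_nat m" by (rule of_nat_mono)
  then show ?thesis using m by simp
qed

lemma card_atoms_le:
  assumes \<mu>: "counting_measure \<mu>" and A: "A \<in> bounded_borel"
  shows "finite (atoms_in \<mu> A)" "of_nat (card (atoms_in \<mu> A)) \<le> emeasure \<mu> A"
proof -
  note [simp] = counting_sets[OF \<mu>]
  obtain m :: nat where m: "emeasure \<mu> A = of_nat m" using assms by (auto simp: counting_measure_def)
  have "card G \<le> m" if G: "G \<subseteq> atoms_in \<mu> A" "finite G" for G
  proof -
    have "(of_nat (card G) :: ennreal) = (\<Sum>x\<in>G. 1)" by simp
    also have "\<dots> \<le> (\<Sum>x\<in>G. emeasure \<mu> {x})"
    proof (rule sum_mono)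
      fix x assume "x \<in> G"
      then show "1 \<le> emeasure \<mu> {x}"
        using G(1) by (intro counting_ge_1[OF \<mu>]) (auto simp: atoms_in_def bounded_borel_def)
    qed
    also have "\<dots> = emeasure \<mu> G" using G(2) by (intro emeasure_eq_sum_singleton[symmetric]) auto
    also have "\<dots> \<le> emeasure \<mu> A"
      using G(1) A by (intro emeasure_mono) (auto simp: atoms_in_def bounded_borel_def)
    finally show ?thesis unfolding m by simp
  qed
  then have "finite (atoms_in \<mu> A) \<and> card (atoms_in \<mu> A) \<le> m"
    by (intro finite_if_finite_subsets_card_bdd) blast
  then show "finite (atoms_in \<mu> A)" "of_nat (card (atoms_in \<mu> A)) \<le> emeasure \<mu> A"
    unfolding m by auto
qed

text \<open>Masses are integers. If no point of \<open>A\<close> were an atom, every point would have a neighbourhood that meets \<open>A\<close>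
  in mass less than \<open>1\<close>, hence in mass \<open>0\<close>, and finitely many of these neighbourhoods cover \<open>A\<close>.\<close>

lemma atoms_nonempty:
  fixes \<mu> :: "'a::euclidean_space measure"
  assumes \<mu>: "counting_measure \<mu>" and A: "A \<in> bounded_borel" and pos: "emeasure \<mu> A > 0"
  shows "atoms_in \<mu> A \<noteq> {}"
proof
  assume none: "atoms_in \<mu> A = {}"
  note [simp] = counting_sets[OF \<mu>]
  have [measurable]: "A \<in> sets borel" and "bounded A" using A by (auto simp: bounded_borel_def)
  have null: "\<exists>e>0. emeasure \<mu> (A \<inter> ball x e) = 0" for x
  proof -
    let ?S = "\<lambda>n. A \<inter> ball x (1 / Suc n)"
    have bb: "?S n \<in> bounded_borel" for n using A by (intro bounded_borel_Int) auto
    have "(\<lambda>n. emeasure \<mu> (?S n)) \<longlonglongrightarrow> emeasure \<mu> (\<Inter>n. ?S n)"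
    proof (rule Lim_emeasure_decseq)
      show "range ?S \<subseteq> sets \<mu>" using bb by (auto simp: bounded_borel_def)
      show "decseq ?S"
      proof (rule decseq_SucI)
        fix n
        have "1 / real (Suc (Suc n)) \<le> 1 / real (Suc n)" by (intro frac_le) auto
        then show "?S (Suc n) \<subseteq> ?S n" by (intro Int_mono order_refl subset_ball)
      qed
      show "emeasure \<mu> (?S n) \<noteq> \<infinity>" for n
        using \<mu> bb[of n] by (auto simp: counting_measure_def bdd_finite_measures_def)
    qed
    moreover have "emeasure \<mu> (\<Inter>n. ?S n) = 0"
    proof -
      have sub: "(\<Inter>n. ?S n) \<subseteq> A \<inter> {x}"
      proof
        fix y assume y: "y \<in> (\<Inter>n. ?S n)"
        then have "dist x y < 1 / Suc n" for n by auto
        then have "dist x y \<le> 0" by (metis nat_approx_posE not_less less_asym)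
        then show "y \<in> A \<inter> {x}" using y by auto
      qed
      have "emeasure \<mu> (A \<inter> {x}) = 0"
      proof (cases "x \<in> A")
        case True
        then have "A \<inter> {x} = {x}" by auto
        then show ?thesis using none True by (auto simp: atoms_in_def)
      qed simp
      then show ?thesis using emeasure_mono[OF sub, of \<mu>] by simp
    qed
    ultimately have "\<forall>\<^sub>F n in sequentially. emeasure \<mu> (?S n) < 1"
      by (intro order_tendstoD(2)) auto
    then obtain n where "emeasure \<mu> (?S n) < 1" by (auto simp: eventually_sequentially)
    then have "emeasure \<mu> (?S n) = 0" using counting_ge_1[OF \<mu> bb[of n]] by (metis not_gr_zero not_less)
    then show ?thesis by (intro exI[of _ "1 / Suc n"]) auto
  qed
  then obtain e where e: "\<And>x. e x > 0" "\<And>x. emeasure \<mu> (A \<inter> ball x (e x)) = 0" by metis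
  have "compact (closure A)" using \<open>bounded A\<close> by (simp add: compact_closure)
  then obtain C where C: "C \<subseteq> closure A" "finite C" "closure A \<subseteq> (\<Union>x\<in>C. ball x (e x))"
    by (rule compactE_image[of "closure A" "closure A" "\<lambda>x. ball x (e x)"]) (use e(1) in auto)
  have "emeasure \<mu> A \<le> emeasure \<mu> (\<Union>x\<in>C. A \<inter> ball x (e x))"
  proof (rule emeasure_mono)
    show "A \<subseteq> (\<Union>x\<in>C. A \<inter> ball x (e x))" using C(3) closure_subset[of A] by blast
    show "(\<Union>x\<in>C. A \<inter> ball x (e x)) \<in> sets \<mu>" using C(2) by (intro sets.finite_UN) auto
  qed
  also have "\<dots> \<le> (\<Sum>x\<in>C. emeasure \<mu> (A \<inter> ball x (e x)))"
    using C(2) by (intro emeasure_subadditive_finite) auto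
  also have "\<dots> = 0" using e(2) by simp
  finally show False using pos by simp
qed

text \<open>This is phrased with masses rather than atoms so that it is measurable on the space of all boundedly
  finite measures.\<close>

definition occupied :: "real \<Rightarrow> 'a::euclidean_space set \<Rightarrow> 'a measure \<Rightarrow> 'a set" where
  "occupied h A \<mu> = {p \<in> grid h ` A. emeasure \<mu> (A \<inter> cell h p) > 0}"

lemma occupied_eq_grid_atoms:
  fixes \<mu> :: "'a::euclidean_space measure"
  assumes \<mu>: "counting_measure \<mu>" and A: "A \<in> bounded_borel"
  shows "occupied h A \<mu> = grid h ` atoms_in \<mu> A"
proof (intro equalityI subsetI)
  fix p assume p: "p \<in> occupied h A \<mu>"
  then have "atoms_in \<mu> (A \<inter> cell h p) \<noteq> {}"
    by (intro atoms_nonempty[OF \<mu> bounded_borel_Int[OF A]]) (auto simp: occupied_def)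
  then obtain x where "x \<in> atoms_in \<mu> (A \<inter> cell h p)" by blast
  then have "x \<in> atoms_in \<mu> A" "p = grid h x" by (auto simp: atoms_in_def cell_def)
  then show "p \<in> grid h ` atoms_in \<mu> A" by blast
next
  fix p assume "p \<in> grid h ` atoms_in \<mu> A"
  then obtain x where x: "x \<in> A" "emeasure \<mu> {x} > 0" "p = grid h x" by (auto simp: atoms_in_def)
  have "emeasure \<mu> {x} \<le> emeasure \<mu> (A \<inter> cell h p)"
  proof (rule emeasure_mono)
    show "{x} \<subseteq> A \<inter> cell h p" using x by (simp add: cell_def)
    show "A \<inter> cell h p \<in> sets \<mu>" using A by (auto simp: counting_sets[OF \<mu>] bounded_borel_def intro!: sets.Int)
  qed
  then show "p \<in> occupied h A \<mu>" using x by (auto simp: occupied_def)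
qed

lemma measurable_occupied:
  assumes A: "A \<in> bounded_borel" and h: "h > 0"
  shows "occupied h A \<in> measure_algebra \<rightarrow>\<^sub>M count_space (Pow (grid h ` A))"
proof -
  let ?G = "grid h ` A"
  have fin: "finite ?G" using A h by (intro finite_grid_image) (auto simp: bounded_borel_def)
  show ?thesis
  proof (subst measurable_count_space_eq2)
    show "finite (Pow ?G)" using fin by simp
    have "occupied h A -` {S} \<inter> space measure_algebra \<in> sets measure_algebra" if S: "S \<in> Pow ?G" for S
    proof -
      have [measurable]: "(\<lambda>\<mu>. emeasure \<mu> (A \<inter> cell h p)) \<in> borel_measurable measure_algebra" for p
        by (intro measurable_emeasure_measure_algebra bounded_borel_Int[OF A]) simp
      define G where "G = ?G"
      have "occupied h A \<mu> = S \<longleftrightarrow> (\<forall>p\<in>G. (emeasure \<mu> (A \<inter> cell h p) > 0) = (p \<in> S))" for \<mu>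
        using S unfolding occupied_def G_def[symmetric] by blast
      then have "occupied h A -` {S} \<inter> space measure_algebra =
          {\<mu> \<in> space measure_algebra. \<forall>p\<in>?G. (emeasure \<mu> (A \<inter> cell h p) > 0) = (p \<in> S)}"
        unfolding G_def by auto
      also have "\<dots> \<in> sets measure_algebra"
        using fin by measurable
      finally show ?thesis .
    qed
    then show "occupied h A \<in> space measure_algebra \<rightarrow> Pow ?G \<and>
        (\<forall>S\<in>Pow ?G. occupied h A -` {S} \<inter> space measure_algebra \<in> sets measure_algebra)"
      by (auto simp: occupied_def)
  qed
qed

text \<open>Stationarity speaks about the law on the space of all boundedly finite measures. This is a measurable
  function on that whole space which agrees with \<open>rel_rank\<close> of the atoms on integer-valued measures.\<close>

definition limit_rank :: "'f::field itself \<Rightarrow> nat \<Rightarrow> real \<Rightarrow> real \<Rightarrow> 'a::euclidean_space set \<Rightarrow> 'a measure \<Rightarrow> ennreal" where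
  "limit_rank F l r s A \<mu> = liminf (\<lambda>m. of_nat (rel_rank F l (r + DIM('a) / 2 ^ m) (s + DIM('a) / 2 ^ m) (occupied (1 / 2 ^ m) A \<mu>)))"

lemma measurable_limit_rank:
  fixes F :: "'f::field itself" and A :: "'a::euclidean_space set"
  assumes "A \<in> bounded_borel"
  shows "limit_rank F l r s A \<in> borel_measurable measure_algebra"
  unfolding limit_rank_def
proof (rule borel_measurable_liminf)
  fix m :: nat
  show "(\<lambda>\<mu>. of_nat (rel_rank F l (r + DIM('a) / 2 ^ m) (s + DIM('a) / 2 ^ m) (occupied (1 / 2 ^ m) A \<mu>)) :: ennreal)
    \<in> borel_measurable measure_algebra"
    by (rule measurable_compose[OF measurable_occupied[OF assms]]) auto
qed

lemma limit_rank_eq: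
  fixes \<mu> :: "'a::euclidean_space measure"
  assumes \<mu>: "counting_measure \<mu>" and A: "A \<in> bounded_borel"
  shows "limit_rank F l r s A \<mu> = of_nat (rel_rank F l r s (atoms_in \<mu> A))"
proof -
  have "(\<lambda>m. of_nat (rel_rank F l (r + DIM('a) / 2 ^ m) (s + DIM('a) / 2 ^ m) (occupied (1 / 2 ^ m) A \<mu>)) :: ennreal)
     \<longlonglongrightarrow> of_nat (rel_rank F l r s (atoms_in \<mu> A))"
    using rel_rank_grid_eventually[OF card_atoms_le(1)[OF assms], of F l r s]
    unfolding occupied_eq_grid_atoms[OF assms]
    by (intro tendsto_eventually) (auto elim!: eventually_mono)
  then show ?thesis unfolding limit_rank_def by (intro lim_imp_Liminf) auto
qed

definition shift :: "'a::euclidean_space \<Rightarrow> 'a measure \<Rightarrow> 'a measure" where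
  "shift v \<mu> = distr \<mu> borel (\<lambda>x. x + v)"

lemma emeasure_shift:
  assumes "sets \<mu> = sets borel" "A \<in> sets borel"
  shows "emeasure (shift v \<mu>) ((\<lambda>x. x + v) ` A) = emeasure \<mu> A"
proof -
  have "(\<lambda>x. x + v) \<in> \<mu> \<rightarrow>\<^sub>M borel" using assms(1) by (simp cong: measurable_cong_sets)
  moreover have "(\<lambda>x. x + v) -` (\<lambda>x. x + v) ` A \<inter> space \<mu> = A"
    using sets_eq_imp_space_eq[OF assms(1)] by auto
  ultimately show ?thesis
    unfolding shift_def by (subst emeasure_distr) (auto simp: translate_borel assms)
qed

lemma emeasure_shift':
  assumes "sets \<mu> = sets borel" "A \<in> sets borel"
  shows "emeasure (shift v \<mu>) A = emeasure \<mu> ((\<lambda>x. x + (- v)) ` A)"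
  using emeasure_shift[OF assms(1) translate_borel[OF assms(2)], of v "- v"] by (simp add: image_image)

lemma shift_counting:
  assumes "counting_measure \<mu>"
  shows "counting_measure (shift v \<mu>)"
proof -
  have "emeasure (shift v \<mu>) A = emeasure \<mu> ((\<lambda>x. x + (- v)) ` A)" if "A \<in> bounded_borel" for A
    using that by (intro emeasure_shift' counting_sets[OF assms]) (auto simp: bounded_borel_def)
  moreover have "sets (shift v \<mu>) = sets borel" by (simp add: shift_def)
  ultimately show ?thesis
    using assms translate_bounded_borel[of _ "- v"]
    unfolding counting_measure_def bdd_finite_measures_def by auto
qed

lemma atoms_in_shift:
  assumes "sets \<mu> = sets borel"
  shows "atoms_in (shift v \<mu>) ((\<lambda>x. x + v) ` A) = (\<lambda>x. x + v) ` atoms_in \<mu> A"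
proof -
  have "emeasure (shift v \<mu>) {x + v} = emeasure \<mu> {x}" for x
    using emeasure_shift[OF assms, of "{x}" v] by simp
  then show ?thesis by (auto simp: atoms_in_def)
qed

locale stationary_process =
  fixes M :: "'w measure" and \<xi> :: "'w \<Rightarrow> 'a::euclidean_space measure"
  assumes prob: "prob_space M" and pp: "point_process M \<xi>"
    and mom: "all_moments_finite M \<xi>" and stat: "stationary M \<xi>"
begin

lemma \<xi>_measurable: "\<xi> \<in> M \<rightarrow>\<^sub>M measure_algebra"
  using pp by (simp add: point_process_def)

lemma counting: "\<omega> \<in> space M \<Longrightarrow> counting_measure (\<xi> \<omega>)"
  using pp measurable_space[OF \<xi>_measurable] by (auto simp: point_process_def counting_measure_def space_measure_algebra)

lemma shift_measurable: "(\<lambda>\<omega>. shift v (\<xi> \<omega>)) \<in> M \<rightarrow>\<^sub>M measure_algebra"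
proof (rule measurable_measure_algebraI)
  show "shift v (\<xi> \<omega>) \<in> bdd_finite_measures" if "\<omega> \<in> space M" for \<omega>
    using shift_counting[OF counting[OF that]] by (simp add: counting_measure_def)
  fix A :: "'a set" assume A: "A \<in> bounded_borel"
  have "(\<lambda>\<omega>. emeasure (\<xi> \<omega>) ((\<lambda>x. x + (- v)) ` A)) \<in> borel_measurable M"
    by (rule measurable_compose[OF \<xi>_measurable measurable_emeasure_measure_algebra[OF translate_bounded_borel[OF A]]])
  then show "(\<lambda>\<omega>. emeasure (shift v (\<xi> \<omega>)) A) \<in> borel_measurable M"
    using A by (subst measurable_cong[OF emeasure_shift'[OF counting_sets[OF counting]]]) (auto simp: bounded_borel_def)
qed

lemma nn_integral_shift:
  assumes "G \<in> borel_measurable measure_algebra"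
  shows "(\<integral>\<^sup>+\<omega>. G (shift v (\<xi> \<omega>)) \<partial>M) = (\<integral>\<^sup>+\<omega>. G (\<xi> \<omega>) \<partial>M)"
proof -
  have "distr M measure_algebra (\<lambda>\<omega>. shift v (\<xi> \<omega>)) = distr M measure_algebra \<xi>"
    using stat by (simp add: stationary_def shift_def)
  then have "(\<integral>\<^sup>+\<mu>. G \<mu> \<partial>distr M measure_algebra (\<lambda>\<omega>. shift v (\<xi> \<omega>))) = (\<integral>\<^sup>+\<mu>. G \<mu> \<partial>distr M measure_algebra \<xi>)"
    by simp
  then show ?thesis
    by (simp add: nn_integral_distr[OF shift_measurable] nn_integral_distr[OF \<xi>_measurable] assms)
qed

lemma emeasure_measurable:
  "A \<in> bounded_borel \<Longrightarrow> (\<lambda>\<omega>. emeasure (\<xi> \<omega>) A) \<in> borel_measurable M"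
  by (rule measurable_compose[OF \<xi>_measurable measurable_emeasure_measure_algebra])

lemma moment_shift:
  assumes "A \<in> bounded_borel"
  shows "(\<integral>\<^sup>+\<omega>. emeasure (\<xi> \<omega>) ((\<lambda>x. x + v) ` A) ^ k \<partial>M) = (\<integral>\<^sup>+\<omega>. emeasure (\<xi> \<omega>) A ^ k \<partial>M)"
proof -
  have "(\<integral>\<^sup>+\<omega>. emeasure (\<xi> \<omega>) A ^ k \<partial>M) = (\<integral>\<^sup>+\<omega>. emeasure (shift v (\<xi> \<omega>)) ((\<lambda>x. x + v) ` A) ^ k \<partial>M)"
    using assms by (intro nn_integral_cong) (simp add: emeasure_shift[OF counting_sets[OF counting]] bounded_borel_def)
  also have "\<dots> = (\<integral>\<^sup>+\<omega>. emeasure (\<xi> \<omega>) ((\<lambda>x. x + v) ` A) ^ k \<partial>M)"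
    by (intro nn_integral_shift[of "\<lambda>\<mu>. emeasure \<mu> ((\<lambda>x. x + v) ` A) ^ k"] borel_measurable_power_ennreal
        measurable_emeasure_measure_algebra translate_bounded_borel[OF assms])
  finally show ?thesis ..
qed

lemma rel_rank_measurable_ennreal:
  assumes "A \<in> bounded_borel"
  shows "(\<lambda>\<omega>. of_nat (rel_rank F l r s (atoms_in (\<xi> \<omega>) A)) :: ennreal) \<in> borel_measurable M"
proof -
  have "(\<lambda>\<omega>. limit_rank F l r s A (\<xi> \<omega>)) \<in> borel_measurable M"
    by (rule measurable_compose[OF \<xi>_measurable measurable_limit_rank[OF assms]])
  then show ?thesis
    by (subst (asm) measurable_cong[OF limit_rank_eq[OF counting assms]])
qed

lemma rel_rank_measurable:
  assumes "A \<in> bounded_borel"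
  shows "(\<lambda>\<omega>. rel_rank F l r s (atoms_in (\<xi> \<omega>) A)) \<in> M \<rightarrow>\<^sub>M count_space UNIV"
proof (subst measurable_count_space_eq_countable)
  have "(\<lambda>\<omega>. rel_rank F l r s (atoms_in (\<xi> \<omega>) A)) -` {k} \<inter> space M \<in> sets M" for k
  proof -
    have "(\<lambda>\<omega>. of_nat (rel_rank F l r s (atoms_in (\<xi> \<omega>) A)) :: ennreal) -` {of_nat k} \<inter> space M \<in> sets M"
      by (rule measurable_sets[OF rel_rank_measurable_ennreal[OF assms]]) simp
    also have "(\<lambda>\<omega>. of_nat (rel_rank F l r s (atoms_in (\<xi> \<omega>) A)) :: ennreal) -` {of_nat k}
      = (\<lambda>\<omega>. rel_rank F l r s (atoms_in (\<xi> \<omega>) A)) -` {k}" by auto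
    finally show ?thesis .
  qed
  then show "(\<lambda>\<omega>. rel_rank F l r s (atoms_in (\<xi> \<omega>) A)) \<in> space M \<rightarrow> UNIV \<and>
    (\<forall>k\<in>UNIV. (\<lambda>\<omega>. rel_rank F l r s (atoms_in (\<xi> \<omega>) A)) -` {k} \<inter> space M \<in> sets M)" by auto
qed simp

definition mean_rank :: "'f::field itself \<Rightarrow> nat \<Rightarrow> real \<Rightarrow> real \<Rightarrow> 'a set \<Rightarrow> ennreal" where
  "mean_rank F l r s A = (\<integral>\<^sup>+\<omega>. of_nat (rel_rank F l r s (atoms_in (\<xi> \<omega>) A)) \<partial>M)"

text \<open>Stationarity together with the invariance of \<open>rel_rank\<close> under translations of the point set.\<close>

lemma mean_rank_shift:
  assumes "A \<in> bounded_borel"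
  shows "mean_rank F l r s ((\<lambda>x. x + v) ` A) = mean_rank F l r s A"
proof -
  let ?A = "(\<lambda>x. x + v) ` A"
  note A = translate_bounded_borel[OF assms, of v]
  have "mean_rank F l r s A = (\<integral>\<^sup>+\<omega>. limit_rank F l r s ?A (shift v (\<xi> \<omega>)) \<partial>M)"
    unfolding mean_rank_def
  proof (intro nn_integral_cong)
    fix \<omega> assume \<omega>: "\<omega> \<in> space M"
    show "of_nat (rel_rank F l r s (atoms_in (\<xi> \<omega>) A)) = limit_rank F l r s ?A (shift v (\<xi> \<omega>))"
      using counting[OF \<omega>]
      by (simp add: limit_rank_eq[OF shift_counting A] atoms_in_shift counting_sets
          rel_rank_translate card_atoms_le(1)[OF _ assms])
  qed
  also have "\<dots> = (\<integral>\<^sup>+\<omega>. limit_rank F l r s ?A (\<xi> \<omega>) \<partial>M)"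
    by (rule nn_integral_shift[OF measurable_limit_rank[OF A]])
  also have "\<dots> = mean_rank F l r s ?A"
    unfolding mean_rank_def by (intro nn_integral_cong limit_rank_eq counting A)
  finally show ?thesis ..
qed

lemma mean_rank_cell:
  assumes m: "m > 0" and p: "p \<in> range (grid m)"
  shows "mean_rank F l r s (cell m p) = mean_rank F l r s (cell m 0)"
  unfolding cell_translate[OF m p] by (rule mean_rank_shift[OF cell_bounded_borel[OF m]])

lemma mean_rank_finite:
  assumes "A \<in> bounded_borel"
  shows "mean_rank F l r s A < \<infinity>"
proof -
  have "mean_rank F l r s A \<le> (\<integral>\<^sup>+\<omega>. emeasure (\<xi> \<omega>) A ^ (l + 2) \<partial>M)"
    unfolding mean_rank_def
  proof (rule nn_integral_mono)
    fix \<omega> assume \<omega>: "\<omega> \<in> space M"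
    note c = card_atoms_le[OF counting[OF \<omega>] assms]
    have "(of_nat (rel_rank F l r s (atoms_in (\<xi> \<omega>) A)) :: ennreal) \<le> of_nat (card (atoms_in (\<xi> \<omega>) A) ^ (l + 2))"
      by (intro of_nat_mono rel_rank_le_card c)
    also have "\<dots> \<le> emeasure (\<xi> \<omega>) A ^ (l + 2)"
      unfolding of_nat_power using c(2) by (rule power_mono) simp
    finally show "of_nat (rel_rank F l r s (atoms_in (\<xi> \<omega>) A)) \<le> emeasure (\<xi> \<omega>) A ^ (l + 2)" .
  qed
  also have "\<dots> < \<infinity>" using mom[unfolded all_moments_finite_def, rule_format, of "l + 2" A] assms by (simp del: power_Suc add_2_eq_Suc')
  finally show ?thesis .
qed

text \<open>Superadditivity of \<open>rel_rank\<close> over the cells inside \<open>A\<close>; all of them have the same mean.\<close>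

lemma mean_rank_lower:
  assumes A: "A \<in> bounded_borel" and m: "m > 0"
  shows "of_nat (card {p \<in> grid m ` A. cell m p \<subseteq> A}) * mean_rank F l r s (cell m 0) \<le> mean_rank F l r s A"
proof -
  let ?P = "{p \<in> grid m ` A. cell m p \<subseteq> A}"
  have fin: "finite ?P" using finite_grid_image[of A m] A m by (auto simp: bounded_borel_def)
  have "of_nat (card ?P) * mean_rank F l r s (cell m 0) = (\<Sum>p\<in>?P. mean_rank F l r s (cell m p))"
  proof -
    have "(\<Sum>p\<in>?P. mean_rank F l r s (cell m p)) = (\<Sum>p\<in>?P. mean_rank F l r s (cell m 0))"
      by (intro sum.cong refl mean_rank_cell[OF m]) auto
    then show ?thesis by simp
  qed
  also have "\<dots> = (\<integral>\<^sup>+\<omega>. (\<Sum>p\<in>?P. of_nat (rel_rank F l r s (atoms_in (\<xi> \<omega>) (cell m p)))) \<partial>M)"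
    unfolding mean_rank_def
    by (rule nn_integral_sum[symmetric]) (rule rel_rank_measurable_ennreal[OF cell_bounded_borel[OF m]])
  also have "\<dots> \<le> mean_rank F l r s A"
    unfolding mean_rank_def
  proof (rule nn_integral_mono)
    fix \<omega> assume \<omega>: "\<omega> \<in> space M"
    have "(\<Sum>p\<in>?P. rel_rank F l r s (atoms_in (\<xi> \<omega>) (cell m p))) = (\<Sum>p\<in>?P. rel_rank F l r s (atoms_in (\<xi> \<omega>) A \<inter> cell m p))"
      by (intro sum.cong refl arg_cong[of _ _ "rel_rank F l r s"]) (auto simp: atoms_in_def)
    also have "\<dots> \<le> rel_rank F l r s (atoms_in (\<xi> \<omega>) A)"
      by (rule rel_rank_blocks(1)[OF card_atoms_le(1)[OF counting[OF \<omega>] A] fin disjoint_cells])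
    finally show "(\<Sum>p\<in>?P. of_nat (rel_rank F l r s (atoms_in (\<xi> \<omega>) (cell m p)))) \<le> (of_nat (rel_rank F l r s (atoms_in (\<xi> \<omega>) A)) :: ennreal)"
      unfolding of_nat_sum[symmetric] by (rule of_nat_mono)
  qed
  finally show ?thesis .
qed

text \<open>Subadditivity up to the simplices that leave their cell. Their number is bounded by powers of the
  numbers of atoms in balls of a fixed radius, and the means of these powers do not depend on the
  centres.\<close>

lemma mean_rank_upper:
  fixes r s m :: real
  assumes A: "A \<in> bounded_borel" and m: "m > 0"
  shows "mean_rank F l r s A \<le> of_nat (card (grid m ` A)) * mean_rank F l r s (cell m 0)
     + of_nat (card (straddling m s A)) * (\<integral>\<^sup>+\<omega>. emeasure (\<xi> \<omega>) (cball 0 (DIM('a) + 2 * s)) ^ (l + 2) \<partial>M)"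
proof -
  let ?\<rho> = "DIM('a) + 2 * s"
  have bA: "bounded A" using A by (simp add: bounded_borel_def)
  note [measurable] = rel_rank_measurable_ennreal[OF cell_bounded_borel[OF m]]
    emeasure_measurable[OF cball_bounded_borel]
  have "mean_rank F l r s A \<le> (\<integral>\<^sup>+\<omega>. (\<Sum>p\<in>grid m ` A. of_nat (rel_rank F l r s (atoms_in (\<xi> \<omega>) (cell m p))))
      + (\<Sum>c\<in>straddling m s A. emeasure (\<xi> \<omega>) (cball c ?\<rho>) ^ (l + 2)) \<partial>M)"
    unfolding mean_rank_def
  proof (rule nn_integral_mono)
    fix \<omega> assume \<omega>: "\<omega> \<in> space M"
    let ?X = "atoms_in (\<xi> \<omega>) A"
    have sub: "?X \<inter> B \<subseteq> atoms_in (\<xi> \<omega>) B" for B by (auto simp: atoms_in_def)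
    note c = card_atoms_le[OF counting[OF \<omega>]]
    have "rel_rank F l r s ?X \<le> (\<Sum>p\<in>grid m ` A. rel_rank F l r s (?X \<inter> cell m p))
     + (\<Sum>c\<in>straddling m s A. card (?X \<inter> cball c ?\<rho>) ^ (l + 2))"
      by (rule rel_rank_tiles[OF c(1)[OF A] _ bA m]) (auto simp: atoms_in_def)
    also have "\<dots> \<le> (\<Sum>p\<in>grid m ` A. rel_rank F l r s (atoms_in (\<xi> \<omega>) (cell m p)))
     + (\<Sum>c\<in>straddling m s A. card (atoms_in (\<xi> \<omega>) (cball c ?\<rho>)) ^ (l + 2))"
      by (intro add_mono sum_mono rel_rank_mono power_mono card_mono c sub cell_bounded_borel[OF m] cball_bounded_borel) auto
    finally have "(of_nat (rel_rank F l r s ?X) :: ennreal) \<le> (\<Sum>p\<in>grid m ` A. of_nat (rel_rank F l r s (atoms_in (\<xi> \<omega>) (cell m p))))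
     + (\<Sum>c\<in>straddling m s A. of_nat (card (atoms_in (\<xi> \<omega>) (cball c ?\<rho>))) ^ (l + 2))"
      unfolding of_nat_sum[symmetric] of_nat_power[symmetric] of_nat_add[symmetric] by (rule of_nat_mono)
    also have "\<dots> \<le> (\<Sum>p\<in>grid m ` A. of_nat (rel_rank F l r s (atoms_in (\<xi> \<omega>) (cell m p))))
      + (\<Sum>c\<in>straddling m s A. emeasure (\<xi> \<omega>) (cball c ?\<rho>) ^ (l + 2))"
      by (intro add_mono order_refl sum_mono power_mono c cball_bounded_borel) simp
    finally show "of_nat (rel_rank F l r s ?X) \<le> \<dots>" .
  qed
  also have "\<dots> = (\<Sum>p\<in>grid m ` A. mean_rank F l r s (cell m p))
      + (\<Sum>c\<in>straddling m s A. \<integral>\<^sup>+\<omega>. emeasure (\<xi> \<omega>) (cball c ?\<rho>) ^ (l + 2) \<partial>M)"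
    unfolding mean_rank_def by (simp add: nn_integral_add nn_integral_sum)
  also have "(\<Sum>p\<in>grid m ` A. mean_rank F l r s (cell m p)) = of_nat (card (grid m ` A)) * mean_rank F l r s (cell m 0)"
  proof -
    have "(\<Sum>p\<in>grid m ` A. mean_rank F l r s (cell m p)) = (\<Sum>p\<in>grid m ` A. mean_rank F l r s (cell m 0))"
      by (intro sum.cong refl mean_rank_cell[OF m]) auto
    then show ?thesis by simp
  qed
  also have "(\<Sum>c\<in>straddling m s A. \<integral>\<^sup>+\<omega>. emeasure (\<xi> \<omega>) (cball c ?\<rho>) ^ (l + 2) \<partial>M) =
      of_nat (card (straddling m s A)) * (\<integral>\<^sup>+\<omega>. emeasure (\<xi> \<omega>) (cball 0 ?\<rho>) ^ (l + 2) \<partial>M)"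
  proof -
    have "(\<integral>\<^sup>+\<omega>. emeasure (\<xi> \<omega>) (cball c ?\<rho>) ^ (l + 2) \<partial>M) = (\<integral>\<^sup>+\<omega>. emeasure (\<xi> \<omega>) (cball 0 ?\<rho>) ^ (l + 2) \<partial>M)" for c
    proof -
      have "cball c ?\<rho> = (\<lambda>x. x + c) ` cball 0 ?\<rho>"
        using cball_translation[of c 0 ?\<rho>] by (simp add: add.commute)
      then show ?thesis using moment_shift[OF cball_bounded_borel] by metis
    qed
    from sum.cong[OF refl this] show ?thesis unfolding sum_constant .
  qed
  finally show ?thesis .
qed

end

section \<open>Averages along convex sequences\<close>

lemma emeasure_cell:
  fixes p :: "'a::euclidean_space" and m :: real
  assumes m: "m > 0" and p: "p \<in> range (grid m)"
  shows "emeasure lborel (cell m p) = ennreal (m ^ DIM('a))"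
proof (rule antisym)
  have vol: "(\<Prod>b\<in>Basis. ((p + m *\<^sub>R One) - p) \<bullet> b) = m ^ DIM('a)"
    by (simp add: inner_sum_left_Basis)
  have "cell m p \<subseteq> cbox p (p + m *\<^sub>R One)"
  proof
    fix x assume "x \<in> cell m p"
    then have "p = grid m x" by (simp add: cell_def)
    then show "x \<in> cbox p (p + m *\<^sub>R One)"
      using grid_bounds[OF m, of _ x] by (auto simp: mem_box inner_add_left less_imp_le)
  qed
  then have "emeasure lborel (cell m p) \<le> emeasure lborel (cbox p (p + m *\<^sub>R One))"
    by (intro emeasure_mono) auto
  also have "\<dots> = ennreal (m ^ DIM('a))"
    using m vol by (subst emeasure_lborel_cbox) (auto simp: inner_add_left)
  finally show "emeasure lborel (cell m p) \<le> ennreal (m ^ DIM('a))" .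
  have "box p (p + m *\<^sub>R One) \<subseteq> cell m p"
  proof
    fix x assume x: "x \<in> box p (p + m *\<^sub>R One)"
    obtain y where y: "p = grid m y" using p by auto
    have "grid m x = grid m y"
      using x by (intro grid_eqI[OF m]) (auto simp: mem_box y inner_add_left)
    then show "x \<in> cell m p" by (simp add: cell_def y)
  qed
  then have "emeasure lborel (box p (p + m *\<^sub>R One)) \<le> emeasure lborel (cell m p)"
    by (intro emeasure_mono) auto
  then show "ennreal (m ^ DIM('a)) \<le> emeasure lborel (cell m p)"
    using m vol by (subst (asm) emeasure_lborel_box) (auto simp: inner_add_left)
qed

lemma emeasure_UN_cells:
  fixes S :: "'a::euclidean_space set" and m :: real
  assumes m: "m > 0" and S: "finite S" "S \<subseteq> range (grid m)"
  shows "emeasure lborel (\<Union>p\<in>S. cell m p) = ennreal (card S * m ^ DIM('a))"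
proof -
  have "emeasure lborel (\<Union>p\<in>S. cell m p) = (\<Sum>p\<in>S. emeasure lborel (cell m p))"
    using S(1) disjoint_cells by (intro sum_emeasure[symmetric]) auto
  also have "\<dots> = (\<Sum>p\<in>S. ennreal (m ^ DIM('a)))"
    using S(2) m by (intro sum.cong emeasure_cell) auto
  also have "\<dots> = ennreal (card S * m ^ DIM('a))"
    using m by (simp add: ennreal_mult ennreal_of_nat_eq_real_of_nat)
  finally show ?thesis .
qed

lemma dist_same_cell:
  fixes x y :: "'a::euclidean_space" and m :: real
  assumes "m > 0" "grid m x = grid m y"
  shows "dist x y \<le> 2 * m * DIM('a)"
  using dist_grid[OF assms(1), of x] dist_grid[OF assms(1), of y] dist_triangle2[of x y "grid m x"]
  by (simp add: assms(2))

lemma convex_inball_combination: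
  assumes A: "convex A" "cball x r \<subseteq> A" and r: "r > 0" and a: "a \<in> A" and v: "norm v \<le> r" and u: "0 \<le> u" "u \<le> 1"
  shows "(1 - u) *\<^sub>R a + u *\<^sub>R (x + v) \<in> A"
  using A a v u by (intro convexD) (auto simp: subset_iff dist_norm)

text \<open>A point at distance at most \<open>t * r\<close> from a convex set \<open>A\<close> that contains the ball of radius \<open>r\<close> about \<open>x\<close> lies in
  the image of \<open>A\<close> under the homothety with centre \<open>x\<close> and ratio \<open>1 + t\<close>. The union of the cells that meet
  \<open>A\<close> is contained in such an image.\<close>

lemma card_cells_meeting_le:
  fixes A :: "'a::euclidean_space set" and m r :: real
  assumes A: "A \<in> bounded_borel" "convex A" "cball x r \<subseteq> A" and r: "r > 0" and m: "m > 0"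
  shows "card (grid m ` A) * m ^ DIM('a) \<le> (1 + 2 * m * DIM('a) / r) ^ DIM('a) * measure lborel A"
proof -
  define t where "t = 2 * m * DIM('a) / r"
  have t: "t > 0" using r m by (simp add: t_def)
  have bA: "bounded A" "A \<in> sets borel" using A(1) by (auto simp: bounded_borel_def)
  have fin: "finite (grid m ` A)" using finite_grid_image[OF bA(1) m] .
  let ?T = "\<lambda>a. (1 + t) *\<^sub>R a + (- t) *\<^sub>R x"
  have sub: "(\<Union>p\<in>grid m ` A. cell m p) \<subseteq> ?T ` A"
  proof
    fix y assume "y \<in> (\<Union>p\<in>grid m ` A. cell m p)"
    then obtain a where a: "a \<in> A" "grid m y = grid m a" by (auto simp: cell_def)
    have d: "norm (y - a) \<le> t * r" using dist_same_cell[OF m a(2)] r by (simp add: t_def dist_norm)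
    define v where "v = (1 / t) *\<^sub>R (y - a)"
    have v: "norm v \<le> r" using d t by (simp add: v_def pos_divide_le_eq mult.commute)
    have ya: "y = a + t *\<^sub>R v" using t by (simp add: v_def)
    define u where "u = t / (1 + t)"
    have u: "0 \<le> u" "u \<le> 1" "(1 + t) * (1 - u) = 1" "(1 + t) * u = t"
      using t by (auto simp: u_def field_simps)
    have "y = ?T ((1 - u) *\<^sub>R a + u *\<^sub>R (x + v))"
      unfolding scaleR_add_right scaleR_scaleR u ya by simp
    then show "y \<in> ?T ` A" using convex_inball_combination[OF A(2,3) r a(1) v u(1,2)] by blast
  qed
  have "ennreal (card (grid m ` A) * m ^ DIM('a)) = emeasure lborel (\<Union>p\<in>grid m ` A. cell m p)"
    by (rule emeasure_UN_cells[OF m fin, symmetric]) auto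
  also have "\<dots> = emeasure lebesgue (\<Union>p\<in>grid m ` A. cell m p)"
    using sets.finite_UN[OF fin, of "cell m" lborel] by (simp del: UN_simps)
  also have "\<dots> \<le> emeasure lebesgue (?T ` A)"
  proof (rule emeasure_mono[OF sub])
    have "A \<in> sets lebesgue" using bA(2) by simp
    have "?T ` A = (\<lambda>y. (1 / (1 + t)) *\<^sub>R (y + t *\<^sub>R x)) -` A \<inter> space borel"
    proof (intro equalityI subsetI)
      fix y assume "y \<in> (\<lambda>y. (1 / (1 + t)) *\<^sub>R (y + t *\<^sub>R x)) -` A \<inter> space borel"
      then have "(1 / (1 + t)) *\<^sub>R (y + t *\<^sub>R x) \<in> A" by simp
      moreover have "y = ?T ((1 / (1 + t)) *\<^sub>R (y + t *\<^sub>R x))" using t by simp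
      ultimately show "y \<in> ?T ` A" by blast
    qed (use t in auto)
    also have "\<dots> \<in> sets borel" by (rule measurable_sets[OF _ bA(2)]) measurable
    finally show "?T ` A \<in> sets lebesgue" by simp
  qed
  also have "\<dots> = ennreal ((1 + t) ^ DIM('a)) * emeasure lebesgue A"
    using emeasure_lebesgue_affine[of "1 + t" "(- t) *\<^sub>R x" A] t by simp
  also have "\<dots> = ennreal ((1 + t) ^ DIM('a) * measure lborel A)"
    using bA t emeasure_bounded_finite[OF bA(1)] by (simp add: emeasure_eq_ennreal_measure ennreal_mult)
  finally show ?thesis
    using t by (subst (asm) ennreal_le_iff) (auto simp: t_def)
qed

text \<open>Dually, every point of the image of \<open>A\<close> under the homothety with ratio \<open>1 - t\<close> has its ball of radius
  \<open>t * r\<close> inside \<open>A\<close>, so the cells inside \<open>A\<close> cover this image.\<close>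

lemma card_cells_inside_ge:
  fixes A :: "'a::euclidean_space set" and m r :: real
  assumes A: "A \<in> bounded_borel" "convex A" "cball x r \<subseteq> A" and r: "r > 0" and m: "m > 0" "2 * m * DIM('a) < r"
  shows "(1 - 2 * m * DIM('a) / r) ^ DIM('a) * measure lborel A \<le> card {p \<in> grid m ` A. cell m p \<subseteq> A} * m ^ DIM('a)"
proof -
  define t where "t = 2 * m * DIM('a) / r"
  have t: "t > 0" "t < 1" using r m by (simp_all add: t_def)
  have bA: "bounded A" "A \<in> sets borel" using A(1) by (auto simp: bounded_borel_def)
  let ?P = "{p \<in> grid m ` A. cell m p \<subseteq> A}"
  have fin: "finite ?P" using finite_grid_image[OF bA(1) m(1)] by simp
  let ?T = "\<lambda>a. (1 - t) *\<^sub>R a + t *\<^sub>R x"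
  have sub: "?T ` A \<subseteq> (\<Union>p\<in>?P. cell m p)"
  proof
    fix y assume "y \<in> ?T ` A"
    then obtain a where a: "a \<in> A" "y = ?T a" by auto
    have near: "z \<in> A" if "dist y z \<le> t * r" for z
    proof -
      define v where "v = (1 / t) *\<^sub>R (z - y)"
      have "norm v \<le> r" using that t by (simp add: v_def pos_divide_le_eq mult.commute dist_norm norm_minus_commute)
      moreover have "z = (1 - t) *\<^sub>R a + t *\<^sub>R (x + v)"
        using t by (simp add: v_def a(2) scaleR_add_right)
      ultimately show ?thesis using convex_inball_combination[OF A(2,3) r a(1)] t by simp
    qed
    have "y \<in> A" using near[of y] t r by simp
    moreover have "cell m (grid m y) \<subseteq> A"
    proof
      fix z assume "z \<in> cell m (grid m y)"
      then have "dist y z \<le> 2 * m * DIM('a)" by (intro dist_same_cell[OF m(1)]) (simp add: cell_def)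
      then show "z \<in> A" using r by (intro near) (simp add: t_def)
    qed
    ultimately show "y \<in> (\<Union>p\<in>?P. cell m p)" by (auto simp: cell_def)
  qed
  have "ennreal ((1 - t) ^ DIM('a) * measure lborel A) = ennreal ((1 - t) ^ DIM('a)) * emeasure lebesgue A"
    using bA t emeasure_bounded_finite[OF bA(1)] by (simp add: emeasure_eq_ennreal_measure ennreal_mult)
  also have "\<dots> = emeasure lebesgue (?T ` A)"
    using emeasure_lebesgue_affine[of "1 - t" "t *\<^sub>R x" A] t by simp
  also have "\<dots> \<le> emeasure lebesgue (\<Union>p\<in>?P. cell m p)"
    using sets.finite_UN[OF fin, of "cell m" lborel] by (intro emeasure_mono[OF sub]) simp
  also have "\<dots> = emeasure lborel (\<Union>p\<in>?P. cell m p)"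
    using sets.finite_UN[OF fin, of "cell m" lborel] by simp
  also have "\<dots> = ennreal (card ?P * m ^ DIM('a))"
    using fin by (intro emeasure_UN_cells[OF m(1)]) auto
  finally show ?thesis
    using m by (subst (asm) ennreal_le_iff) (auto simp: t_def)
qed

text \<open>For each cell of side \<open>m\<close> the relevant unit cells lie in the shell between a slightly larger and a
  slightly smaller cube. The volume of the shell is of order \<open>m ^ (n - 1)\<close>, one order below the volume of
  the cell.\<close>

lemma card_straddling_le:
  fixes A :: "'a::euclidean_space set" and n s m H :: real
  defines "n \<equiv> real DIM('a)"
  assumes A: "bounded A" and m: "m > 0"
    and H: "H = 2 * n + 2 * \<bar>s\<bar> + 1" "2 * H \<le> m"
  shows "card (straddling m s A) \<le> card (grid m ` A) * ((m + 4 * n) ^ DIM('a) - (m - 2 * H) ^ DIM('a))"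
proof -
  let ?L = "{x \<in> A. \<exists>y. dist x y \<le> 2 * s \<and> grid m y \<noteq> grid m x}"
  let ?S = "\<lambda>p. grid 1 ` {x \<in> ?L. grid m x = p}"
  have n: "n > 0" by (simp add: n_def)
  have Hpos: "H > 0" using H(1) n by linarith
  have finA: "finite (grid m ` A)" using finite_grid_image[OF A m] .
  have "card (straddling m s A) \<le> card (\<Union>p\<in>grid m ` A. ?S p)"
    using finA A m by (intro card_mono finite_UN_I finite_grid_image bounded_subset[OF A]) (auto simp: straddling_def)
  also have "\<dots> \<le> (\<Sum>p\<in>grid m ` A. card (?S p))" by (rule card_UN_le[OF finA])
  finally have 1: "card (straddling m s A) \<le> (\<Sum>p\<in>grid m ` A. card (?S p))" .
  have 2: "real (card (?S p)) \<le> (m + 4 * n) ^ DIM('a) - (m - 2 * H) ^ DIM('a)" if p: "p \<in> grid m ` A" for p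
  proof -
    have fin: "finite (?S p)" by (intro finite_grid_image bounded_subset[OF A]) auto
    let ?O = "cbox (p - (2 * n) *\<^sub>R One) (p + (m + 2 * n) *\<^sub>R One)"
    let ?I = "cbox (p + H *\<^sub>R One) (p + (m - H) *\<^sub>R One)"
    have coord: "\<bar>x \<bullet> i - y \<bullet> i\<bar> \<le> dist x y" if "i \<in> Basis" for x y i :: 'a
      using Basis_le_norm[OF that, of "x - y"] by (simp add: dist_norm inner_diff_left)
    have sub: "(\<Union>c\<in>?S p. cell 1 c) \<subseteq> ?O - ?I"
    proof
      fix z assume "z \<in> (\<Union>c\<in>?S p. cell 1 c)"
      then obtain x y where x: "grid 1 z = grid 1 x" "grid m x = p" and y: "dist x y \<le> 2 * s" "grid m y \<noteq> p"
        by (auto simp: cell_def)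
      \<comment> \<open>Within its unit cell \<open>z\<close> is at distance at most \<open>2 * n\<close> from \<open>x\<close>, and \<open>x\<close> is at distance at most \<open>2 * s\<close> from \<open>y\<close>, which is in another cell; so the depth of \<open>z\<close> in the cube of \<open>x\<close> is less than \<open>H\<close>.\<close>
      have zx: "\<bar>z \<bullet> i - x \<bullet> i\<bar> \<le> 2 * n" if "i \<in> Basis" for i
        using coord[OF that, of z x] dist_same_cell[OF _ x(1)] by (simp add: n_def)
      have xp: "p \<bullet> i \<le> x \<bullet> i" "x \<bullet> i < p \<bullet> i + m" if "i \<in> Basis" for i
        using grid_bounds[OF m that, of x] x(2) by auto
      have "z \<in> ?O" unfolding mem_box
      proof
        fix i :: 'a assume i: "i \<in> Basis"
        show "(p - (2 * n) *\<^sub>R One) \<bullet> i \<le> z \<bullet> i \<and> z \<bullet> i \<le> (p + (m + 2 * n) *\<^sub>R One) \<bullet> i"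
          using zx[OF i] xp[OF i] i by (auto simp: inner_diff_left inner_add_left abs_le_iff)
      qed
      moreover have "z \<notin> ?I"
      proof
        assume zI: "z \<in> ?I"
        have "grid m y = grid m x"
        proof (rule grid_eqI[OF m])
          fix i :: 'a assume i: "i \<in> Basis"
          have "p \<bullet> i + H \<le> z \<bullet> i" "z \<bullet> i \<le> p \<bullet> i + (m - H)"
            using zI i by (auto simp: mem_box inner_add_left)
          moreover have "\<bar>x \<bullet> i - y \<bullet> i\<bar> \<le> 2 * s" using coord[OF i, of x y] y(1) by simp
          ultimately show "grid m x \<bullet> i \<le> y \<bullet> i \<and> y \<bullet> i < grid m x \<bullet> i + m"
            using zx[OF i] H(1) unfolding x(2) by linarith
        qed
        then show False using x(2) y(2) by simp
      qed
      ultimately show "z \<in> ?O - ?I" by blast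
    qed
    have "ennreal (card (?S p)) = emeasure lborel (\<Union>c\<in>?S p. cell 1 c)"
      by (subst emeasure_UN_cells[OF zero_less_one fin]) auto
    also have "\<dots> \<le> emeasure lborel (?O - ?I)" by (intro emeasure_mono sub) auto
    also have "\<dots> = emeasure lborel ?O - emeasure lborel ?I"
    proof (rule emeasure_Diff)
      show "?I \<subseteq> ?O"
      proof
        fix x assume x: "x \<in> ?I"
        show "x \<in> ?O" unfolding mem_box
        proof
          fix i :: 'a assume i: "i \<in> Basis"
          have "p \<bullet> i + H \<le> x \<bullet> i" "x \<bullet> i \<le> p \<bullet> i + (m - H)"
            using x i by (auto simp: mem_box inner_add_left)
          then show "(p - (2 * n) *\<^sub>R One) \<bullet> i \<le> x \<bullet> i \<and> x \<bullet> i \<le> (p + (m + 2 * n) *\<^sub>R One) \<bullet> i"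
            using n Hpos i by (simp add: inner_diff_left inner_add_left)
        qed
      qed
    qed (auto simp: emeasure_lborel_cbox_eq)
    also have "emeasure lborel ?O = ennreal ((m + 4 * n) ^ DIM('a))"
      using m n by (subst emeasure_lborel_cbox) (auto simp: inner_diff_left inner_add_left add.commute)
    also have "emeasure lborel ?I = ennreal ((m - 2 * H) ^ DIM('a))"
      using H(2) by (subst emeasure_lborel_cbox) (auto simp: inner_diff_left inner_add_left)
    also have "ennreal ((m + 4 * n) ^ DIM('a)) - ennreal ((m - 2 * H) ^ DIM('a)) = ennreal ((m + 4 * n) ^ DIM('a) - (m - 2 * H) ^ DIM('a))"
      using H(2) by (intro ennreal_minus) simp
    finally have le: "ennreal (card (?S p)) \<le> ennreal ((m + 4 * n) ^ DIM('a) - (m - 2 * H) ^ DIM('a))" .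
    have "(m - 2 * H) ^ DIM('a) \<le> (m + 4 * n) ^ DIM('a)"
      using n Hpos H(2) by (intro power_mono) linarith+
    then show ?thesis using le by (subst (asm) ennreal_le_iff) linarith+
  qed
  have "real (card (straddling m s A)) \<le> (\<Sum>p\<in>grid m ` A. real (card (?S p)))"
    using of_nat_mono[OF 1, where 'a=real] unfolding of_nat_sum .
  also have "\<dots> \<le> (\<Sum>p\<in>grid m ` A. (m + 4 * n) ^ DIM('a) - (m - 2 * H) ^ DIM('a))"
    by (rule sum_mono[OF 2])
  finally show ?thesis by simp
qed

lemma averaging_sequence_inball:
  assumes "convex_averaging_sequence A"
  shows "\<forall>\<^sub>F k in sequentially. \<exists>x r. r > R \<and> r > 0 \<and> cball x r \<subseteq> A k"
proof -
  have "\<forall>\<^sub>F k in sequentially. ereal R < (SUP r\<in>{r. 0 < r \<and> (\<exists>x. cball x r \<subseteq> A k)}. ereal r)"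
    using assms unfolding convex_averaging_sequence_def tendsto_PInfty by blast
  then show ?thesis by eventually_elim (auto simp: less_SUP_iff)
qed


lemma averaging_sequence_volume_pos:
  assumes A: "convex_averaging_sequence A"
  shows "\<forall>\<^sub>F k in sequentially. measure lborel (A k) > 0"
  using averaging_sequence_inball[OF A, of 0]
proof eventually_elim
  case (elim k)
  then obtain c r where r: "r > 0" "cball c r \<subseteq> A k" by blast
  have "A k \<in> bounded_borel" using A by (simp add: convex_averaging_sequence_def)
  have "0 < measure lborel (ball c r)" using r(1) by (rule content_ball_pos)
  also have "\<dots> \<le> measure lborel (A k)"
    using r(2) \<open>A k \<in> bounded_borel\<close> emeasure_bounded_finite[of "A k"]
    by (intro measure_mono_fmeasurable) (auto simp: bounded_borel_def fmeasurable_def subset_iff)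
  finally show ?case .
qed

lemma convergent_if_eventually_near:
  fixes x :: "nat \<Rightarrow> real"
  assumes "\<And>\<epsilon>. \<epsilon> > 0 \<Longrightarrow> \<exists>c. \<forall>\<^sub>F k in sequentially. \<bar>x k - c\<bar> \<le> \<epsilon>"
  shows "convergent x"
proof (rule real_Cauchy_convergent, rule metric_CauchyI)
  fix e :: real assume "e > 0"
  then obtain c where "\<forall>\<^sub>F k in sequentially. \<bar>x k - c\<bar> \<le> e / 3" using assms[of "e / 3"] by auto
  then obtain N where "\<And>k. k \<ge> N \<Longrightarrow> \<bar>x k - c\<bar> \<le> e / 3" by (auto simp: eventually_sequentially)
  then have N: "\<bar>x k - c\<bar> < e / 2" if "k \<ge> N" for k using \<open>e > 0\<close> that by fastforce
  have "dist (x m) (x n) < e" if "m \<ge> N" "n \<ge> N" for m n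
    using N[OF that(1)] N[OF that(2)] unfolding dist_real_def by linarith
  then show "\<exists>M. \<forall>m\<ge>M. \<forall>n\<ge>M. dist (x m) (x n) < e" by blast
qed

text \<open>Let \<open>c\<close> be the mean per unit volume in one cell of side \<open>m\<close>, and \<open>d\<close> a bound, again per unit volume, for the
  simplices that leave the cell, which tends to \<open>0\<close> for large \<open>m\<close>. If \<open>A k\<close> contains a ball that is large compared with \<open>m\<close>, the
  density for \<open>A k\<close> is between \<open>(1 - t) ^ n * c\<close> and \<open>(1 + t) ^ n * (c + d)\<close> with a small \<open>t\<close>.\<close>

lemma (in stationary_process) mean_rank_density_converges:
  fixes F :: "'f::field itself" and A :: "nat \<Rightarrow> 'a set"
  assumes A: "convex_averaging_sequence A"
  shows "convergent (\<lambda>k. enn2real (mean_rank F l r s (A k)) / measure lborel (A k))"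
proof (rule convergent_if_eventually_near)
  fix \<epsilon> :: real assume \<epsilon>: "\<epsilon> > 0"
  define n where "n = real DIM('a)"
  let ?N = "DIM('a)"
  define H where "H = 2 * n + 2 * \<bar>s\<bar> + 1"
  define \<kappa>' where "\<kappa>' = (\<integral>\<^sup>+\<omega>. emeasure (\<xi> \<omega>) (cball 0 (DIM('a) + 2 * s)) ^ (l + 2) \<partial>M)"
  define \<kappa> where "\<kappa> = enn2real \<kappa>'"
  have \<kappa>': "\<kappa>' = ennreal \<kappa>" "\<kappa> \<ge> 0"
  proof -
    have "\<kappa>' < \<infinity>"
      using mom[unfolded all_moments_finite_def, rule_format, of "l + 2" "cball 0 (DIM('a) + 2 * s)"]
      unfolding \<kappa>'_def by (simp add: cball_bounded_borel del: power_Suc add_2_eq_Suc')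
    then show "\<kappa>' = ennreal \<kappa>" "\<kappa> \<ge> 0" by (simp_all add: \<kappa>_def)
  qed
  have bb: "A k \<in> bounded_borel" "convex (A k)" for k
    using A by (auto simp: convex_averaging_sequence_def)
  define X where "X k = enn2real (mean_rank F l r s (A k))" for k
  define V where "V k = measure lborel (A k)" for k
  define a where "a m = enn2real (mean_rank F l r s (cell m 0))" for m
  have X: "mean_rank F l r s (A k) = ennreal (X k)" "X k \<ge> 0" for k
    using mean_rank_finite[OF bb(1)[of k], of F l r s] by (simp_all add: X_def)
  have a: "mean_rank F l r s (cell m 0) = ennreal (a m)" "a m \<ge> 0" if "m > 0" for m
    using mean_rank_finite[OF cell_bounded_borel[OF that], of F l r s] by (simp_all add: a_def)
  define e where "e m = \<kappa> * ((m + 4 * n) ^ ?N - (m - 2 * H) ^ ?N)" for m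
  have e_lim: "((\<lambda>m. e m / m ^ ?N) \<longlongrightarrow> 0) at_top"
  proof -
    have "((\<lambda>m. \<kappa> * ((1 + 4 * n / m) ^ ?N - (1 - 2 * H / m) ^ ?N)) \<longlongrightarrow> \<kappa> * ((1 + 0) ^ ?N - (1 - 0) ^ ?N)) at_top"
      by (intro tendsto_intros tendsto_divide_0[OF tendsto_const] filterlim_at_top_imp_at_infinity filterlim_ident)
    moreover have "\<forall>\<^sub>F m in at_top. \<kappa> * ((1 + 4 * n / m) ^ ?N - (1 - 2 * H / m) ^ ?N) = e m / m ^ ?N"
      using eventually_gt_at_top[of "0::real"]
    proof eventually_elim
      case (elim m)
      then have eq: "1 + 4 * n / m = (m + 4 * n) / m" "1 - 2 * H / m = (m - 2 * H) / m" by (simp_all add: field_simps)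
      show ?case unfolding eq power_divide e_def diff_divide_distrib[symmetric] by simp
    qed
    ultimately show ?thesis using tendsto_cong[THEN iffD1] by fastforce
  qed
  have "\<forall>\<^sub>F m in at_top. m > 0 \<and> 2 * H \<le> m \<and> e m / m ^ ?N < \<epsilon> / 2"
    using order_tendstoD(2)[OF e_lim, of "\<epsilon> / 2"] \<epsilon> eventually_gt_at_top[of "0::real"] eventually_ge_at_top[of "2 * H"]
    by (intro eventually_conj) auto
  \<comment> \<open>The side \<open>m\<close> is fixed before \<open>k\<close>: first the surface term is made small, then \<open>A k\<close> is taken large.\<close>
  then obtain m where m: "m > 0" "2 * H \<le> m" "e m / m ^ ?N < \<epsilon> / 2"
    using eventually_happens' trivial_limit_at_top_linorder by blast
  define c where "c = a m / m ^ ?N"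
  define d where "d = e m / m ^ ?N"
  have "((\<lambda>t. (1 - t) ^ ?N * c) \<longlongrightarrow> (1 - 0) ^ ?N * c) (at_right 0)"
    by (intro tendsto_intros)
  then have ev1: "\<forall>\<^sub>F t in at_right 0. (1 - t) ^ ?N * c > c - \<epsilon>"
    using \<epsilon> by (intro order_tendstoD(1)) auto
  have "((\<lambda>t. (1 + t) ^ ?N * (c + d)) \<longlongrightarrow> (1 + 0) ^ ?N * (c + d)) (at_right 0)"
    by (intro tendsto_intros)
  then have ev2: "\<forall>\<^sub>F t in at_right 0. (1 + t) ^ ?N * (c + d) < c + \<epsilon>"
  proof (rule order_tendstoD(2))
    have "d < \<epsilon>" using \<epsilon> m(3) unfolding d_def by linarith
    then show "(1 + 0) ^ ?N * (c + d) < c + \<epsilon>" by simp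
  qed
  have "\<forall>\<^sub>F t in at_right (0::real). 0 < t \<and> t < 1" unfolding eventually_at_right_field by (intro exI[of _ 1]) auto
  then have "\<forall>\<^sub>F t in at_right 0. (0 < t \<and> t < 1) \<and> (1 - t) ^ ?N * c > c - \<epsilon> \<and> (1 + t) ^ ?N * (c + d) < c + \<epsilon>"
    using ev1 ev2 by eventually_elim simp
  then obtain t where t: "0 < t" "t < 1" "(1 - t) ^ ?N * c > c - \<epsilon>" "(1 + t) ^ ?N * (c + d) < c + \<epsilon>"
    using eventually_happens' trivial_limit_at_right_real by blast
  have "\<forall>\<^sub>F k in sequentially. \<bar>X k / V k - c\<bar> \<le> \<epsilon>"
    using averaging_sequence_volume_pos[OF A] averaging_sequence_inball[OF A, of "2 * m * n / t"]
  proof eventually_elim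
    case (elim k)
    from elim(2) obtain x \<rho> where \<rho>: "\<rho> > 2 * m * n / t" "\<rho> > 0" "cball x \<rho> \<subseteq> A k" by blast
    define u where "u = 2 * m * DIM('a) / \<rho>"
    have u: "0 \<le> u" "u \<le> t" using \<rho> t m by (auto simp: u_def n_def field_simps)
    have "u < 1" using u(2) t(2) by linarith
    then have small: "2 * m * DIM('a) < \<rho>" unfolding u_def pos_divide_less_eq[OF \<rho>(2)] by simp
    have V: "V k > 0" using elim(1) by (simp add: V_def)
    let ?G = "card (grid m ` A k)" and ?P = "card {p \<in> grid m ` A k. cell m p \<subseteq> A k}"
    have "ennreal (?P * a m) \<le> ennreal (X k)"
      using mean_rank_lower[OF bb(1)[of k] m(1), of F l r s] unfolding X a[OF m(1)]
      by (simp add: ennreal_mult ennreal_of_nat_eq_real_of_nat a[OF m(1)])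
    then have low: "?P * a m \<le> X k" using X(2) by (simp add: ennreal_le_iff)
    have "(1 - t) ^ ?N * V k \<le> (1 - u) ^ ?N * V k"
      using u t V by (intro mult_right_mono power_mono) auto
    also have "\<dots> \<le> ?P * m ^ ?N"
      unfolding u_def V_def by (rule card_cells_inside_ge[OF bb \<rho>(3,2) m(1) small])
    finally have "(1 - t) ^ ?N * V k * c \<le> ?P * m ^ ?N * c"
      by (rule mult_right_mono) (use a m in \<open>auto simp: c_def\<close>)
    also have "\<dots> = ?P * a m" using m by (simp add: c_def)
    finally have "(1 - t) ^ ?N * c \<le> X k / V k"
      using low V by (simp add: pos_le_divide_eq mult_ac)
    moreover have "X k / V k \<le> (1 + t) ^ ?N * (c + d)"
    proof -
      have e0: "0 \<le> (m + 4 * n) ^ ?N - (m - 2 * H) ^ ?N"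
        using m by (auto intro!: power_mono simp: H_def n_def)
      have "ennreal (X k) \<le> ennreal (?G * a m + card (straddling m s (A k)) * \<kappa>)"
        using mean_rank_upper[OF bb(1)[of k] m(1), of F l r s] unfolding X a[OF m(1)] \<kappa>'_def[symmetric] \<kappa>'(1)
        by (simp add: ennreal_mult ennreal_plus ennreal_of_nat_eq_real_of_nat a[OF m(1)] \<kappa>'(2))
      then have "X k \<le> ?G * a m + card (straddling m s (A k)) * \<kappa>"
        using a[OF m(1)] \<kappa>'(2) by (subst (asm) ennreal_le_iff) auto
      also have "\<dots> \<le> ?G * a m + (?G * ((m + 4 * n) ^ ?N - (m - 2 * H) ^ ?N)) * \<kappa>"
        unfolding n_def using bb(1)[of k] m \<kappa>'(2)
        by (intro add_left_mono mult_right_mono card_straddling_le) (auto simp: H_def n_def bounded_borel_def)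
      also have "\<dots> = (?G * m ^ ?N) * (c + d)"
        using m by (simp add: c_def d_def e_def field_simps)
      also have "\<dots> \<le> ((1 + u) ^ ?N * V k) * (c + d)"
        unfolding u_def V_def using a[OF m(1)] m e0 \<kappa>'(2)
        by (intro mult_right_mono card_cells_meeting_le[OF bb \<rho>(3,2) m(1)]) (auto simp: c_def d_def e_def)
      also have "\<dots> \<le> ((1 + t) ^ ?N * V k) * (c + d)"
        using a[OF m(1)] m e0 \<kappa>'(2) u t V
        by (intro mult_right_mono power_mono) (auto simp: c_def d_def e_def)
      finally show ?thesis using V by (simp add: pos_divide_le_eq mult_ac)
    qed
    ultimately show ?case using t(3,4) by linarith
  qed
  then show "\<exists>c. \<forall>\<^sub>F k in sequentially. \<bar>enn2real (mean_rank F l r s (A k)) / measure lborel (A k) - c\<bar> \<le> \<epsilon>"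
    unfolding X_def V_def by blast
qed

section \<open>Radon measures on open sets\<close>

lemma open_Delta: "open Delta"
proof -
  have "Delta = {p. fst p < snd p}" by (auto simp: Delta_def)
  also have "open \<dots>" by (intro open_Collect_less continuous_intros)
  finally show ?thesis .
qed

lemma Delta_borel [measurable, simp]: "Delta \<in> sets borel"
  using open_Delta by simp

lemma sets_restrict_Delta: "B \<in> sets (restrict_space borel Delta) \<longleftrightarrow> B \<in> sets borel \<and> B \<subseteq> Delta"
  by (subst sets_restrict_space_iff) auto

text \<open>An open set is exhausted by compact sets, and the restriction of the measure to each of them is a
  finite Borel measure on a Polish space, hence inner regular.\<close>

lemma radon_measure_onI:
  fixes \<mu> :: "'a::euclidean_space measure"
  assumes S: "open S" and sets: "sets \<mu> = sets (restrict_space borel S)"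
    and fin: "\<And>K. compact K \<Longrightarrow> K \<subseteq> S \<Longrightarrow> emeasure \<mu> K < \<infinity>"
  shows "radon_measure_on S \<mu>"
  unfolding radon_measure_on_def
proof (intro conjI ballI allI impI)
  have mem: "B \<in> sets \<mu> \<longleftrightarrow> B \<in> sets borel \<and> B \<subseteq> S" for B
    unfolding sets using S by (subst sets_restrict_space_iff) auto
  have space: "space \<mu> = S" using sets_eq_imp_space_eq[OF sets] by (simp add: space_restrict_space)
  fix B assume B: "B \<in> sets \<mu>"
  obtain C where C: "\<And>n::nat. compact (C n)" "\<And>n. C n \<subseteq> S" "\<And>n. C n \<subseteq> interior (C (Suc n))" "\<Union>(range C) = S"
    using open_Union_compact_subsets[OF S] by metis
  have Cm: "C n \<in> sets \<mu>" for n using C(1,2) by (auto simp: mem intro: borel_compact)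
  have incC: "incseq C" using C(3) interior_subset by (intro incseq_SucI) blast
  define \<nu> where "\<nu> n = distr (density \<mu> (indicator (C n))) borel (\<lambda>x. x)" for n
  have id: "(\<lambda>x. x) \<in> density \<mu> (indicator (C n)) \<rightarrow>\<^sub>M borel" for n
    by (rule measurableI) (auto simp: mem space S intro!: borel_open)
  have \<nu>: "emeasure (\<nu> n) E = emeasure \<mu> (C n \<inter> E)" if E: "E \<in> sets borel" for n E
  proof -
    have "E \<inter> S \<in> sets \<mu>" using E S by (simp add: mem)
    then have "emeasure (\<nu> n) E = emeasure \<mu> (C n \<inter> (E \<inter> S))"
      unfolding \<nu>_def using E Cm[of n]
      by (subst emeasure_distr[OF id]) (simp_all add: space emeasure_density flip: indicator_inter_arith)
    also have "C n \<inter> (E \<inter> S) = C n \<inter> E" using C(2) by auto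
    finally show ?thesis .
  qed
  have Bb: "B \<in> sets borel" "B \<subseteq> S" using B by (auto simp: mem)
  have "emeasure \<mu> B \<le> (SUP K\<in>{K. compact K \<and> K \<subseteq> B}. emeasure \<mu> K)"
  proof -
    have "emeasure \<mu> B = emeasure \<mu> (\<Union>n. C n \<inter> B)" using C(4) Bb(2) by (intro arg_cong[of _ _ "emeasure \<mu>"]) auto
    also have "\<dots> = (SUP n. emeasure \<mu> (C n \<inter> B))"
      using Cm B incC by (intro SUP_emeasure_incseq[symmetric]) (auto simp: incseq_def)
    also have "\<dots> \<le> (SUP K\<in>{K. compact K \<and> K \<subseteq> B}. emeasure \<mu> K)"
    proof (rule SUP_least)
      fix n
      have "emeasure \<mu> (C n \<inter> B) = emeasure (\<nu> n) B" using \<nu>[OF Bb(1)] by simp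
      also have "\<dots> = (SUP K\<in>{K. K \<subseteq> B \<and> compact K}. emeasure (\<nu> n) K)"
      proof (rule inner_regular[OF _ _ Bb(1)])
        show "sets (\<nu> n) = sets borel" by (simp add: \<nu>_def)
        have "emeasure (\<nu> n) (space (\<nu> n)) = emeasure \<mu> (C n)" using \<nu>[of UNIV n] by (simp add: \<nu>_def)
        then show "emeasure (\<nu> n) (space (\<nu> n)) \<noteq> \<infinity>" using fin[OF C(1,2)] by (metis less_irrefl)
      qed
      also have "\<dots> \<le> (SUP K\<in>{K. compact K \<and> K \<subseteq> B}. emeasure \<mu> K)"
      proof (rule SUP_mono)
        fix K assume K: "K \<in> {K. K \<subseteq> B \<and> compact K}"
        then have "K \<in> sets borel" by (auto intro: borel_compact)
        moreover from this have "K \<in> sets \<mu>" using K Bb by (auto simp: mem)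
        ultimately show "\<exists>K'\<in>{K. compact K \<and> K \<subseteq> B}. emeasure (\<nu> n) K \<le> emeasure \<mu> K'"
          using K by (intro bexI[of _ K]) (auto simp: \<nu> intro!: emeasure_mono)
      qed
      finally show "emeasure \<mu> (C n \<inter> B) \<le> (SUP K\<in>{K. compact K \<and> K \<subseteq> B}. emeasure \<mu> K)" .
    qed
    finally show ?thesis .
  qed
  moreover have "(SUP K\<in>{K. compact K \<and> K \<subseteq> B}. emeasure \<mu> K) \<le> emeasure \<mu> B"
    using B by (intro SUP_least emeasure_mono) auto
  ultimately show "emeasure \<mu> B = (SUP K\<in>{K. compact K \<and> K \<subseteq> B}. emeasure \<mu> K)" by (rule antisym)
qed (use assms in auto)

text \<open>The indicator of a compact set is a decreasing limit of the cutoff functions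
  \<open>max 0 (1 - n * infdist x K)\<close>, which have compact support in \<open>S\<close> for large \<open>n\<close>. So the integrals determine the
  measures of compact sets, and by inner regularity all measures.\<close>

lemma radon_measure_eqI:
  fixes P Q :: "'a::euclidean_space measure"
  assumes S: "open S" and P: "radon_measure_on S P" and Q: "radon_measure_on S Q"
    and eq: "\<And>f::'a \<Rightarrow> real. continuous_on S f \<Longrightarrow> \<exists>K. compact K \<and> K \<subseteq> S \<and> (\<forall>x\<in>S - K. f x = 0) \<Longrightarrow>
        (\<integral>x. f x \<partial>P) = (\<integral>x. f x \<partial>Q)"
  shows "P = Q"
proof (rule measure_eqI)
  have sets: "sets P = sets (restrict_space borel S)" "sets Q = sets (restrict_space borel S)"
    using P Q by (auto simp: radon_measure_on_def)
  then show "sets P = sets Q" by simp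
  have lim: "(\<lambda>n. \<integral>x. max 0 (1 - (real n + real n0) * infdist x K) \<partial>R) \<longlonglongrightarrow> measure R K"
    if R: "radon_measure_on S R" and K: "compact K" "K \<noteq> {}" "{x. infdist x K \<le> 1 / real n0} \<subseteq> S" and n0: "n0 > 0" for R K n0
  proof -
    let ?L = "{x. infdist x K \<le> 1 / real n0}"
    have sR: "sets R = sets (restrict_space borel S)" and spR: "space R = S"
      using R sets_eq_imp_space_eq[of R "restrict_space borel S"] by (auto simp: radon_measure_on_def space_restrict_space)
    have L: "compact ?L" using K(1,2) n0 by (intro compact_infdist_le) auto
    have mem: "B \<in> sets R" if "compact B" "B \<subseteq> S" for B
      unfolding sR using that S by (subst sets_restrict_space_iff) (auto intro: borel_compact)
    have KL: "K \<subseteq> ?L" by auto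
    have "(\<lambda>n. \<integral>x. max 0 (1 - (real n + real n0) * infdist x K) \<partial>R) \<longlonglongrightarrow> (\<integral>x. indicator K x \<partial>R)"
    proof (rule integral_dominated_convergence[where w = "indicator ?L"])
      show "integrable R (indicator ?L :: 'a \<Rightarrow> real)"
        using R L K(3) mem[OF L K(3)] by (auto simp: radon_measure_on_def)
      show "(indicator K :: 'a \<Rightarrow> real) \<in> borel_measurable R" using mem[OF K(1)] KL K(3) by auto
      show "(\<lambda>x. max 0 (1 - (real n + real n0) * infdist x K)) \<in> borel_measurable R" for n
        unfolding measurable_cong_sets[OF sR refl]
        by (rule measurable_restrict_space1) (intro borel_measurable_continuous_onI continuous_intros)
      show "AE x in R. norm (max 0 (1 - (real n + real n0) * infdist x K)) \<le> indicator ?L x" for n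
      proof (rule AE_I2)
        fix x
        have "x \<in> ?L" if "(real n + real n0) * infdist x K < 1"
        proof -
          have "real n0 * infdist x K \<le> (real n + real n0) * infdist x K"
            by (intro mult_right_mono) (auto simp: infdist_nonneg)
          then show ?thesis using that n0 by (simp add: pos_le_divide_eq mult.commute)
        qed
        moreover have "0 \<le> (real n + real n0) * infdist x K" by (simp add: infdist_nonneg)
        ultimately show "norm (max 0 (1 - (real n + real n0) * infdist x K)) \<le> indicator ?L x"
          unfolding indicator_def of_bool_def real_norm_def by (smt (verit))
      qed
      show "AE x in R. (\<lambda>n. max 0 (1 - (real n + real n0) * infdist x K)) \<longlonglongrightarrow> indicator K x"
      proof (rule AE_I2)
        fix x
        show "(\<lambda>n. max 0 (1 - (real n + real n0) * infdist x K)) \<longlonglongrightarrow> indicator K x"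
        proof (cases "x \<in> K")
          case False
          then have "infdist x K > 0"
            using K(1,2) in_closed_iff_infdist_zero[of K x] compact_imp_closed infdist_nonneg[of x K] by fastforce
          then have "\<forall>\<^sub>F n in sequentially. 1 < (real n + real n0) * infdist x K" by real_asymp
          then have "\<forall>\<^sub>F n in sequentially. max 0 (1 - (real n + real n0) * infdist x K) = indicator K x"
            by eventually_elim (use False in auto)
          then show ?thesis by (rule tendsto_eventually)
        qed simp
      qed
    qed
    also have "(\<integral>x. indicator K x \<partial>R) = measure R K"
    proof -
      have "K \<inter> S = K" using KL K(3) by blast
      then show ?thesis using mem[OF K(1)] KL K(3) by (simp add: spR)
    qed
    finally show ?thesis .
  qed
  have compact_eq: "emeasure P K = emeasure Q K" if K: "compact K" "K \<subseteq> S" for K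
  proof (cases "K = {}")
    case False
    obtain e where e: "e > 0" "{x. infdist x K \<le> e} \<subseteq> S"
      using compact_in_open_separated[OF False K(1) S K(2)] by blast
    obtain n0 :: nat where n0: "n0 > 0" "1 / real n0 < e" using e(1) ex_inverse_of_nat_less[of e] by (auto simp: inverse_eq_divide)
    have sub: "{x. infdist x K \<le> 1 / real n0} \<subseteq> S" using e(2) n0(2) by force
    have "(\<integral>x. max 0 (1 - (real n + real n0) * infdist x K) \<partial>P) = (\<integral>x. max 0 (1 - (real n + real n0) * infdist x K) \<partial>Q)" for n
    proof (rule eq)
      show "continuous_on S (\<lambda>x. max 0 (1 - (real n + real n0) * infdist x K))" by (intro continuous_intros)
      have "max 0 (1 - (real n + real n0) * infdist x K) = 0" if "x \<notin> {x. infdist x K \<le> 1 / real n0}" for x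
      proof -
        have "1 < real n0 * infdist x K" using that n0(1) by (simp add: field_simps)
        also have "\<dots> \<le> (real n + real n0) * infdist x K"
          by (intro mult_right_mono) (auto simp: infdist_nonneg)
        finally show ?thesis by simp
      qed
      moreover have "compact {x. infdist x K \<le> 1 / real n0}" using K(1) False n0 by (intro compact_infdist_le) auto
      ultimately show "\<exists>K'. compact K' \<and> K' \<subseteq> S \<and> (\<forall>x\<in>S - K'. max 0 (1 - (real n + real n0) * infdist x K) = 0)"
        using sub by blast
    qed
    with lim[OF P K(1) False sub n0(1)] lim[OF Q K(1) False sub n0(1)] have "measure P K = measure Q K"
      using LIMSEQ_unique by fastforce
    moreover have "emeasure P K < \<infinity>" "emeasure Q K < \<infinity>"
      using P Q K by (auto simp: radon_measure_on_def)
    ultimately show ?thesis by (simp add: emeasure_eq_ennreal_measure)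
  qed simp
  show "emeasure P B = emeasure Q B" if B: "B \<in> sets P" for B
  proof -
    have "B \<subseteq> S" using B sets.sets_into_space[OF B] sets_eq_imp_space_eq[OF sets(1)] by (simp add: space_restrict_space)
    then have "(SUP K\<in>{K. compact K \<and> K \<subseteq> B}. emeasure P K) = (SUP K\<in>{K. compact K \<and> K \<subseteq> B}. emeasure Q K)"
      by (intro SUP_cong compact_eq) auto
    moreover have "B \<in> sets Q" using B sets by simp
    ultimately show ?thesis using P Q B unfolding radon_measure_on_def by metis
  qed
qed

section \<open>A tree of rational rectangles in the half-plane\<close>

text \<open>The linear span of the indicators of half-open rectangles that keep a positive distance from the
  diagonal. Integrals of its members converge as soon as the masses of rectangles do.\<close>

inductive step_fun :: "(real \<times> real \<Rightarrow> real) \<Rightarrow> bool" where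
  rect: "b2 < d1 \<Longrightarrow> step_fun (indicator ({b1<..b2} \<times> {d1<..d2}))"
| add: "step_fun f \<Longrightarrow> step_fun g \<Longrightarrow> step_fun (\<lambda>x. f x + g x)"
| scale: "step_fun f \<Longrightarrow> step_fun (\<lambda>x. a * f x)"

lemma step_fun_mult_rect:
  assumes "step_fun g" "b2 < d1"
  shows "step_fun (\<lambda>x. indicator ({b1<..b2} \<times> {d1<..d2}) x * g x)"
  using assms(1)
proof induction
  case (rect b2' d1' b1' d2')
  have "(\<lambda>x. indicator ({b1<..b2} \<times> {d1<..d2}) x * indicator ({b1'<..b2'} \<times> {d1'<..d2'}) x :: real)
     = indicator ({max b1 b1'<..min b2 b2'} \<times> {max d1 d1'<..min d2 d2'})"
    by (auto simp: fun_eq_iff indicator_def)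
  then show ?case using assms(2) by (simp add: step_fun.rect)
next
  case (add f g)
  from step_fun.add[OF add.IH] show ?case by (simp add: distrib_left)
next
  case (scale f a)
  from step_fun.scale[OF scale.IH, of a] show ?case by (simp add: mult.left_commute)
qed

text \<open>The intersection of two half-open rectangles is one again, so the span is an algebra; therefore the
  sets with indicator in the span form a ring.\<close>

lemma step_fun_mult: "step_fun f \<Longrightarrow> step_fun g \<Longrightarrow> step_fun (\<lambda>x. f x * g x)"
proof (induction rule: step_fun.induct)
  case (rect b2 d1 b1 d2)
  then show ?case by (intro step_fun_mult_rect)
next
  case (add f h)
  from step_fun.add[OF add.IH(1)[OF add.prems] add.IH(2)[OF add.prems]] show ?case by (simp add: distrib_right)
next
  case (scale f a)
  from step_fun.scale[OF scale.IH[OF scale.prems], of a] show ?case by (simp add: mult.assoc)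
qed

lemma step_fun_zero_outside: "step_fun f \<Longrightarrow> x \<notin> Delta \<Longrightarrow> f x = 0"
  by (induction rule: step_fun.induct) (auto simp: Delta_def indicator_def)

lemma step_fun_borel: "step_fun f \<Longrightarrow> f \<in> borel_measurable borel"
  by (induction rule: step_fun.induct) (auto intro!: borel_measurable_indicator borel_measurable_add borel_measurable_times simp: borel_Times)

definition step_set :: "(real \<times> real) set \<Rightarrow> bool" where
  "step_set C \<longleftrightarrow> step_fun (indicator C)"

lemma step_set_rect: "b2 < d1 \<Longrightarrow> step_set ({b1<..b2} \<times> {d1<..d2})"
  by (simp add: step_set_def step_fun.rect)

lemma step_set_empty: "step_set {}"
  using step_set_rect[of 0 1 0 1] by simp

lemma step_set_Int: "step_set C \<Longrightarrow> step_set D \<Longrightarrow> step_set (C \<inter> D)"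
  using step_fun_mult[of "indicator C" "indicator D"] by (simp add: step_set_def indicator_inter_arith[abs_def])

lemma step_set_Diff: "step_set C \<Longrightarrow> step_set D \<Longrightarrow> step_set (C - D)"
proof -
  assume *: "step_set C" "step_set D"
  have "step_fun (\<lambda>x. indicator C x + (- 1) * (indicator C x * indicator D x))"
    using * unfolding step_set_def by (intro step_fun.add step_fun.scale step_fun_mult)
  also have "(\<lambda>x. indicator C x + (- 1) * (indicator C x * indicator D x)) = (indicator (C - D) :: _ \<Rightarrow> real)"
    by (auto simp: fun_eq_iff indicator_def)
  finally show ?thesis by (simp add: step_set_def)
qed

lemma step_set_Un: "step_set C \<Longrightarrow> step_set D \<Longrightarrow> step_set (C \<union> D)"
proof -
  assume *: "step_set C" "step_set D"
  have "step_fun (\<lambda>x. indicator C x + indicator (D - C) x)"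
    using * step_set_Diff[OF *(2,1)] unfolding step_set_def by (intro step_fun.add)
  also have "(\<lambda>x. indicator C x + indicator (D - C) x) = (indicator (C \<union> D) :: _ \<Rightarrow> real)"
    by (auto simp: fun_eq_iff indicator_def)
  finally show ?thesis by (simp add: step_set_def)
qed

lemma step_set_UN: "finite I \<Longrightarrow> (\<And>i. i \<in> I \<Longrightarrow> step_set (C i)) \<Longrightarrow> step_set (\<Union>i\<in>I. C i)"
  by (induction rule: finite_induct) (auto simp: step_set_empty intro: step_set_Un)

lemma step_set_subset: "step_set C \<Longrightarrow> C \<subseteq> Delta"
  using step_fun_zero_outside[of "indicator C"] by (auto simp: step_set_def indicator_def)

lemma step_set_borel: "step_set C \<Longrightarrow> C \<in> sets borel"
  using step_fun_borel[of "indicator C"] by (simp add: step_set_def borel_measurable_indicator_iff)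

text \<open>An enumeration of a countable family of half-open rectangles with closures in \<open>Delta\<close>; indices that do not
  encode such a rectangle give the empty set.\<close>

definition rat_rect :: "nat \<Rightarrow> (real \<times> real) set" where
  "rat_rect i = (case from_nat i :: rat \<times> rat \<times> rat \<times> rat of (a, b, c, d) \<Rightarrow>
     if b < c then {of_rat a<..of_rat b} \<times> {of_rat c<..of_rat d} else {})"

lemma rat_rect_step: "step_set (rat_rect i)"
  by (auto simp: rat_rect_def step_set_empty of_rat_less split: prod.split intro!: step_set_rect)

lemma rat_rect_closure: "compact (closure (rat_rect i))" "closure (rat_rect i) \<subseteq> Delta"
proof -
  obtain a b c d :: rat where eq: "from_nat i = (a, b, c, d)" by (metis prod_cases4)
  have "\<exists>L. compact L \<and> L \<subseteq> Delta \<and> rat_rect i \<subseteq> L"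
  proof (cases "b < c")
    case True
    then have "(of_rat b :: real) < of_rat c" by (simp add: of_rat_less)
    then show ?thesis using True
      by (intro exI[of _ "{of_rat a..of_rat b} \<times> {of_rat c..of_rat d}"])
        (auto simp: rat_rect_def eq Delta_def intro!: compact_Times)
  qed (auto simp: rat_rect_def eq)
  then obtain L where L: "compact L" "L \<subseteq> Delta" "rat_rect i \<subseteq> L" by blast
  then have "closure (rat_rect i) \<subseteq> L" by (intro closure_minimal compact_imp_closed)
  then show "closure (rat_rect i) \<subseteq> Delta" "compact (closure (rat_rect i))"
    using L(2) bounded_subset[OF compact_imp_bounded[OF L(1)] L(3)] by (auto simp: compact_closure)
qed

lemma rat_rect_local:
  assumes "p \<in> Delta" "\<epsilon> > 0"
  shows "\<exists>i. p \<in> interior (rat_rect i) \<and> (\<forall>x\<in>rat_rect i. \<forall>y\<in>rat_rect i. dist x y < \<epsilon>)"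
proof -
  obtain b d where p: "p = (b, d)" "b < d" using assms(1) by (auto simp: Delta_def)
  \<comment> \<open>The sides of the rectangle are less than \<open>2 * \<delta>\<close>, and the second bound keeps its closure off the diagonal.\<close>
  define \<delta> where "\<delta> = min (\<epsilon> / 4) ((d - b) / 2)"
  have \<delta>: "\<delta> > 0" "\<delta> \<le> \<epsilon> / 4" "b + \<delta> \<le> d - \<delta>" using p assms(2) by (auto simp: \<delta>_def min_def field_simps)
  obtain q1 q2 q3 q4 :: rat where
    q: "b - \<delta> < of_rat q1" "of_rat q1 < b" "b < of_rat q2" "of_rat q2 < b + \<delta>"
       "d - \<delta> < of_rat q3" "of_rat q3 < d" "d < of_rat q4" "of_rat q4 < d + \<delta>"
    using of_rat_dense[of "b - \<delta>" b] of_rat_dense[of b "b + \<delta>"] of_rat_dense[of "d - \<delta>" d] of_rat_dense[of d "d + \<delta>"] \<delta>(1)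
    by auto
  define i where "i = to_nat (q1, q2, q3, q4)"
  have "(of_rat q2 :: real) < of_rat q3" using q \<delta>(3) by linarith
  then have "q2 < q3" by (simp add: of_rat_less)
  then have R: "rat_rect i = {of_rat q1<..of_rat q2} \<times> {of_rat q3<..of_rat q4}"
    by (simp add: rat_rect_def i_def)
  have "p \<in> interior (rat_rect i)"
  proof (rule interiorI)
    show "open ({of_rat q1<..<of_rat q2::real} \<times> {of_rat q3<..<of_rat q4::real})" by (intro open_Times) auto
  qed (use q R p in auto)
  moreover have "dist x y < \<epsilon>" if "x \<in> rat_rect i" "y \<in> rat_rect i" for x y
  proof -
    have "\<bar>fst x - fst y\<bar> < 2 * \<delta>" "\<bar>snd x - snd y\<bar> < 2 * \<delta>" using that q unfolding R by (auto simp: abs_less_iff)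
    moreover have "dist x y \<le> \<bar>fst x - fst y\<bar> + \<bar>snd x - snd y\<bar>"
      using sqrt_sum_squares_le_sum_abs[of "fst x - fst y" "snd x - snd y"] by (simp add: dist_prod_def dist_real_def)
    ultimately show ?thesis using \<delta>(2) by linarith
  qed
  ultimately show ?thesis by blast
qed

text \<open>A sequence of ever finer partitions of \<open>Delta\<close>. Level \<open>0\<close> makes the rational rectangles disjoint; the step
  from level \<open>m\<close> to the next cuts every cell along the rectangle with index \<open>m\<close>. The children of cell \<open>i\<close> have the
  indices \<open>2 * i\<close> and \<open>2 * i + 1\<close>, so the cells of level \<open>m\<close> inside cell \<open>j\<close> of level \<open>0\<close> are those with
  \<open>i div 2 ^ m = j\<close>.\<close>

fun tree_cell :: "nat \<Rightarrow> nat \<Rightarrow> (real \<times> real) set" where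
  "tree_cell 0 i = rat_rect i - (\<Union>j<i. rat_rect j)"
| "tree_cell (Suc m) i = (if even i then tree_cell m (i div 2) \<inter> rat_rect m else tree_cell m (i div 2) - rat_rect m)"

lemma tree_cell_step: "step_set (tree_cell m i)"
proof (induction m arbitrary: i)
  case 0
  then show ?case by (auto intro!: step_set_Diff step_set_UN rat_rect_step)
next
  case (Suc m)
  then show ?case by (auto intro!: step_set_Diff step_set_Int rat_rect_step)
qed

lemma tree_cell_ancestor: "tree_cell m i \<subseteq> tree_cell 0 (i div 2 ^ m)"
proof (induction m arbitrary: i)
  case (Suc m)
  have "tree_cell (Suc m) i \<subseteq> tree_cell m (i div 2)" by auto
  also have "\<dots> \<subseteq> tree_cell 0 (i div 2 div 2 ^ m)" by (rule Suc.IH)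
  finally show ?case by (simp add: div_mult2_eq)
qed simp

lemma tree_cell_disjoint: "i \<noteq> j \<Longrightarrow> tree_cell m i \<inter> tree_cell m j = {}"
proof (induction m arbitrary: i j)
  case 0
  then show ?case by (cases "i < j") (auto simp: nat_neq_iff)
next
  case (Suc m)
  show ?case
  proof (cases "i div 2 = j div 2")
    case True
    have "even i \<noteq> even j"
    proof
      assume "even i = even j"
      then have "i mod 2 = j mod 2" by (simp add: even_iff_mod_2_eq_zero odd_iff_mod_2_eq_one parity_cases) (metis mod2_eq_if)
      then have "i = j" using True by (metis div_mod_decomp)
      then show False using Suc.prems by simp
    qed
    then show ?thesis using True by auto
  next
    case False
    from Suc.IH[OF this] show ?thesis by auto
  qed
qed

lemma tree_cell_cover: "(\<Union>i<N * 2 ^ m. tree_cell m i) = (\<Union>i<N. rat_rect i)"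
proof (induction m)
  case 0
  show ?case
  proof (intro equalityI subsetI)
    fix x assume "x \<in> (\<Union>i<N. rat_rect i)"
    then obtain i where i: "i < N" "x \<in> rat_rect i" by auto
    define j where "j = (LEAST j. x \<in> rat_rect j)"
    have "x \<in> rat_rect j" "j \<le> i" "\<And>k. k < j \<Longrightarrow> x \<notin> rat_rect k"
      using i(2) unfolding j_def by (auto intro: LeastI Least_le dest: not_less_Least)
    then show "x \<in> (\<Union>i<N * 2 ^ 0. tree_cell 0 i)" using i(1) by (auto intro!: bexI[of _ j])
  qed auto
next
  case (Suc m)
  have "(\<Union>i<N * 2 ^ Suc m. tree_cell (Suc m) i) = (\<Union>i<N * 2 ^ m. tree_cell m i)"
  proof (intro equalityI subsetI)
    fix x assume "x \<in> (\<Union>i<N * 2 ^ Suc m. tree_cell (Suc m) i)"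
    then obtain i where "i < N * 2 ^ Suc m" "x \<in> tree_cell (Suc m) i" by blast
    then have "i div 2 < N * 2 ^ m" "x \<in> tree_cell m (i div 2)" by (auto split: if_splits)
    then show "x \<in> (\<Union>i<N * 2 ^ m. tree_cell m i)" by blast
  next
    fix x assume "x \<in> (\<Union>i<N * 2 ^ m. tree_cell m i)"
    then obtain i where i: "i < N * 2 ^ m" "x \<in> tree_cell m i" by blast
    then have "x \<in> tree_cell (Suc m) (2 * i) \<or> x \<in> tree_cell (Suc m) (2 * i + 1)" by auto
    moreover have "2 * i < N * 2 ^ Suc m" "2 * i + 1 < N * 2 ^ Suc m" using i(1) by auto
    ultimately show "x \<in> (\<Union>i<N * 2 ^ Suc m. tree_cell (Suc m) i)" by blast
  qed
  then show ?case using Suc.IH by simp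
qed

lemma tree_cell_decided: "j < m \<Longrightarrow> tree_cell m i \<subseteq> rat_rect j \<or> tree_cell m i \<inter> rat_rect j = {}"
proof (induction m arbitrary: i)
  case (Suc m)
  show ?case
  proof (cases "j = m")
    case False
    then have "j < m" using Suc.prems by simp
    moreover have "tree_cell (Suc m) i \<subseteq> tree_cell m (i div 2)" by auto
    ultimately show ?thesis using Suc.IH[of "i div 2"] by blast
  qed auto
qed simp

lemma rat_rects_cover_compact:
  assumes K: "compact K" "K \<subseteq> Delta"
  obtains N where "K \<subseteq> (\<Union>i<N. interior (rat_rect i))"
proof -
  have "\<forall>p\<in>K. \<exists>i. p \<in> interior (rat_rect i)"
    using rat_rect_local[of _ 1] K(2) by fastforce
  then have "K \<subseteq> (\<Union>i\<in>UNIV. interior (rat_rect i))" by blast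
  then obtain J where J: "finite J" "K \<subseteq> (\<Union>i\<in>J. interior (rat_rect i))"
    using compactE_image[OF K(1), of UNIV "\<lambda>i. interior (rat_rect i)"] by (metis open_interior)
  then have "K \<subseteq> (\<Union>i<Suc (Max J). interior (rat_rect i))" using Max_ge[OF J(1)] by (fastforce simp: less_Suc_eq_le)
  then show thesis using that by blast
qed

lemma rat_rects_closure:
  "compact (closure (\<Union>i<N. rat_rect i))" "closure (\<Union>i<N. rat_rect i) \<subseteq> Delta" for N :: nat
proof -
  have eq: "closure (\<Union>i<N. rat_rect i) = (\<Union>i<N. closure (rat_rect i))"
    by (induction N) (simp_all add: lessThan_Suc)
  show "compact (closure (\<Union>i<N. rat_rect i))" "closure (\<Union>i<N. rat_rect i) \<subseteq> Delta"
    unfolding eq using rat_rect_closure by (auto intro!: compact_UN)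
qed

text \<open>The first \<open>N\<close> rectangles have a compact closure in \<open>Delta\<close>, which is covered by finitely many rational rectangles
  of small diameter. Beyond the indices of these, every cell is contained in each of them that it
  meets.\<close>

lemma tree_cell_mesh:
  assumes "\<epsilon> > 0"
  shows "\<exists>m0. \<forall>m\<ge>m0. \<forall>i. i div 2 ^ m < N \<longrightarrow> (\<forall>x\<in>tree_cell m i. \<forall>y\<in>tree_cell m i. dist x y < \<epsilon>)"
proof -
  let ?K = "closure (\<Union>i<N. rat_rect i)"
  have "\<forall>p\<in>?K. \<exists>j. p \<in> interior (rat_rect j) \<and> (\<forall>x\<in>rat_rect j. \<forall>y\<in>rat_rect j. dist x y < \<epsilon>)"
    using rat_rect_local[OF _ assms] rat_rects_closure(2)[of N] by blast
  then obtain j where j: "\<And>p. p \<in> ?K \<Longrightarrow> p \<in> interior (rat_rect (j p))"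
    "\<And>p x y. p \<in> ?K \<Longrightarrow> x \<in> rat_rect (j p) \<Longrightarrow> y \<in> rat_rect (j p) \<Longrightarrow> dist x y < \<epsilon>" by metis
  obtain D where D: "D \<subseteq> ?K" "finite D" "?K \<subseteq> (\<Union>p\<in>D. interior (rat_rect (j p)))"
    by (rule compactE_image[OF rat_rects_closure(1)[of N], of ?K "\<lambda>p. interior (rat_rect (j p))"]) (use j(1) in auto)
  define m0 where "m0 = Suc (Max (j ` D))"
  have "dist x y < \<epsilon>" if m: "m \<ge> m0" and i: "i div 2 ^ m < N" and xy: "x \<in> tree_cell m i" "y \<in> tree_cell m i" for m i x y
  proof -
    have "x \<in> rat_rect (i div 2 ^ m)" using xy(1) tree_cell_ancestor[of m i] by auto
    then have "x \<in> ?K" using i closure_subset[of "\<Union>i<N. rat_rect i"] by blast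
    then obtain p where p: "p \<in> D" "x \<in> interior (rat_rect (j p))" using D(3) by blast
    then have "j p < m0" using D(2) unfolding m0_def less_Suc_eq_le by (intro Max_ge) auto
    then have "j p < m" using m by simp
    moreover have "x \<in> tree_cell m i \<inter> rat_rect (j p)" using xy(1) p(2) interior_subset by blast
    ultimately have "tree_cell m i \<subseteq> rat_rect (j p)" using tree_cell_decided[of "j p" m i] by auto
    then show ?thesis using xy j(2)[of p x y] D(1) p(1) by auto
  qed
  then show ?thesis by blast
qed

section \<open>Limits of measures that converge on rectangles\<close>

text \<open>The masses of rectangles near the diagonal may be infinite or fail to converge; only rectangles with
  closure in \<open>Delta\<close> matter for vague convergence on \<open>Delta\<close>.\<close>

locale rectangle_convergent =
  fixes \<mu> :: "nat \<Rightarrow> (real \<times> real) measure"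
  assumes sets: "\<And>k. sets (\<mu> k) = sets (restrict_space borel Delta)"
    and fin: "\<And>b1 b2 d1 d2. b2 < d1 \<Longrightarrow> \<forall>\<^sub>F k in sequentially. emeasure (\<mu> k) ({b1<..b2} \<times> {d1<..d2}) < \<infinity>"
    and conv: "\<And>b1 b2 d1 d2. b2 < d1 \<Longrightarrow> convergent (\<lambda>k. measure (\<mu> k) ({b1<..b2} \<times> {d1<..d2}))"
begin

lemma in_sets: "B \<in> sets (\<mu> k) \<longleftrightarrow> B \<in> sets borel \<and> B \<subseteq> Delta"
  unfolding sets by (rule sets_restrict_Delta)

lemma space_\<mu>: "space (\<mu> k) = Delta"
  using sets_eq_imp_space_eq[OF sets[of k]] by (simp add: space_restrict_space)

lemma step_fun_integrals:
  "step_fun f \<Longrightarrow> (\<forall>\<^sub>F k in sequentially. integrable (\<mu> k) f) \<and> convergent (\<lambda>k. \<integral>x. f x \<partial>\<mu> k)"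
proof (induction rule: step_fun.induct)
  case (rect b2 d1 b1 d2)
  let ?R = "{b1<..b2} \<times> {d1<..d2}"
  have "step_set ?R" using rect by (rule step_set_rect)
  then have "?R \<in> sets (\<mu> k)" "?R \<inter> space (\<mu> k) = ?R" for k
    using step_set_subset step_set_borel by (auto simp: in_sets space_\<mu>)
  then show ?case using fin[OF rect, of b1 d2] conv[OF rect, of b1 d2]
    by (auto elim!: eventually_mono)
next
  case (add f g)
  then have "\<forall>\<^sub>F k in sequentially. integrable (\<mu> k) f \<and> integrable (\<mu> k) g" by (auto intro: eventually_conj)
  then have int: "\<forall>\<^sub>F k in sequentially. integrable (\<mu> k) (\<lambda>x. f x + g x)"
    and eq: "\<forall>\<^sub>F k in sequentially. (\<integral>x. f x \<partial>\<mu> k) + (\<integral>x. g x \<partial>\<mu> k) = (\<integral>x. f x + g x \<partial>\<mu> k)"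
    by (auto elim!: eventually_mono)
  have "convergent (\<lambda>k. (\<integral>x. f x \<partial>\<mu> k) + (\<integral>x. g x \<partial>\<mu> k))"
    using add by (intro convergent_add) auto
  then have "convergent (\<lambda>k. \<integral>x. f x + g x \<partial>\<mu> k)"
    using convergent_cong[OF eq] by simp
  then show ?case using int by blast
next
  case (scale f a)
  then show ?case by (auto elim!: eventually_mono intro!: convergent_mult_const_iff[THEN iffD2] convergent_mult convergent_const)
qed

text \<open>A finitely additive limit on the ring of step sets. It need not be countably additive, since mass can
  move to the boundary of a rectangle; the limit measure is built from the tree of cells instead.\<close>

definition weight :: "(real \<times> real) set \<Rightarrow> real" where
  "weight C = lim (\<lambda>k. measure (\<mu> k) C)"

lemma step_set_measurable: "step_set C \<Longrightarrow> C \<in> sets (\<mu> k)"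
  using step_set_subset step_set_borel by (auto simp: in_sets)

lemma step_set_finite: "step_set C \<Longrightarrow> \<forall>\<^sub>F k in sequentially. emeasure (\<mu> k) C < \<infinity>"
proof -
  assume C: "step_set C"
  have "C \<inter> space (\<mu> k) = C" for k using step_set_subset[OF C] by (auto simp: space_\<mu>)
  moreover have "\<forall>\<^sub>F k in sequentially. integrable (\<mu> k) (indicator C :: _ \<Rightarrow> real)"
    using step_fun_integrals[OF C[unfolded step_set_def]] by (rule conjunct1)
  ultimately show ?thesis
    unfolding integrable_indicator_iff by (auto elim: eventually_mono)
qed

lemma weight_limit:
  assumes "step_set C"
  shows "(\<lambda>k. measure (\<mu> k) C) \<longlonglongrightarrow> weight C"
proof -
  have "convergent (\<lambda>k. \<integral>x. indicat_real C x \<partial>\<mu> k)"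
    using step_fun_integrals[OF assms[unfolded step_set_def]] by (rule conjunct2)
  moreover have "(\<integral>x. indicat_real C x \<partial>\<mu> k) = measure (\<mu> k) C" for k
    using step_set_subset[OF assms] by (simp add: space_\<mu> Int_absorb2)
  ultimately show ?thesis unfolding weight_def convergent_LIMSEQ_iff[symmetric] by simp
qed

lemma weight_nonneg: "step_set C \<Longrightarrow> weight C \<ge> 0"
  by (rule LIMSEQ_le_const[OF weight_limit]) auto

lemma weight_empty: "weight {} = 0"
  by (simp add: weight_def)

lemma weight_split:
  assumes "step_set C" "step_set D"
  shows "weight C = weight (C \<inter> D) + weight (C - D)"
proof -
  note CD = step_set_Int[OF assms] step_set_Diff[OF assms]
  have "\<forall>\<^sub>F k in sequentially. measure (\<mu> k) C = measure (\<mu> k) (C \<inter> D) + measure (\<mu> k) (C - D)"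
    using step_set_finite[OF CD(1)] step_set_finite[OF CD(2)]
  proof eventually_elim
    case (elim k)
    have "measure (\<mu> k) ((C \<inter> D) \<union> (C - D)) = measure (\<mu> k) (C \<inter> D) + measure (\<mu> k) (C - D)"
      using elim CD by (intro measure_Union step_set_measurable) auto
    then show ?case by (simp add: Int_Diff_Un)
  qed
  then have "(\<lambda>k. measure (\<mu> k) C) \<longlonglongrightarrow> weight (C \<inter> D) + weight (C - D)"
    using tendsto_add[OF weight_limit[OF CD(1)] weight_limit[OF CD(2)]]
    by (rule tendsto_cong[THEN iffD2])
  then show ?thesis using weight_limit[OF assms(1)] LIMSEQ_unique by blast
qed

text \<open>An initial part of the half-line is tiled by intervals that represent the cells of level \<open>m\<close>, in the order of their indices and
  with their weights as lengths; this is the left end point of the interval of cell \<open>i\<close>.\<close>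

definition stack :: "nat \<Rightarrow> nat \<Rightarrow> real" where
  "stack m i = (\<Sum>j<i. weight (tree_cell m j))"

lemma stack_0 [simp]: "stack m 0 = 0" and stack_Suc: "stack m (Suc i) = stack m i + weight (tree_cell m i)"
  by (simp_all add: stack_def)

lemma stack_mono: "i \<le> j \<Longrightarrow> stack m i \<le> stack m j"
  unfolding stack_def by (intro sum_mono2) (auto intro: weight_nonneg tree_cell_step)

text \<open>By additivity of the weights, the intervals of the two children tile the interval of their parent.\<close>

lemma stack_double: "stack (Suc m) (2 * i) = stack m i"
proof (induction i)
  case (Suc i)
  have "stack (Suc m) (2 * Suc i) = stack m i + weight (tree_cell m i \<inter> rat_rect m) + weight (tree_cell m i - rat_rect m)"
    using Suc.IH by (simp add: stack_Suc)
  then show ?case using weight_split[OF tree_cell_step rat_rect_step, of m i m] by (simp add: stack_Suc)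
qed simp

lemma stack_power: "stack m (i * 2 ^ m) = stack 0 i"
proof (induction m)
  case (Suc m)
  have "stack (Suc m) (i * 2 ^ Suc m) = stack (Suc m) (2 * (i * 2 ^ m))" by (simp add: mult_ac)
  then show ?case using Suc.IH by (simp only: stack_double)
qed simp

definition stack_range :: "real set" where "stack_range = {u. 0 \<le> u \<and> (\<exists>i. u < stack 0 i)}"

text \<open>The index of the cell of level \<open>m\<close> whose interval contains \<open>u\<close>. Intervals of length \<open>0\<close> are never selected, so
  the selected cell is not empty.\<close>

definition slot :: "nat \<Rightarrow> real \<Rightarrow> nat" where "slot m u = (LEAST i. u < stack m (Suc i))"

lemma slot_bounds:
  assumes "u \<in> stack_range"
  shows "stack m (slot m u) \<le> u" "u < stack m (Suc (slot m u))"
proof -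
  obtain i where i: "u < stack 0 i" using assms by (auto simp: stack_range_def)
  have "u < stack m (i * 2 ^ m)" using i by (simp add: stack_power)
  also have "\<dots> \<le> stack m (Suc (i * 2 ^ m))" by (rule stack_mono) simp
  finally show 1: "u < stack m (Suc (slot m u))" unfolding slot_def by (rule LeastI)
  show "stack m (slot m u) \<le> u"
  proof (cases "slot m u")
    case 0
    then show ?thesis using assms by (simp add: stack_range_def)
  next
    case (Suc j)
    then have "j < slot m u" by simp
    then have "\<not> u < stack m (Suc j)" unfolding slot_def by (rule not_less_Least)
    then show ?thesis using Suc by simp
  qed
qed

lemma slot_unique:
  assumes "stack m i \<le> u" "u < stack m (Suc i)"
  shows "slot m u = i"
  unfolding slot_def
proof (rule Least_equality)
  show "u < stack m (Suc i)" by (rule assms(2))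
  fix j assume "u < stack m (Suc j)"
  then have "\<not> Suc j \<le> i" using stack_mono[of "Suc j" i m] assms(1) by auto
  then show "i \<le> j" by simp
qed

lemma slot_Suc:
  assumes "u \<in> stack_range"
  shows "slot (Suc m) u div 2 = slot m u"
proof -
  let ?i = "slot (Suc m) u"
  have "stack m (?i div 2) = stack (Suc m) (2 * (?i div 2))" by (simp only: stack_double)
  also have "\<dots> \<le> stack (Suc m) ?i" by (rule stack_mono) simp
  also have "\<dots> \<le> u" by (rule slot_bounds(1)[OF assms])
  finally have 1: "stack m (?i div 2) \<le> u" .
  have "u < stack (Suc m) (Suc ?i)" by (rule slot_bounds(2)[OF assms])
  also have "\<dots> \<le> stack (Suc m) (2 * Suc (?i div 2))" by (rule stack_mono) presburger
  also have "\<dots> = stack m (Suc (?i div 2))" by (rule stack_double)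
  finally show ?thesis using slot_unique[OF 1] by simp
qed

lemma slot_power: "u \<in> stack_range \<Longrightarrow> slot m u div 2 ^ m = slot 0 u"
proof (induction m)
  case (Suc m)
  have "slot (Suc m) u div 2 ^ Suc m = slot (Suc m) u div 2 div 2 ^ m" by (simp add: div_mult2_eq)
  then show ?case using Suc by (simp add: slot_Suc)
qed simp

text \<open>For an empty cell this is an arbitrary point; such a cell has weight \<open>0\<close>.\<close>

definition center :: "nat \<Rightarrow> nat \<Rightarrow> real \<times> real" where
  "center m i = (SOME x. x \<in> tree_cell m i)"

lemma center_in: "tree_cell m i \<noteq> {} \<Longrightarrow> center m i \<in> tree_cell m i"
  unfolding center_def by (simp add: some_in_eq)

lemma center_slot:
  assumes "u \<in> stack_range"
  shows "center m (slot m u) \<in> tree_cell m (slot m u)"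
proof (rule center_in)
  have "weight (tree_cell m (slot m u)) > 0" using slot_bounds[OF assms, of m] by (simp add: stack_Suc)
  then show "tree_cell m (slot m u) \<noteq> {}" by (auto simp: weight_empty)
qed

lemma tree_cell_slot_antimono:
  assumes u: "u \<in> stack_range" and "m \<le> m'"
  shows "tree_cell m' (slot m' u) \<subseteq> tree_cell m (slot m u)"
  using assms(2)
proof (induction rule: dec_induct)
  case (step m')
  have "tree_cell (Suc m') (slot (Suc m') u) \<subseteq> tree_cell m' (slot (Suc m') u div 2)" by auto
  then show ?case using step.IH unfolding slot_Suc[OF u] by blast
qed simp

text \<open>The cells selected by \<open>u\<close> at successive levels are nested and their diameters tend to \<open>0\<close>.\<close>

definition quantile :: "real \<Rightarrow> real \<times> real" where
  "quantile u = lim (\<lambda>m. center m (slot m u))"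

lemma quantile_limit:
  assumes "u \<in> stack_range"
  shows "(\<lambda>m. center m (slot m u)) \<longlonglongrightarrow> quantile u"
proof -
  have "Cauchy (\<lambda>m. center m (slot m u))"
  proof (rule metric_CauchyI)
    fix \<epsilon> :: real assume "\<epsilon> > 0"
    then obtain m0 where m0: "\<And>i x y. i div 2 ^ m0 < Suc (slot 0 u) \<Longrightarrow> x \<in> tree_cell m0 i \<Longrightarrow> y \<in> tree_cell m0 i \<Longrightarrow> dist x y < \<epsilon>"
      using tree_cell_mesh[of \<epsilon> "Suc (slot 0 u)"] by blast
    have "dist (center m (slot m u)) (center m' (slot m' u)) < \<epsilon>" if "m \<ge> m0" "m' \<ge> m0" for m m'
      using center_slot[OF assms] tree_cell_slot_antimono[OF assms that(1)] tree_cell_slot_antimono[OF assms that(2)]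
      by (intro m0[of "slot m0 u"]) (auto simp: slot_power[OF assms])
    then show "\<exists>M. \<forall>m\<ge>M. \<forall>n\<ge>M. dist (center m (slot m u)) (center n (slot n u)) < \<epsilon>" by blast
  qed
  then show ?thesis unfolding quantile_def convergent_LIMSEQ_iff[symmetric] by (rule Cauchy_convergent)
qed

lemma quantile_in_closure: "u \<in> stack_range \<Longrightarrow> quantile u \<in> closure (tree_cell 0 (slot 0 u))"
proof -
  assume u: "u \<in> stack_range"
  have "center m (slot m u) \<in> closure (tree_cell 0 (slot 0 u))" for m
    using center_slot[OF u, of m] tree_cell_slot_antimono[OF u, of 0 m] closure_subset by blast
  then show ?thesis using closed_sequentially[OF closed_closure _ quantile_limit[OF u]] by blast
qed

lemma quantile_Delta: "u \<in> stack_range \<Longrightarrow> quantile u \<in> Delta"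
proof -
  assume u: "u \<in> stack_range"
  have "closure (tree_cell 0 (slot 0 u)) \<subseteq> closure (rat_rect (slot 0 u))" by (intro closure_mono) auto
  then show ?thesis using quantile_in_closure[OF u] rat_rect_closure(2) by blast
qed

lemma center_slot_Delta: "u \<in> stack_range \<Longrightarrow> center m (slot m u) \<in> Delta"
  using center_slot step_set_subset[OF tree_cell_step] by blast

text \<open>Cells that are disjoint from an open set have closures that are disjoint from it. So a compact subset
  of \<open>Delta\<close> is only reached from a bounded part of the half-line.\<close>

lemma quantile_far:
  assumes u: "u \<in> stack_range" and q: "quantile u \<in> (\<Union>i<N. interior (rat_rect i))"
  shows "u < stack 0 N"
proof -
  have "slot 0 u < N"
  proof (rule ccontr)
    assume ge: "\<not> slot 0 u < N"
    have "closure (tree_cell 0 (slot 0 u)) \<inter> (\<Union>i<N. interior (rat_rect i)) = {}"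
    proof -
      have "tree_cell 0 (slot 0 u) \<inter> (\<Union>i<N. interior (rat_rect i)) = {}"
        using ge interior_subset by fastforce
      then show ?thesis by (subst Int_commute, subst open_Int_closure_eq_empty) auto
    qed
    then show False using quantile_in_closure[OF u] q by blast
  qed
  then have "stack 0 (Suc (slot 0 u)) \<le> stack 0 N" by (intro stack_mono) simp
  then show ?thesis using slot_bounds(2)[OF u, of 0] by linarith
qed

lemma stack_range_borel [measurable, simp]: "stack_range \<in> sets borel"
proof -
  have "stack_range = {0..} \<inter> (\<Union>i. {..<stack 0 i})" by (auto simp: stack_range_def)
  also have "\<dots> \<in> sets borel" by auto
  finally show ?thesis .
qed

lemma slot_measurable: "slot m \<in> borel \<rightarrow>\<^sub>M count_space UNIV"
proof -
  have [measurable]: "Measurable.pred borel (\<lambda>u. u < stack m (Suc i))" for i by measurable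
  show ?thesis unfolding slot_def by measurable
qed

abbreviation base :: "real measure" where "base \<equiv> restrict_space lborel stack_range"

lemma center_slot_measurable: "(\<lambda>u. h (center m (slot m u))) \<in> borel_measurable base" for h :: "real \<times> real \<Rightarrow> 'b::topological_space"
proof (rule measurable_restrict_space1)
  have "slot m \<in> lborel \<rightarrow>\<^sub>M count_space UNIV" using slot_measurable by simp
  from measurable_compose[OF this, of "\<lambda>i. h (center m i)" borel]
  show "(\<lambda>u. h (center m (slot m u))) \<in> borel_measurable lborel" by simp
qed

lemma quantile_measurable: "quantile \<in> base \<rightarrow>\<^sub>M restrict_space borel Delta"
proof (rule measurable_restrict_space2)
  show "quantile \<in> space base \<rightarrow> Delta" using quantile_Delta by (auto simp: space_restrict_space)
  show "quantile \<in> borel_measurable base"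
    by (rule borel_measurable_LIMSEQ_metric[of "\<lambda>m u. center m (slot m u)"])
      (use center_slot_measurable[of "\<lambda>x. x"] quantile_limit in \<open>auto simp: space_restrict_space\<close>)
qed

text \<open>The image of Lebesgue measure under \<open>quantile\<close>, a two-dimensional analogue of the quantile
  transformation. Countable additivity is inherited from Lebesgue measure.\<close>

definition limit_measure :: "(real \<times> real) measure" where
  "limit_measure = distr base (restrict_space borel Delta) quantile"

lemma radon_limit_measure: "radon_measure_on Delta limit_measure"
proof (rule radon_measure_onI[OF open_Delta])
  show "sets limit_measure = sets (restrict_space borel Delta)" by (simp add: limit_measure_def)
  fix K assume K: "compact K" "K \<subseteq> Delta"
  obtain N where N: "K \<subseteq> (\<Union>i<N. interior (rat_rect i))" using rat_rects_cover_compact[OF K] .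
  have Ks: "K \<in> sets (restrict_space borel Delta)" using K by (simp add: sets_restrict_Delta borel_compact)
  have "emeasure limit_measure K = emeasure base (quantile -` K \<inter> space base)"
    unfolding limit_measure_def by (rule emeasure_distr[OF quantile_measurable Ks])
  also have "\<dots> = emeasure lborel (quantile -` K \<inter> stack_range)"
    by (subst emeasure_restrict_space) (auto simp: space_restrict_space)
  also have "\<dots> \<le> emeasure lborel {0..stack 0 N}"
  proof (rule emeasure_mono)
    show "quantile -` K \<inter> stack_range \<subseteq> {0..stack 0 N}"
    proof
      fix u assume u: "u \<in> quantile -` K \<inter> stack_range"
      then have "u < stack 0 N" using N by (intro quantile_far) auto
      then show "u \<in> {0..stack 0 N}" using u by (simp add: stack_range_def)
    qed
  qed simp
  also have "\<dots> < \<infinity>" by (simp add: emeasure_lborel_Icc_eq)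
  finally show "emeasure limit_measure K < \<infinity>" .
qed

text \<open>The sums are the integrals of \<open>f\<close> along the level-\<open>m\<close> approximations of \<open>quantile\<close>; dominated convergence
  applies since \<open>f \<circ> quantile\<close> vanishes outside a bounded interval.\<close>

lemma integral_limit_measure:
  fixes f :: "real \<times> real \<Rightarrow> real"
  assumes f: "continuous_on Delta f" and B: "\<And>x. x \<in> Delta \<Longrightarrow> \<bar>f x\<bar> \<le> B"
    and supp: "\<And>x. x \<in> Delta \<Longrightarrow> x \<notin> (\<Union>i<N. interior (rat_rect i)) \<Longrightarrow> f x = 0"
  shows "(\<lambda>m. \<Sum>i<N * 2 ^ m. f (center m i) * weight (tree_cell m i)) \<longlonglongrightarrow> (\<integral>x. f x \<partial>limit_measure)"
proof -
  let ?J = "{0..<stack 0 N}"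
  have fm: "f \<in> borel_measurable (restrict_space borel Delta)"
    by (rule borel_measurable_continuous_on_restrict[OF f])
  have J: "?J \<subseteq> stack_range" by (auto simp: stack_range_def)
  have Jm: "?J \<in> sets base" using J by (simp add: sets_restrict_space_iff)
  have "(\<integral>x. f x \<partial>limit_measure) = (\<integral>u. f (quantile u) \<partial>base)"
    unfolding limit_measure_def by (rule integral_distr[OF quantile_measurable fm])
  also have "\<dots> = (\<integral>u. indicator ?J u * f (quantile u) \<partial>base)"
  proof (rule Bochner_Integration.integral_cong[OF refl])
    fix u assume "u \<in> space base"
    then have u: "u \<in> stack_range" by (simp add: space_restrict_space)
    show "f (quantile u) = indicator ?J u * f (quantile u)"
    proof (cases "u \<in> ?J")
      case False
      then have "f (quantile u) = 0"
        using u quantile_far[OF u, of N] by (intro supp quantile_Delta) (auto simp: stack_range_def)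
      then show ?thesis by simp
    qed simp
  qed
  finally have eq: "(\<integral>x. f x \<partial>limit_measure) = (\<integral>u. indicator ?J u * f (quantile u) \<partial>base)" .
  have "(\<lambda>m. \<integral>u. indicator ?J u * f (center m (slot m u)) \<partial>base) \<longlonglongrightarrow> (\<integral>u. indicator ?J u * f (quantile u) \<partial>base)"
  proof (rule integral_dominated_convergence[where w = "\<lambda>u. indicator ?J u * B"])
    have ind: "(indicator ?J :: real \<Rightarrow> real) \<in> borel_measurable base" using Jm by simp
    show "(\<lambda>u. indicator ?J u * f (quantile u)) \<in> borel_measurable base"
      using ind measurable_compose[OF quantile_measurable fm] by (intro borel_measurable_times)
    show "(\<lambda>u. indicator ?J u * f (center m (slot m u))) \<in> borel_measurable base" for m
      using ind center_slot_measurable by (intro borel_measurable_times)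
    have "emeasure base ?J < \<infinity>" using J stack_mono[of 0 N 0] by (subst emeasure_restrict_space) auto
    then show "integrable base (\<lambda>u. indicator ?J u * B)" using Jm by (intro integrable_mult_left) auto
    show "AE u in base. (\<lambda>m. indicator ?J u * f (center m (slot m u))) \<longlonglongrightarrow> indicator ?J u * f (quantile u)"
    proof (rule AE_I2)
      fix u assume "u \<in> space base"
      then have u: "u \<in> stack_range" by (simp add: space_restrict_space)
      have "(\<lambda>m. f (center m (slot m u))) \<longlonglongrightarrow> f (quantile u)"
        by (rule continuous_on_tendsto_compose[OF f quantile_limit[OF u] quantile_Delta[OF u]])
          (simp add: center_slot_Delta[OF u])
      then show "(\<lambda>m. indicator ?J u * f (center m (slot m u))) \<longlonglongrightarrow> indicator ?J u * f (quantile u)"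
        by (intro tendsto_intros)
    qed
    show "AE u in base. norm (indicator ?J u * f (center m (slot m u))) \<le> indicator ?J u * B" for m
      using B center_slot_Delta by (intro AE_I2) (auto simp: indicator_def space_restrict_space)
  qed
  also have "(\<lambda>m. \<integral>u. indicator ?J u * f (center m (slot m u)) \<partial>base) = (\<lambda>m. \<Sum>i<N * 2 ^ m. f (center m i) * weight (tree_cell m i))"
  proof
    fix m
    let ?I = "\<lambda>i. {stack m i..<stack m (Suc i)}"
    have IU: "?I i \<subseteq> stack_range" if "i < N * 2 ^ m" for i
    proof -
      have "0 \<le> stack m i" using stack_mono[of 0 i m] by simp
      moreover have "stack m (Suc i) \<le> stack 0 N" using stack_mono[of "Suc i" "N * 2 ^ m" m] that by (simp add: stack_power)
      ultimately show ?thesis by (auto simp: stack_range_def intro!: exI[of _ N])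
    qed
    have "(\<integral>u. indicator ?J u * f (center m (slot m u)) \<partial>base) = (\<integral>u. (\<Sum>i<N * 2 ^ m. f (center m i) * indicator (?I i) u) \<partial>base)"
    proof (rule Bochner_Integration.integral_cong[OF refl])
      fix u assume "u \<in> space base"
      then have u: "u \<in> stack_range" by (simp add: space_restrict_space)
      have ind: "indicator (?I i) u = (if i = slot m u then 1 else (0::real))" for i
      proof (cases "i = slot m u")
        case True
        then show ?thesis using slot_bounds[OF u, of m] by simp
      next
        case False
        then have "u \<notin> ?I i" using slot_unique[of m i u] by auto
        then show ?thesis using False by simp
      qed
      have "u \<in> ?J \<longleftrightarrow> slot m u < N * 2 ^ m"
      proof
        assume "u \<in> ?J"
        then have "u < stack m (N * 2 ^ m)" by (simp add: stack_power)
        then show "slot m u < N * 2 ^ m" using slot_bounds(1)[OF u, of m] stack_mono[of "N * 2 ^ m" "slot m u" m] by fastforce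
      next
        assume "slot m u < N * 2 ^ m"
        then have "stack m (Suc (slot m u)) \<le> stack 0 N" using stack_mono[of "Suc (slot m u)" "N * 2 ^ m" m] by (simp add: stack_power)
        then show "u \<in> ?J" using slot_bounds(2)[OF u, of m] u by (auto simp: stack_range_def)
      qed
      then show "indicator ?J u * f (center m (slot m u)) = (\<Sum>i<N * 2 ^ m. f (center m i) * indicator (?I i) u)"
        unfolding ind by (auto simp: if_distrib cong: if_cong)
    qed
    also have "\<dots> = (\<Sum>i<N * 2 ^ m. f (center m i) * measure base (?I i))"
    proof -
      have "emeasure base (?I i) < \<infinity>" "?I i \<in> sets base" "?I i \<inter> space base = ?I i" if "i < N * 2 ^ m" for i
        using IU[OF that] by (auto simp: emeasure_restrict_space sets_restrict_space_iff space_restrict_space stack_mono)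
      then show ?thesis by (subst Bochner_Integration.integral_sum) auto
    qed
    also have "\<dots> = (\<Sum>i<N * 2 ^ m. f (center m i) * weight (tree_cell m i))"
      using IU stack_mono by (intro sum.cong refl) (subst measure_restrict_space, auto simp: stack_Suc weight_nonneg tree_cell_step)
    finally show "(\<integral>u. indicator ?J u * f (center m (slot m u)) \<partial>base) = (\<Sum>i<N * 2 ^ m. f (center m i) * weight (tree_cell m i))" .
  qed
  finally show ?thesis unfolding eq .
qed

text \<open>At a deep level \<open>m\<close> the function \<open>f\<close> is almost constant on the cells, uniformly in \<open>k\<close>; and the masses of the finitely
  many relevant cells converge to their weights.\<close>

lemma vague_convergence_limit_measure: "vague_convergence_on Delta \<mu> limit_measure"
  unfolding vague_convergence_on_def
proof (intro allI impI, elim conjE exE)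
  fix f :: "real \<times> real \<Rightarrow> real" and K
  assume f: "continuous_on Delta f" and K: "compact K" "K \<subseteq> Delta" and fK: "\<forall>x\<in>Delta - K. f x = 0"
  obtain N where N: "K \<subseteq> (\<Union>i<N. interior (rat_rect i))" using rat_rects_cover_compact[OF K] .
  let ?D = "\<Union>i<N. rat_rect i"
  have D: "step_set ?D" by (intro step_set_UN rat_rect_step) simp
  have KD: "K \<subseteq> ?D" using N interior_subset by blast
  obtain B where B: "\<And>x. x \<in> Delta \<Longrightarrow> \<bar>f x\<bar> \<le> B" and B0: "0 \<le> B"
  proof -
    have "bounded (f ` K)" using K f continuous_on_subset by (intro compact_imp_bounded compact_continuous_image) blast+
    then obtain B where "\<And>x. x \<in> K \<Longrightarrow> \<bar>f x\<bar> \<le> B" by (auto simp: bounded_iff)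
    then have "\<bar>f x\<bar> \<le> max B 0" if "x \<in> Delta" for x
      using that fK by (cases "x \<in> K") (auto simp: le_max_iff_disj)
    then show thesis by (intro that[of "max B 0"]) auto
  qed
  show "(\<lambda>k. \<integral>x. f x \<partial>\<mu> k) \<longlonglongrightarrow> (\<integral>x. f x \<partial>limit_measure)"
  proof (rule tendstoI)
    fix \<epsilon> :: real assume \<epsilon>: "\<epsilon> > 0"
    define W where "W = weight ?D + 1"
    have W: "W > 0" using weight_nonneg[OF D] by (simp add: W_def)
    \<comment> \<open>Three errors of at most \<open>\<epsilon> / 3\<close>: the oscillation of \<open>f\<close> on the cells, the difference between masses and weights, and the discretisation of the limit integral. The masses of \<open>?D\<close> are eventually below \<open>W\<close>.\<close>
    define \<eta> where "\<eta> = \<epsilon> / (3 * W)"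
    have \<eta>: "\<eta> > 0" using \<epsilon> W by (simp add: \<eta>_def)
    have "uniformly_continuous_on (closure ?D) f"
      using rat_rects_closure[of N] continuous_on_subset[OF f] by (intro compact_uniformly_continuous) auto
    then obtain \<delta> where \<delta>: "\<delta> > 0" "\<And>x y. x \<in> closure ?D \<Longrightarrow> y \<in> closure ?D \<Longrightarrow> dist y x < \<delta> \<Longrightarrow> dist (f y) (f x) < \<eta>"
      using \<eta> unfolding uniformly_continuous_on_def by metis
    obtain m0 where m0: "\<And>m i x y. m \<ge> m0 \<Longrightarrow> i div 2 ^ m < N \<Longrightarrow> x \<in> tree_cell m i \<Longrightarrow> y \<in> tree_cell m i \<Longrightarrow> dist x y < \<delta>"
      using tree_cell_mesh[OF \<delta>(1), of N] by blast
    have "(\<lambda>m. \<Sum>i<N * 2 ^ m. f (center m i) * weight (tree_cell m i)) \<longlonglongrightarrow> (\<integral>x. f x \<partial>limit_measure)"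
      using f B fK N by (intro integral_limit_measure) auto
    from tendstoD[OF this, of "\<epsilon> / 3"] \<epsilon>
    have "\<forall>\<^sub>F m in sequentially. dist (\<Sum>i<N * 2 ^ m. f (center m i) * weight (tree_cell m i)) (\<integral>x. f x \<partial>limit_measure) < \<epsilon> / 3" by simp
    with eventually_ge_at_top[of m0]
    have "\<forall>\<^sub>F m in sequentially. m0 \<le> m \<and> dist (\<Sum>i<N * 2 ^ m. f (center m i) * weight (tree_cell m i)) (\<integral>x. f x \<partial>limit_measure) < \<epsilon> / 3"
      by eventually_elim simp
    then obtain m where m: "m \<ge> m0" "dist (\<Sum>i<N * 2 ^ m. f (center m i) * weight (tree_cell m i)) (\<integral>x. f x \<partial>limit_measure) < \<epsilon> / 3"
      using eventually_happens' sequentially_bot by blast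
    let ?n = "N * 2 ^ m"
    let ?g = "\<lambda>x. \<Sum>i<?n. f (center m i) * indicator (tree_cell m i) x"
    have osc: "\<bar>f x - ?g x\<bar> \<le> \<eta> * indicator ?D x" if "x \<in> Delta" for x
    proof (cases "x \<in> ?D")
      case True
      then obtain i where i: "i < ?n" "x \<in> tree_cell m i" using tree_cell_cover[of m N] by blast
      have ind: "indicator (tree_cell m j) x = (if j = i then 1 else (0::real))" for j
        using tree_cell_disjoint[of i j m] i(2) by (auto simp: indicator_def)
      have g: "?g x = f (center m i)" unfolding ind using i(1) by (simp add: if_distrib cong: if_cong)
      have c: "center m i \<in> tree_cell m i" using i(2) by (intro center_in) auto
      have sub: "tree_cell m i \<subseteq> closure ?D" using tree_cell_cover[of m N] i(1) closure_subset by blast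
      have "i div 2 ^ m < N" using i(1) by (simp add: div_less_iff_less_mult)
      then have "dist (f x) (f (center m i)) < \<eta>"
        using m0[OF m(1) _ i(2) c] sub i(2) c by (intro \<delta>(2)) auto
      then show ?thesis using True g by (simp add: dist_real_def)
    next
      case False
      have "x \<notin> tree_cell m i" if "i < ?n" for i using tree_cell_cover[of m N] False that by blast
      then have "?g x = 0" by (intro sum.neutral) auto
      moreover have "f x = 0" using fK KD that False by auto
      ultimately show ?thesis using False by simp
    qed
    have "(\<lambda>k. \<Sum>i<?n. f (center m i) * measure (\<mu> k) (tree_cell m i)) \<longlonglongrightarrow> (\<Sum>i<?n. f (center m i) * weight (tree_cell m i))"
      by (intro tendsto_intros weight_limit tree_cell_step)
    from tendstoD[OF this, of "\<epsilon> / 3"] \<epsilon>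
    have ev1: "\<forall>\<^sub>F k in sequentially. dist (\<Sum>i<?n. f (center m i) * measure (\<mu> k) (tree_cell m i)) (\<Sum>i<?n. f (center m i) * weight (tree_cell m i)) < \<epsilon> / 3" by simp
    have ev2: "\<forall>\<^sub>F k in sequentially. measure (\<mu> k) ?D < W"
      using weight_limit[OF D] by (rule order_tendstoD(2)) (simp add: W_def)
    show "\<forall>\<^sub>F k in sequentially. dist (\<integral>x. f x \<partial>\<mu> k) (\<integral>x. f x \<partial>limit_measure) < \<epsilon>"
      using ev1 ev2 step_set_finite[OF D]
    proof eventually_elim
      case (elim k)
      have Dk: "?D \<in> sets (\<mu> k)" "?D \<inter> space (\<mu> k) = ?D"
        using step_set_measurable[OF D] step_set_subset[OF D] by (auto simp: space_\<mu>)
      have ck: "tree_cell m i \<in> sets (\<mu> k)" "tree_cell m i \<inter> space (\<mu> k) = tree_cell m i" for i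
        using step_set_measurable[OF tree_cell_step] step_set_subset[OF tree_cell_step, of m i] by (auto simp: space_\<mu>)
      have intD: "integrable (\<mu> k) (indicat_real ?D)" using Dk elim(3) by (simp add: integrable_indicator_iff)
      have fm: "f \<in> borel_measurable (\<mu> k)"
        unfolding measurable_cong_sets[OF sets refl] by (rule borel_measurable_continuous_on_restrict[OF f])
      have intf: "integrable (\<mu> k) f"
      proof (rule Bochner_Integration.integrable_bound[OF integrable_mult_right[OF intD, of B] fm], rule AE_I2)
        fix x assume "x \<in> space (\<mu> k)"
        then have x: "x \<in> Delta" by (simp add: space_\<mu>)
        show "norm (f x) \<le> norm (B * indicat_real ?D x)"
          using B[OF x] B0 fK KD x by (cases "x \<in> ?D") auto
      qed
      have fin: "emeasure (\<mu> k) (tree_cell m i) < \<infinity>" if "i < ?n" for i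
      proof -
        have "emeasure (\<mu> k) (tree_cell m i) \<le> emeasure (\<mu> k) ?D"
          using tree_cell_cover[of m N] that Dk(1) by (intro emeasure_mono) blast+
        then show ?thesis using elim(3) by (rule le_less_trans)
      qed
      have inti: "integrable (\<mu> k) (\<lambda>x. f (center m i) * indicator (tree_cell m i) x)" if "i < ?n" for i
        using fin[OF that] ck by (intro integrable_mult_right) (simp add: integrable_indicator_iff)
      have intg: "integrable (\<mu> k) ?g" using inti by (intro Bochner_Integration.integrable_sum) auto
      have "(\<integral>x. ?g x \<partial>\<mu> k) = (\<Sum>i<?n. \<integral>x. f (center m i) * indicator (tree_cell m i) x \<partial>\<mu> k)"
        using inti by (intro Bochner_Integration.integral_sum) auto
      also have "\<dots> = (\<Sum>i<?n. f (center m i) * measure (\<mu> k) (tree_cell m i))"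
        using ck(2) by (intro sum.cong) auto
      finally have ig: "(\<integral>x. ?g x \<partial>\<mu> k) = (\<Sum>i<?n. f (center m i) * measure (\<mu> k) (tree_cell m i))" .
      have "\<bar>(\<integral>x. f x \<partial>\<mu> k) - (\<integral>x. ?g x \<partial>\<mu> k)\<bar> = \<bar>\<integral>x. f x - ?g x \<partial>\<mu> k\<bar>"
        using intf intg by simp
      also have "\<dots> \<le> (\<integral>x. \<bar>f x - ?g x\<bar> \<partial>\<mu> k)" by (rule integral_abs_bound)
      also have "\<dots> \<le> (\<integral>x. \<eta> * indicat_real ?D x \<partial>\<mu> k)"
        using intf intg intD osc
        by (intro integral_mono integrable_abs Bochner_Integration.integrable_diff integrable_mult_right) (auto simp: space_\<mu>)
      also have "\<dots> = \<eta> * measure (\<mu> k) ?D" using Dk(2) by simp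
      also have "\<dots> \<le> \<eta> * W" using elim(2) \<eta> by (intro mult_left_mono) auto
      also have "\<dots> = \<epsilon> / 3" using W by (simp add: \<eta>_def)
      finally show ?case using elim(1) m(2) unfolding ig dist_real_def by linarith
    qed
  qed
qed

end

section \<open>Expected persistence measures\<close>

lemma sets_measure_of_Delta: "sets (measure_of Delta (sets (restrict_space borel Delta)) f) = sets (restrict_space borel Delta)"
proof -
  have sp: "space (restrict_space borel Delta) = Delta" by (simp add: space_restrict_space)
  have "sets (restrict_space borel Delta) \<subseteq> Pow Delta" using sets.space_closed[of "restrict_space borel Delta"] sp by simp
  then show ?thesis using sets.sigma_sets_eq[of "restrict_space borel Delta"] sp by simp
qed

lemma emeasure_measure_of_Delta:
  assumes "f {} = 0" "B \<in> sets (restrict_space borel Delta)"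
    and "\<And>E. range E \<subseteq> sets (restrict_space borel Delta) \<Longrightarrow> disjoint_family E \<Longrightarrow> (\<Sum>n. f (E n)) = f (\<Union>n. E n)"
  shows "emeasure (measure_of Delta (sets (restrict_space borel Delta)) f) B = f B"
proof (rule emeasure_measure_of[OF refl])
  show "sets (restrict_space borel Delta) \<subseteq> Pow Delta"
    using sets.space_closed[of "restrict_space borel Delta"] by (simp add: space_restrict_space)
qed (use assms in \<open>auto simp: sets_measure_of_Delta positive_def countably_additive_def\<close>)

lemma size_filter_eq_sum_indicator:
  "(of_nat (size (filter_mset (\<lambda>x. x \<in> B) D)) :: ennreal) = (\<Sum>x\<in>set_mset D. of_nat (count D x) * indicator B x)"
proof -
  have "size (filter_mset (\<lambda>x. x \<in> B) D) = (\<Sum>x\<in>{x \<in> set_mset D. x \<in> B}. count D x)"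
    by (simp add: size_multiset_overloaded_eq)
  also have "\<dots> = (\<Sum>x\<in>set_mset D. if x \<in> B then count D x else 0)"
    by (simp add: sum.inter_filter)
  finally have eq: "size (filter_mset (\<lambda>x. x \<in> B) D) = (\<Sum>x\<in>set_mset D. if x \<in> B then count D x else 0)" .
  show ?thesis unfolding eq of_nat_sum by (intro sum.cong) (auto simp: indicator_def)
qed

lemma emeasure_mset_measure:
  assumes "B \<in> sets (restrict_space borel Delta)"
  shows "emeasure (mset_measure D) B = of_nat (size (filter_mset (\<lambda>x. x \<in> B) D))"
  unfolding mset_measure_def
proof (rule emeasure_measure_of_Delta[OF _ assms])
  fix E :: "nat \<Rightarrow> (real \<times> real) set" assume "disjoint_family E"
  then have "(\<Sum>n. of_nat (count D x) * indicator (E n) x) = (of_nat (count D x) * indicator (\<Union>n. E n) x :: ennreal)" for x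
    by (simp add: suminf_indicator)
  then show "(\<Sum>n. of_nat (size (filter_mset (\<lambda>x. x \<in> E n) D))) = (of_nat (size (filter_mset (\<lambda>x. x \<in> (\<Union>n. E n)) D)) :: ennreal)"
    unfolding size_filter_eq_sum_indicator by (subst suminf_sum) auto
qed simp

lemma size_filter_sum_mset: "size (filter_mset P (\<Sum>l<(n::nat). D l)) = (\<Sum>l<n. size (filter_mset P (D l)))"
  by (induction n) auto

definition half_open_rects :: "(real \<times> real) set set" where
  "half_open_rects = {{b1<..b2} \<times> {d1<..d2} | b1 b2 d1 d2. b2 < d1}"

lemma half_open_rectsI: "b2 < d1 \<Longrightarrow> {b1<..b2} \<times> {d1<..d2} \<in> half_open_rects"
  by (auto simp: half_open_rects_def)

lemma Int_stable_half_open_rects: "Int_stable half_open_rects"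
  unfolding Int_stable_def
proof (intro ballI)
  fix R S assume "R \<in> half_open_rects" "S \<in> half_open_rects"
  then obtain b1 b2 d1 d2 b1' b2' d1' d2' :: real
    where "R = {b1<..b2} \<times> {d1<..d2}" "S = {b1'<..b2'} \<times> {d1'<..d2'}" and le: "b2 < d1" "b2' < d1'"
    unfolding half_open_rects_def by blast
  then have "R \<inter> S = {max b1 b1'<..min b2 b2'} \<times> {max d1 d1'<..min d2 d2'}" by auto
  then show "R \<inter> S \<in> half_open_rects" using half_open_rectsI[of "min b2 b2'" "max d1 d1'"] le by auto
qed

lemma rat_rect_half_open: "rat_rect i \<in> half_open_rects"
proof -
  obtain a b c d :: rat where eq: "from_nat i = (a, b, c, d)" by (metis prod_cases4)
  show ?thesis
  proof (cases "b < c")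
    case True
    then show ?thesis by (simp add: rat_rect_def eq half_open_rectsI of_rat_less)
  next
    case False
    then show ?thesis using half_open_rectsI[of 0 1 0 1] by (simp add: rat_rect_def eq)
  qed
qed

lemma open_eq_UN_rat_rects:
  assumes "open V" "V \<subseteq> Delta"
  shows "V = (\<Union>i\<in>{i. rat_rect i \<subseteq> V}. rat_rect i)"
proof (intro equalityI subsetI)
  fix p assume p: "p \<in> V"
  obtain e where e: "e > 0" "ball p e \<subseteq> V" using assms(1) p openE by blast
  obtain i where i: "p \<in> interior (rat_rect i)" "\<forall>x\<in>rat_rect i. \<forall>y\<in>rat_rect i. dist x y < e"
    using rat_rect_local[of p e] e(1) p assms(2) by blast
  have "p \<in> rat_rect i" using i(1) interior_subset by blast
  moreover from this have "rat_rect i \<subseteq> V" using i(2) e(2) by (auto simp: subset_iff)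
  ultimately show "p \<in> (\<Union>i\<in>{i. rat_rect i \<subseteq> V}. rat_rect i)" by blast
qed auto

text \<open>Open subsets of \<open>Delta\<close> are countable unions of rational rectangles.\<close>

lemma sigma_sets_half_open_rects: "sigma_sets Delta half_open_rects = sets (restrict_space borel Delta)"
proof
  have "R \<in> sets (restrict_space borel Delta)" if "R \<in> half_open_rects" for R
    using that step_set_rect step_set_borel step_set_subset unfolding half_open_rects_def sets_restrict_Delta by blast
  then have "sigma_sets (space (restrict_space borel Delta)) half_open_rects \<subseteq> sets (restrict_space borel Delta)"
    by (intro sets.sigma_sets_subset) auto
  then show "sigma_sets Delta half_open_rects \<subseteq> sets (restrict_space borel Delta)"
    by (simp add: space_restrict_space)
  have "sets (restrict_space borel Delta) = (\<inter>) Delta ` sigma_sets UNIV {S. open S}"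
    by (simp add: sets_restrict_space borel_def)
  also have "\<dots> = sigma_sets Delta ((\<inter>) Delta ` {S. open S})"
    using Delta_borel by (intro sigma_sets_Int) (auto simp: borel_def)
  also have "\<dots> \<subseteq> sigma_sets Delta half_open_rects"
  proof (rule sigma_sets_mono, safe)
    fix V :: "(real \<times> real) set" assume "open V"
    then have "Delta \<inter> V = (\<Union>i\<in>{i. rat_rect i \<subseteq> Delta \<inter> V}. rat_rect i)"
      using open_Delta by (intro open_eq_UN_rat_rects) auto
    also have "\<dots> = (\<Union>i. if rat_rect i \<subseteq> Delta \<inter> V then rat_rect i else {})" by auto
    also have "\<dots> \<in> sigma_sets Delta half_open_rects"
      by (intro sigma_sets.Union) (auto intro: sigma_sets.Basic rat_rect_half_open sigma_sets.Empty)
    finally show "Delta \<inter> V \<in> sigma_sets Delta half_open_rects" .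
  qed
  finally show "sets (restrict_space borel Delta) \<subseteq> sigma_sets Delta half_open_rects" .
qed

lemma Delta_eq_UN_tree_cells: "(\<Union>i. tree_cell 0 i) = Delta"
proof
  show "(\<Union>i. tree_cell 0 i) \<subseteq> Delta" using step_set_subset[OF tree_cell_step] by blast
  show "Delta \<subseteq> (\<Union>i. tree_cell 0 i)"
  proof
    fix p assume "p \<in> Delta"
    then obtain i where "p \<in> rat_rect i" using rat_rect_local[of p 1] interior_subset by fastforce
    then have "p \<in> (\<Union>i<Suc i. rat_rect i)" by auto
    then show "p \<in> (\<Union>i. tree_cell 0 i)" unfolding tree_cell_cover[of 0 "Suc i", symmetric] by blast
  qed
qed


text \<open>A Dynkin argument, with half-open rectangles as generators. Complements require that the total mass is
  measurable; it is the sum of the masses of the disjoint cells of level \<open>0\<close>, each of which is a finite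
  combination of rectangles.\<close>

lemma measurable_random_measure:
  assumes sets: "\<And>\<omega>. sets (\<rho> \<omega>) = sets (restrict_space borel Delta)"
    and fin: "\<And>\<omega>. \<omega> \<in> space M \<Longrightarrow> emeasure (\<rho> \<omega>) Delta < \<infinity>"
    and rect: "\<And>R. R \<in> half_open_rects \<Longrightarrow> (\<lambda>\<omega>. emeasure (\<rho> \<omega>) R) \<in> borel_measurable M"
    and B: "B \<in> sets (restrict_space borel Delta)"
  shows "(\<lambda>\<omega>. emeasure (\<rho> \<omega>) B) \<in> borel_measurable M"
proof -
  have space: "space (\<rho> \<omega>) = Delta" for \<omega>
    using sets_eq_imp_space_eq[OF sets] by (simp add: space_restrict_space)
  have finite: "emeasure (\<rho> \<omega>) C < \<infinity>" if "\<omega> \<in> space M" for C \<omega>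
    using emeasure_space[of "\<rho> \<omega>" C] fin[OF that] unfolding space by (rule le_less_trans)
  have step: "(\<forall>\<omega>\<in>space M. integrable (\<rho> \<omega>) f) \<and> (\<lambda>\<omega>. \<integral>x. f x \<partial>\<rho> \<omega>) \<in> borel_measurable M" if "step_fun f" for f
    using that
  proof induction
    case (rect b2 d1 b1 d2)
    let ?R = "{b1<..b2} \<times> {d1<..d2}"
    note R' = step_set_rect[OF rect, of b1 d2]
    have R: "?R \<in> sets (\<rho> \<omega>)" "?R \<inter> space (\<rho> \<omega>) = ?R" for \<omega>
      using step_set_subset[OF R'] step_set_borel[OF R'] by (auto simp: sets sets_restrict_Delta space)
    have "(\<lambda>\<omega>. enn2real (emeasure (\<rho> \<omega>) ?R)) \<in> borel_measurable M"
      using assms(3)[OF half_open_rectsI[OF rect, of b1 d2]] by measurable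
    then show ?case using finite R by (auto simp: integrable_indicator_iff measure_def)
  next
    case (add f g)
    have "(\<lambda>\<omega>. (\<integral>x. f x \<partial>\<rho> \<omega>) + (\<integral>x. g x \<partial>\<rho> \<omega>)) \<in> borel_measurable M"
      using add by (intro borel_measurable_add) auto
    also have "?this \<longleftrightarrow> (\<lambda>\<omega>. \<integral>x. f x + g x \<partial>\<rho> \<omega>) \<in> borel_measurable M"
      using add by (intro measurable_cong) auto
    finally show ?case using add by auto
  next
    case (scale f a)
    then show ?case by auto
  qed
  have step_set: "(\<lambda>\<omega>. emeasure (\<rho> \<omega>) C) \<in> borel_measurable M" if C: "step_set C" for C
  proof -
    have Cs: "C \<inter> space (\<rho> \<omega>) = C" for \<omega> using step_set_subset[OF C] space by auto
    have "(\<lambda>\<omega>. ennreal (\<integral>x. indicat_real C x \<partial>\<rho> \<omega>)) \<in> borel_measurable M"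
      by (rule measurable_compose[OF conjunct2[OF step[OF C[unfolded step_set_def]]] measurable_ennreal])
    also have "?this \<longleftrightarrow> ?thesis"
      using finite by (intro measurable_cong) (simp add: Cs emeasure_eq_ennreal_measure less_top)
    finally show ?thesis .
  qed
  have total: "(\<lambda>\<omega>. emeasure (\<rho> \<omega>) Delta) \<in> borel_measurable M"
  proof -
    have "(\<lambda>\<omega>. \<Sum>i. emeasure (\<rho> \<omega>) (tree_cell 0 i)) \<in> borel_measurable M"
      by (intro borel_measurable_suminf_order step_set tree_cell_step)
    moreover have "(\<Sum>i. emeasure (\<rho> \<omega>) (tree_cell 0 i)) = emeasure (\<rho> \<omega>) Delta" for \<omega>
    proof -
      have "range (tree_cell 0) \<subseteq> sets (\<rho> \<omega>)"
        using step_set_subset[OF tree_cell_step] step_set_borel[OF tree_cell_step] by (auto simp: sets sets_restrict_Delta simp del: tree_cell.simps)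
      moreover have "disjoint_family (tree_cell 0)" using tree_cell_disjoint by (auto simp: disjoint_family_on_def simp del: tree_cell.simps)
      ultimately show ?thesis using suminf_emeasure Delta_eq_UN_tree_cells by metis
    qed
    ultimately show ?thesis by simp
  qed
  have "half_open_rects \<subseteq> Pow Delta"
    using step_set_rect step_set_subset unfolding half_open_rects_def by blast
  from Int_stable_half_open_rects this B[folded sigma_sets_half_open_rects] show ?thesis
  proof (induction rule: sigma_sets_induct_disjoint)
    case (basic R)
    then show ?case by (rule rect)
  next
    case empty
    show ?case by simp
  next
    case (compl C)
    have "(\<lambda>\<omega>. emeasure (\<rho> \<omega>) Delta - emeasure (\<rho> \<omega>) C) \<in> borel_measurable M"
      by (rule borel_measurable_minus_ennreal[OF total compl.IH])
    also have "?this \<longleftrightarrow> ?case"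
    proof (rule measurable_cong)
      fix \<omega> assume \<omega>: "\<omega> \<in> space M"
      have C: "C \<in> sets (\<rho> \<omega>)" using compl.hyps by (simp add: sets sigma_sets_half_open_rects)
      show "emeasure (\<rho> \<omega>) Delta - emeasure (\<rho> \<omega>) C = emeasure (\<rho> \<omega>) (Delta - C)"
        using emeasure_compl[OF C] finite[OF \<omega>, of C] by (simp add: space less_top)
    qed
    finally show ?case .
  next
    case (union E)
    have "(\<lambda>\<omega>. \<Sum>i. emeasure (\<rho> \<omega>) (E i)) \<in> borel_measurable M"
      by (intro borel_measurable_suminf_order union.IH)
    moreover have "(\<Sum>i. emeasure (\<rho> \<omega>) (E i)) = emeasure (\<rho> \<omega>) (\<Union>i. E i)" for \<omega>
      using union.hyps by (intro suminf_emeasure) (auto simp: sets sigma_sets_half_open_rects)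
    ultimately show ?case by simp
  qed
qed

context stationary_process
begin

text \<open>The rectangle formula without subtraction, so that it can be integrated with values in the extended
  nonnegative reals.\<close>

lemma Dgm_count_identity:
  fixes F :: "'f::field itself"
  assumes "finite X" "b1 \<le> b2" "b2 < d1" "d1 \<le> d2"
  shows "size (filter_mset (\<lambda>x. x \<in> {b1<..b2} \<times> {d1<..d2}) (Dgm F l X)) + (rel_rank F l b2 d1 X + rel_rank F l b1 d2 X)
     = rel_rank F l b2 d2 X + rel_rank F l b1 d1 X"
  using Dgm_rectangle[OF assms(1,2) less_imp_le[OF assms(3)] assms(4), of F l]
  unfolding rect_mass_def by linarith

lemma Dgm_count_measurable:
  fixes F :: "'f::field itself"
  assumes A: "A \<in> bounded_borel" and le: "b1 \<le> b2" "b2 < d1" "d1 \<le> d2"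
  shows "(\<lambda>\<omega>. of_nat (size (filter_mset (\<lambda>x. x \<in> {b1<..b2} \<times> {d1<..d2}) (Dgm F l (atoms_in (\<xi> \<omega>) A)))) :: ennreal) \<in> borel_measurable M"
proof -
  note [measurable] = rel_rank_measurable[OF A]
  have "(\<lambda>\<omega>. of_nat ((rel_rank F l b2 d2 (atoms_in (\<xi> \<omega>) A) + rel_rank F l b1 d1 (atoms_in (\<xi> \<omega>) A))
      - (rel_rank F l b2 d1 (atoms_in (\<xi> \<omega>) A) + rel_rank F l b1 d2 (atoms_in (\<xi> \<omega>) A))) :: ennreal) \<in> borel_measurable M"
    by measurable
  also have "?this \<longleftrightarrow> ?thesis"
  proof (intro measurable_cong arg_cong[of _ _ of_nat])
    fix \<omega> assume "\<omega> \<in> space M"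
    from Dgm_count_identity[OF card_atoms_le(1)[OF counting[OF this] A] le, of F l]
    show "(rel_rank F l b2 d2 (atoms_in (\<xi> \<omega>) A) + rel_rank F l b1 d1 (atoms_in (\<xi> \<omega>) A))
      - (rel_rank F l b2 d1 (atoms_in (\<xi> \<omega>) A) + rel_rank F l b1 d2 (atoms_in (\<xi> \<omega>) A)) =
      size (filter_mset (\<lambda>x. x \<in> {b1<..b2} \<times> {d1<..d2}) (Dgm F l (atoms_in (\<xi> \<omega>) A)))" by simp
  qed
  finally show ?thesis .
qed

lemma diagram_measure_eq:
  assumes "B \<in> sets (restrict_space borel Delta)"
  shows "emeasure (persistence_diagram_measure F \<xi> \<omega> A) B =
    (\<Sum>l<DIM('a). of_nat (size (filter_mset (\<lambda>x. x \<in> B) (Dgm F l (atoms_in (\<xi> \<omega>) A)))))"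
  unfolding persistence_diagram_measure_def emeasure_mset_measure[OF assms] size_filter_sum_mset by simp

lemma diagram_measure_measurable:
  fixes F :: "'f::field itself"
  assumes A: "A \<in> bounded_borel" and B: "B \<in> sets (restrict_space borel Delta)"
  shows "(\<lambda>\<omega>. emeasure (persistence_diagram_measure F \<xi> \<omega> A) B) \<in> borel_measurable M"
proof (rule measurable_random_measure[OF _ _ _ B])
  show sets: "sets (persistence_diagram_measure F \<xi> \<omega> A) = sets (restrict_space borel Delta)" for \<omega>
    unfolding persistence_diagram_measure_def mset_measure_def by (rule sets_measure_of_Delta)
  show "emeasure (persistence_diagram_measure F \<xi> \<omega> A) Delta < \<infinity>" for \<omega>
    by (simp add: diagram_measure_eq sets_restrict_Delta ennreal_of_nat_eq_real_of_nat)
  fix R assume "R \<in> half_open_rects"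
  then obtain b1 b2 d1 d2 where R: "R = {b1<..b2} \<times> {d1<..d2}" "b2 < d1" by (auto simp: half_open_rects_def)
  have Rs: "R \<in> sets (restrict_space borel Delta)"
    using step_set_rect[OF R(2)] step_set_borel step_set_subset by (simp add: R(1) sets_restrict_Delta)
  show "(\<lambda>\<omega>. emeasure (persistence_diagram_measure F \<xi> \<omega> A) R) \<in> borel_measurable M"
  proof (cases "b1 \<le> b2 \<and> d1 \<le> d2")
    case True
    then show ?thesis unfolding diagram_measure_eq[OF Rs] unfolding R(1)
      using R(2) by (intro borel_measurable_sum Dgm_count_measurable[OF A]) auto
  next
    case False
    then have "R = {}" by (auto simp: R)
    then show ?thesis by simp
  qed
qed

lemma sets_expectation_measure: "sets (persistence_expectation_measure F M \<xi> A) = sets (restrict_space borel Delta)"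
  unfolding persistence_expectation_measure_def by (rule sets_measure_of_Delta)

text \<open>The set function in the definition is countably additive because the integrands are measurable.\<close>

lemma emeasure_expectation_measure:
  fixes F :: "'f::field itself"
  assumes A: "A \<in> bounded_borel" and B: "B \<in> sets (restrict_space borel Delta)"
  shows "emeasure (persistence_expectation_measure F M \<xi> A) B = (\<integral>\<^sup>+\<omega>. emeasure (persistence_diagram_measure F \<xi> \<omega> A) B \<partial>M)"
  unfolding persistence_expectation_measure_def
proof (rule emeasure_measure_of_Delta[OF _ B])
  fix E :: "nat \<Rightarrow> (real \<times> real) set"
  assume E: "range E \<subseteq> sets (restrict_space borel Delta)" "disjoint_family E"
  have "(\<Sum>n. \<integral>\<^sup>+\<omega>. emeasure (persistence_diagram_measure F \<xi> \<omega> A) (E n) \<partial>M)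
    = (\<integral>\<^sup>+\<omega>. (\<Sum>n. emeasure (persistence_diagram_measure F \<xi> \<omega> A) (E n)) \<partial>M)"
    using E(1) by (intro nn_integral_suminf[symmetric] diagram_measure_measurable[OF A]) auto
  also have "\<dots> = (\<integral>\<^sup>+\<omega>. emeasure (persistence_diagram_measure F \<xi> \<omega> A) (\<Union>n. E n) \<partial>M)"
  proof (rule nn_integral_cong)
    fix \<omega>
    have "sets (persistence_diagram_measure F \<xi> \<omega> A) = sets (restrict_space borel Delta)"
      unfolding persistence_diagram_measure_def mset_measure_def by (rule sets_measure_of_Delta)
    then show "(\<Sum>n. emeasure (persistence_diagram_measure F \<xi> \<omega> A) (E n)) = emeasure (persistence_diagram_measure F \<xi> \<omega> A) (\<Union>n. E n)"
      using E by (intro suminf_emeasure) auto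
  qed
  finally show "(\<Sum>n. \<integral>\<^sup>+\<omega>. emeasure (persistence_diagram_measure F \<xi> \<omega> A) (E n) \<partial>M)
    = (\<integral>\<^sup>+\<omega>. emeasure (persistence_diagram_measure F \<xi> \<omega> A) (\<Union>n. E n) \<partial>M)" .
qed simp

lemma expectation_measure_rectangle:
  fixes F :: "'f::field itself"
  assumes A: "A \<in> bounded_borel" and le: "b1 \<le> b2" "b2 < d1" "d1 \<le> d2"
  defines "u \<equiv> \<lambda>l r s. enn2real (mean_rank F l r s A)"
  shows "emeasure (persistence_expectation_measure F M \<xi> A) ({b1<..b2} \<times> {d1<..d2})
    = ennreal (\<Sum>l<DIM('a). u l b2 d2 - u l b2 d1 - u l b1 d2 + u l b1 d1)"
    and "(\<Sum>l<DIM('a). u l b2 d2 - u l b2 d1 - u l b1 d2 + u l b1 d1) \<ge> 0"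
proof -
  let ?R = "{b1<..b2} \<times> {d1<..d2}"
  have Rs: "?R \<in> sets (restrict_space borel Delta)"
    using step_set_rect[OF le(2)] step_set_borel step_set_subset by (simp add: sets_restrict_Delta)
  define e where "e l = (\<integral>\<^sup>+\<omega>. of_nat (size (filter_mset (\<lambda>x. x \<in> ?R) (Dgm F l (atoms_in (\<xi> \<omega>) A)))) \<partial>M)" for l
  have u: "mean_rank F l r s A = ennreal (u l r s)" "u l r s \<ge> 0" for l r s
    using mean_rank_finite[OF A, of F l r s] by (simp_all add: u_def)
  have e: "e l = ennreal (u l b2 d2 - u l b2 d1 - u l b1 d2 + u l b1 d1) \<and> u l b2 d2 - u l b2 d1 - u l b1 d2 + u l b1 d1 \<ge> 0" for l
  proof -
    note [measurable] = rel_rank_measurable_ennreal[OF A] Dgm_count_measurable[OF A le]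
    have "e l + (mean_rank F l b2 d1 A + mean_rank F l b1 d2 A) = mean_rank F l b2 d2 A + mean_rank F l b1 d1 A"
    proof -
      let ?s = "\<lambda>\<omega>. of_nat (size (filter_mset (\<lambda>x. x \<in> ?R) (Dgm F l (atoms_in (\<xi> \<omega>) A)))) :: ennreal"
      let ?u = "\<lambda>r s \<omega>. of_nat (rel_rank F l r s (atoms_in (\<xi> \<omega>) A)) :: ennreal"
      have "e l + (mean_rank F l b2 d1 A + mean_rank F l b1 d2 A) = (\<integral>\<^sup>+\<omega>. ?s \<omega> + (?u b2 d1 \<omega> + ?u b1 d2 \<omega>) \<partial>M)"
        unfolding e_def mean_rank_def
        by (subst nn_integral_add, measurable, subst nn_integral_add, measurable)
      also have "\<dots> = (\<integral>\<^sup>+\<omega>. ?u b2 d2 \<omega> + ?u b1 d1 \<omega> \<partial>M)"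
        unfolding of_nat_add[symmetric]
        by (intro nn_integral_cong arg_cong[of _ _ of_nat] Dgm_count_identity[OF card_atoms_le(1)[OF counting A] le])
      also have "\<dots> = mean_rank F l b2 d2 A + mean_rank F l b1 d1 A"
        unfolding mean_rank_def by (rule nn_integral_add) measurable
      finally show ?thesis .
    qed
    then have eq: "e l + ennreal (u l b2 d1 + u l b1 d2) = ennreal (u l b2 d2 + u l b1 d1)"
      by (simp add: u)
    then have "e l < \<infinity>" by (metis ennreal_add_eq_top ennreal_neq_top infinity_ennreal_def less_top)
    then obtain x where x: "e l = ennreal x" "x \<ge> 0" by (metis ennreal_cases infinity_ennreal_def less_irrefl)
    from eq have "ennreal (x + (u l b2 d1 + u l b1 d2)) = ennreal (u l b2 d2 + u l b1 d1)"
      using x u(2) by simp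
    then have "x + (u l b2 d1 + u l b1 d2) = u l b2 d2 + u l b1 d1"
      using x u(2) by (subst (asm) ennreal_inj) (auto intro!: add_nonneg_nonneg)
    then have "x = u l b2 d2 - u l b2 d1 - u l b1 d2 + u l b1 d1" by linarith
    then show ?thesis using x by simp
  qed
  then show "(\<Sum>l<DIM('a). u l b2 d2 - u l b2 d1 - u l b1 d2 + u l b1 d1) \<ge> 0"
    by (intro sum_nonneg) blast
  have "emeasure (persistence_expectation_measure F M \<xi> A) ?R = (\<Sum>l<DIM('a). e l)"
    unfolding emeasure_expectation_measure[OF A Rs] diagram_measure_eq[OF Rs] e_def
    by (intro nn_integral_sum Dgm_count_measurable[OF A le])
  also have "\<dots> = (\<Sum>l<DIM('a). ennreal (u l b2 d2 - u l b2 d1 - u l b1 d2 + u l b1 d1))"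
    using e by (intro sum.cong) auto
  also have "\<dots> = ennreal (\<Sum>l<DIM('a). u l b2 d2 - u l b2 d1 - u l b1 d2 + u l b1 d1)"
    using e by (intro sum_ennreal) blast
  finally show "emeasure (persistence_expectation_measure F M \<xi> A) ?R
    = ennreal (\<Sum>l<DIM('a). u l b2 d2 - u l b2 d1 - u l b1 d2 + u l b1 d1)" .
qed

text \<open>The mass of a rectangle is a combination of finitely many mean ranks, each of which has a limiting
  density. Rectangles with reversed end points are empty.\<close>

lemma rectangle_convergent_expectation_measures:
  fixes F :: "'f::field itself" and A :: "nat \<Rightarrow> 'a set"
  assumes A: "convex_averaging_sequence A"
  shows "rectangle_convergent (\<lambda>k. scale_measure (1 / emeasure lborel (A k)) (persistence_expectation_measure F M \<xi> (A k)))"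
proof
  let ?p = "\<lambda>k. persistence_expectation_measure F M \<xi> (A k)"
  let ?\<mu> = "\<lambda>k. scale_measure (1 / emeasure lborel (A k)) (?p k)"
  show "sets (?\<mu> k) = sets (restrict_space borel Delta)" for k
    by (simp add: sets_expectation_measure)
  fix b1 b2 d1 d2 :: real assume bd: "b2 < d1"
  let ?R = "{b1<..b2} \<times> {d1<..d2}"
  define V where "V k = measure lborel (A k)" for k
  define u where "u k l r s = enn2real (mean_rank F l r s (A k))" for k l r s
  define x where "x k = (\<Sum>l<DIM('a). u k l b2 d2 / V k - u k l b2 d1 / V k - u k l b1 d2 / V k + u k l b1 d1 / V k)" for k
  have bb: "A k \<in> bounded_borel" for k using A by (auto simp: convex_averaging_sequence_def)
  have "\<forall>\<^sub>F k in sequentially. V k > 0"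
    unfolding V_def by (rule averaging_sequence_volume_pos[OF A])
  then have ev: "\<forall>\<^sub>F k in sequentially. emeasure (?\<mu> k) ?R < \<infinity> \<and> measure (?\<mu> k) ?R = (if b1 \<le> b2 \<and> d1 \<le> d2 then x k else 0)"
  proof eventually_elim
    case (elim k)
    have "emeasure lborel (A k) < \<infinity>" using emeasure_bounded_finite[of "A k"] bb[of k] by (simp add: bounded_borel_def)
    then have V: "emeasure lborel (A k) = ennreal (V k)" by (simp add: V_def emeasure_eq_ennreal_measure less_top)
    show ?case
    proof (cases "b1 \<le> b2 \<and> d1 \<le> d2")
      case True
      note r = expectation_measure_rectangle[OF bb[of k], of b1 b2 d1 d2 F]
      define y where "y = (\<Sum>l<DIM('a). u k l b2 d2 - u k l b2 d1 - u k l b1 d2 + u k l b1 d1)"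
      have y: "emeasure (?p k) ?R = ennreal y" "y \<ge> 0"
        using r True bd by (simp_all add: y_def u_def)
      have "emeasure (?\<mu> k) ?R = 1 / ennreal (V k) * ennreal y" by (simp add: y V)
      also have "1 / ennreal (V k) = ennreal (1 / V k)"
        using divide_ennreal[of 1 "V k"] elim by simp
      also have "ennreal (1 / V k) * ennreal y = ennreal (y / V k)"
        using elim y(2) by (simp add: ennreal_mult[symmetric])
      finally have em: "emeasure (?\<mu> k) ?R = ennreal (y / V k)" .
      have yx: "y / V k = x k"
        by (simp add: x_def y_def sum_divide_distrib diff_divide_distrib add_divide_distrib)
      have "x k \<ge> 0" using y(2) elim unfolding yx[symmetric] by simp
      then have "measure (?\<mu> k) ?R = x k" unfolding measure_def em yx by (rule enn2real_ennreal)
      then show ?thesis using em True by simp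
    next
      case False
      then have R: "?R = {}" by auto
      show ?thesis unfolding R if_not_P[OF False] by simp
    qed
  qed
  then show "\<forall>\<^sub>F k in sequentially. emeasure (?\<mu> k) ?R < \<infinity>" by (rule eventually_mono) simp
  have "convergent (\<lambda>k. u k l r s / V k)" for l r s
    unfolding u_def V_def by (rule mean_rank_density_converges[OF A])
  then have "convergent x" unfolding x_def
    by (intro convergent_sum convergent_add convergent_diff) auto
  then have lim: "convergent (\<lambda>k. if P then x k else 0)" for P by (cases P) (simp_all add: convergent_const)
  have "\<forall>\<^sub>F k in sequentially. measure (?\<mu> k) ?R = (if b1 \<le> b2 \<and> d1 \<le> d2 then x k else 0)"
    using ev by (rule eventually_mono) simp
  from convergent_cong[OF this] lim show "convergent (\<lambda>k. measure (?\<mu> k) ?R)" by blast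
qed

end

theorem theorem3p4:
  fixes M :: "'w measure"
    and \<xi> :: "'w \<Rightarrow> (real ^ 'n) measure"
    and A :: "nat \<Rightarrow> (real ^ 'n) set"
  assumes "prob_space M"
    and "point_process M \<xi>"
    and "positive_intensity M \<xi>"
    and "simple_process M \<xi>"
    and "all_moments_finite M \<xi>"
    and "convex_averaging_sequence A"
    and "balanced A"
    and "stationary M \<xi>"
  shows "\<exists>!\<PP>. radon_measure_on Delta \<PP> \<and>
           vague_convergence_on Delta
             (\<lambda>k. scale_measure (1 / emeasure lborel (A k))
                    (persistence_expectation_measure TYPE('f::field) M \<xi> (A k)))
             \<PP>"
proof -
  let ?\<mu> = "\<lambda>k. scale_measure (1 / emeasure lborel (A k)) (persistence_expectation_measure TYPE('f) M \<xi> (A k))"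
  interpret stationary_process M \<xi> by (rule stationary_process.intro) (fact assms)+
  interpret rectangle_convergent ?\<mu> by (rule rectangle_convergent_expectation_measures[OF assms(6)])
  show ?thesis
  proof (intro ex1I conjI)
    show "radon_measure_on Delta limit_measure" by (rule radon_limit_measure)
    show "vague_convergence_on Delta ?\<mu> limit_measure" by (rule vague_convergence_limit_measure)
  next
    fix P assume P: "radon_measure_on Delta P \<and> vague_convergence_on Delta ?\<mu> P"
    show "P = limit_measure"
    proof (rule radon_measure_eqI[OF open_Delta _ radon_limit_measure])
      show "radon_measure_on Delta P" using P by simp
      fix f :: "real \<times> real \<Rightarrow> real"
      assume "continuous_on Delta f" "\<exists>K. compact K \<and> K \<subseteq> Delta \<and> (\<forall>x\<in>Delta - K. f x = 0)"
      then show "(\<integral>x. f x \<partial>P) = (\<integral>x. f x \<partial>limit_measure)"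
        using P vague_convergence_limit_measure unfolding vague_convergence_on_def
        by (intro LIMSEQ_unique[of "\<lambda>k. \<integral>x. f x \<partial>?\<mu> k"]) auto
    qed
  qed
qed

end
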